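(* There are a fine filter $\Gamma$ over $[\mathbb R^{<\omega}]^{<\omega}$ and a $\ll$-increasing sequence of positive infinitesimals $\langle\varepsilon_i:i<\omega\rangle\subseteq\mathrm{Pow}(\mathbb R,\Gamma)$ such that, if $m(A)=\int\chi_A\,d\Gamma$ for $A\subseteq\mathbb R^{<\omega}$, then: 1. $\varepsilon_n=m([0,1]^n)$, the measure of the $n$-dimensional unit cube. 2. For any measurable fragment $A$ of an $n$-dimensional piecewise smooth surface $S$, $m(A)=\mathrm{vol}_n(A)\,\varepsilon_n+\delta$, where $\delta\ll\varepsilon_n$. 3. For any countable $C\subseteq\mathbb R^{<\omega}$, $m(C)\ll\varepsilon_1$. 4. For any middling Borel set $A\subseteq\mathbb R^{<\omega}$ and any $\vec x\in\mathbb R^{<\omega}$, $m(A+\vec x)\approx m(A)$.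
   Context: $\mathbb R^{<\omega}$ is the real vector space of $\omega$-sequences of reals that are eventually zero, with the Euclidean norm (Borel refers to its topology). $\mathbb R^n$ is identified with the set of $\vec x$ with $\vec x(j)=0$ for all $j\ge n$, and $[0,1]^n\subseteq\mathbb R^n\subseteq\mathbb R^{<\omega}$ accordingly. For a set $X$, $[X]^{<\omega}$ is the set of finite subsets of $X$; a (proper) filter $F$ over $[X]^{<\omega}$ is fine if $\{z:x\in z\}\in F$ for all $x\in X$. $\mathrm{Pow}(\mathbb R,F)$ is the set of functions $[X]^{<\omega}\to\mathbb R$ modulo agreeing on a set in $F$, with pointwise ring operations, $[g]_F<[h]_F$ iff $\{z:g(z)<h(z)\}\in F$, and $\mathbb R$ embedded via constants. $\int f\,dF=\left[z\mapsto\frac1{|z|}\sum_{x\in z}f(x)\right]_F$. For $a,b\in\mathrm{Pow}(\mathbb R,F)$: $a\ll b$ means $b>0$ and $-b<na<b$ for all $n\in\mathbb Z$; $a$ is infinitesimal if $a\ll1$; $a\sim b$ if $a-b$ is infinitesimal; $a\approx b$ if $b$ is invertible and $ab^{-1}\sim1$. Surfaces: $S\subseteq\mathbb R^N$ is a parameterized $k$-dimensional smooth surface if there are bounded open $U\subseteq V\subseteq\mathbb R^k$ with $\bar U\subseteq V$ and an injective $\varphi:V\to\mathbb R^N$ with $S=\varphi[U]$ and $\varphi,\varphi^{-1}$ both continuously differentiable. If $A\subseteq U$ is Lebesgue measurable, then $\varphi[A]$ is a measurable fragment of $S$, and $\mathrm{vol}_k(\varphi[A])=\int_A\sqrt{\det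 G_\varphi(\vec x)}\,d\vec x$, where $G_\varphi$ is the Gram matrix of inner products of partial derivatives of $\varphi$; this is independent of the parameterization. A $k$-dimensional piecewise smooth surface is a finite union of parameterized $k$-dimensional smooth surfaces in some $\mathbb R^N$. A measurable fragment $A$ of a piecewise smooth surface $S$ is a subset of $S$ that is a finite disjoint union of measurable fragments of parameterized $k$-dimensional smooth surfaces, and $\mathrm{vol}_k(A)$ is the sum of the volumes of the pieces (independent of the decomposition). Let $\mu_n$ be Lebesgue measure on $\mathbb R^n$. A set $A\subseteq\mathbb R^{<\omega}$ is middling if $\mu_n(A\cap\mathbb R^n)<\infty$ for all but finitely many $n<\omega$ and $\mu_n(A\cap\mathbb R^n)>0$ for infinitely many $n<\omega$. *)

theory Defs
  imports
    "HOL-Analysis.Analysis"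
    "HOL-Library.FSet"
    "HOL-Algebra.Ring"
    "Jordan_Normal_Form.Determinant"
begin

section \<open>The space of eventually zero real sequences\<close>

text \<open>
  A separate type is needed because the library's norm on \<open>nat \<Rightarrow>\<^sub>0 real\<close> is the sum norm,
  not the Euclidean one.
\<close>

typedef fseq = "{x :: nat \<Rightarrow> real. \<forall>\<^sub>F i in sequentially. x i = 0}"
  morphisms coord Abs_fseq
  by (rule exI[of _ "\<lambda>_. 0"]) simp

setup_lifting type_definition_fseq

lemma eventually_coord_eq_0: "\<forall>\<^sub>F i in sequentially. coord x i = 0"
  using coord[of x] by simp

lemma fseq_eqI: "(\<And>i. coord x i = coord y i) \<Longrightarrow> x = y"
  by (simp add: coord_inject[symmetric] fun_eq_iff)

instantiation fseq :: real_vector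
begin

lift_definition zero_fseq :: fseq is "\<lambda>_. 0" by simp

lift_definition plus_fseq :: "fseq \<Rightarrow> fseq \<Rightarrow> fseq" is "\<lambda>x y i. x i + y i"
  subgoal premises prems using prems by eventually_elim simp
  done

lift_definition minus_fseq :: "fseq \<Rightarrow> fseq \<Rightarrow> fseq" is "\<lambda>x y i. x i - y i"
  subgoal premises prems using prems by eventually_elim simp
  done

lift_definition uminus_fseq :: "fseq \<Rightarrow> fseq" is "\<lambda>x i. - x i"
  by simp

lift_definition scaleR_fseq :: "real \<Rightarrow> fseq \<Rightarrow> fseq" is "\<lambda>c x i. c * x i"
  subgoal premises prems using prems by eventually_elim simp
  done

instance
  by standard (transfer; simp add: algebra_simps)+

end

lemma coord_simps [simp]:
  "coord 0 i = 0"
  "coord (x + y) i = coord x i + coord y i"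
  "coord (x - y) i = coord x i - coord y i"
  "coord (- x) i = - coord x i"
  "coord (c *\<^sub>R x) i = c * coord x i"
  by (transfer; simp)+

lemma summable_coord_mult: "summable (\<lambda>i. coord x i * coord y i)"
proof -
  obtain N where "\<And>i. i \<ge> N \<Longrightarrow> coord x i = 0"
    using eventually_coord_eq_0[of x] unfolding eventually_sequentially by blast
  then show ?thesis
    by (intro summable_finite[of "{..<N}"]) auto
qed

instantiation fseq :: real_inner
begin

definition inner_fseq :: "fseq \<Rightarrow> fseq \<Rightarrow> real"
  where "inner_fseq x y = (\<Sum>i. coord x i * coord y i)"

definition norm_fseq :: "fseq \<Rightarrow> real"
  where "norm_fseq x = sqrt (inner x x)"

definition sgn_fseq :: "fseq \<Rightarrow> fseq"
  where "sgn_fseq x = x /\<^sub>R norm x"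

definition dist_fseq :: "fseq \<Rightarrow> fseq \<Rightarrow> real"
  where "dist_fseq x y = norm (x - y)"

definition uniformity_fseq :: "(fseq \<times> fseq) filter"
  where "uniformity_fseq = (INF e\<in>{0<..}. principal {(x, y). dist x y < e})"

definition open_fseq :: "fseq set \<Rightarrow> bool"
  where "open_fseq U \<longleftrightarrow> (\<forall>x\<in>U. \<forall>\<^sub>F (x', y) in uniformity. x' = x \<longrightarrow> y \<in> U)"

instance
proof
  fix x y z :: fseq and r :: real and U :: "fseq set"
  show "inner x y = inner y x"
    by (simp add: inner_fseq_def mult.commute)
  show "inner (x + y) z = inner x z + inner y z"
    by (simp add: inner_fseq_def distrib_right suminf_add summable_coord_mult)
  show "inner (r *\<^sub>R x) y = r * inner x y"
    by (simp add: inner_fseq_def mult.assoc suminf_mult summable_coord_mult)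
  show "0 \<le> inner x x"
    unfolding inner_fseq_def by (intro suminf_nonneg summable_coord_mult) simp
  show "inner x x = 0 \<longleftrightarrow> x = 0"
  proof
    assume "inner x x = 0"
    then have "\<forall>i. coord x i * coord x i = 0"
      unfolding inner_fseq_def
      by (subst (asm) suminf_eq_zero_iff) (auto simp: summable_coord_mult)
    then show "x = 0"
      by (intro fseq_eqI) simp
  qed (simp add: inner_fseq_def)
qed (fact dist_fseq_def sgn_fseq_def uniformity_fseq_def open_fseq_def norm_fseq_def)+

end

definition Rn :: "nat \<Rightarrow> fseq set"
  where "Rn n = {x. \<forall>j\<ge>n. coord x j = 0}"

definition unit_cube :: "nat \<Rightarrow> fseq set"
  where "unit_cube n = {x \<in> Rn n. \<forall>i<n. 0 \<le> coord x i \<and> coord x i \<le> 1}"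

lift_definition unit_fseq :: "nat \<Rightarrow> fseq" is "\<lambda>j i. if i = j then 1 else 0"
  subgoal for j by (rule eventually_mono[OF eventually_gt_at_top[of j]]) simp
  done

lift_definition extend_zero :: "nat \<Rightarrow> (nat \<Rightarrow> real) \<Rightarrow> fseq"
  is "\<lambda>n f i. if i < n then f i else 0"
  subgoal for n f by (rule eventually_mono[OF eventually_ge_at_top[of n]]) simp
  done

text \<open>
  Lebesgue measure on \<open>\<real>\<^sup>n\<close>, as a complete measure whose space is \<^term>\<open>Rn n\<close>.
\<close>

definition lebesgue_Rn :: "nat \<Rightarrow> fseq measure"
  where "lebesgue_Rn n = embed_measure (completion (Pi\<^sub>M {..<n} (\<lambda>_. lborel))) (extend_zero n)"

lemma coord_extend_zero: "coord (extend_zero n f) i = (if i < n then f i else 0)"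
  by transfer simp

lemma inj_on_extend_zero: "inj_on (extend_zero n) (Pi\<^sub>E {..<n} (\<lambda>_. UNIV))"
proof (rule inj_onI)
  fix f g :: "nat \<Rightarrow> real"
  assume *: "f \<in> Pi\<^sub>E {..<n} (\<lambda>_. UNIV)" "g \<in> Pi\<^sub>E {..<n} (\<lambda>_. UNIV)"
    and eq: "extend_zero n f = extend_zero n g"
  have "f i = g i" if "i < n" for i
    using arg_cong[OF eq, of "\<lambda>x. coord x i"] that by (simp add: coord_extend_zero)
  then show "f = g"
    using * by (intro PiE_ext) auto
qed

lemma space_lebesgue_Rn: "space (lebesgue_Rn n) = Rn n"
proof -
  have "x \<in> extend_zero n ` Pi\<^sub>E {..<n} (\<lambda>_. UNIV)" if "x \<in> Rn n" for x
  proof (rule image_eqI)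
    show "x = extend_zero n (restrict (coord x) {..<n})"
      using that by (intro fseq_eqI) (auto simp: coord_extend_zero Rn_def)
  qed auto
  then show ?thesis
    by (auto simp: lebesgue_Rn_def space_embed_measure space_PiM Rn_def coord_extend_zero)
qed


section \<open>Reduced powers of the reals\<close>

text \<open>
  A filter over the finite subsets of a type is a library filter on \<^typ>\<open>'a fset\<close>;
  the library admits the improper filter \<^term>\<open>bot\<close>, which has to be excluded separately.
\<close>

definition fine_filter :: "'a fset filter \<Rightarrow> bool"
  where "fine_filter F \<longleftrightarrow> (\<forall>x. \<forall>\<^sub>F z in F. x |\<in>| z)"

definition ae_eq :: "'a fset filter \<Rightarrow> (('a fset \<Rightarrow> real) \<times> ('a fset \<Rightarrow> real)) set"
  where "ae_eq F = {(g, h). \<forall>\<^sub>F z in F. g z = h z}"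

definition pow_class :: "'a fset filter \<Rightarrow> ('a fset \<Rightarrow> real) \<Rightarrow> ('a fset \<Rightarrow> real) set"
  where "pow_class F g = ae_eq F `` {g}"

definition pow_const :: "'a fset filter \<Rightarrow> real \<Rightarrow> ('a fset \<Rightarrow> real) set"
  where "pow_const F c = pow_class F (\<lambda>_. c)"

definition PowR :: "'a fset filter \<Rightarrow> ('a fset \<Rightarrow> real) set ring"
  where "PowR F =
    \<lparr>carrier = UNIV // ae_eq F,
     monoid.mult = (\<lambda>a b. \<Union>g\<in>a. \<Union>h\<in>b. pow_class F (\<lambda>z. g z * h z)),
     one = pow_const F 1,
     zero = pow_const F 0,
     add = (\<lambda>a b. \<Union>g\<in>a. \<Union>h\<in>b. pow_class F (\<lambda>z. g z + h z))\<rparr>"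

definition pow_less :: "'a fset filter \<Rightarrow> ('a fset \<Rightarrow> real) set \<Rightarrow> ('a fset \<Rightarrow> real) set \<Rightarrow> bool"
  where "pow_less F a b \<longleftrightarrow> (\<exists>g\<in>a. \<exists>h\<in>b. \<forall>\<^sub>F z in F. g z < h z)"

definition much_less :: "'a fset filter \<Rightarrow> ('a fset \<Rightarrow> real) set \<Rightarrow> ('a fset \<Rightarrow> real) set \<Rightarrow> bool"
  where "much_less F a b \<longleftrightarrow>
    pow_less F \<zero>\<^bsub>PowR F\<^esub> b \<and>
    (\<forall>n::int. pow_less F (\<ominus>\<^bsub>PowR F\<^esub> b) (pow_const F (of_int n) \<otimes>\<^bsub>PowR F\<^esub> a) \<and>
              pow_less F (pow_const F (of_int n) \<otimes>\<^bsub>PowR F\<^esub> a) b)"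

definition infinitesimal :: "'a fset filter \<Rightarrow> ('a fset \<Rightarrow> real) set \<Rightarrow> bool"
  where "infinitesimal F a \<longleftrightarrow> much_less F a \<one>\<^bsub>PowR F\<^esub>"

definition inf_close :: "'a fset filter \<Rightarrow> ('a fset \<Rightarrow> real) set \<Rightarrow> ('a fset \<Rightarrow> real) set \<Rightarrow> bool"
  where "inf_close F a b \<longleftrightarrow> infinitesimal F (a \<ominus>\<^bsub>PowR F\<^esub> b)"

definition ratio_close :: "'a fset filter \<Rightarrow> ('a fset \<Rightarrow> real) set \<Rightarrow> ('a fset \<Rightarrow> real) set \<Rightarrow> bool"
  where "ratio_close F a b \<longleftrightarrow>
    b \<in> Units (PowR F) \<and> inf_close F (a \<otimes>\<^bsub>PowR F\<^esub> inv\<^bsub>PowR F\<^esub> b) \<one>\<^bsub>PowR F\<^esub>"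

definition pow_integral :: "'a fset filter \<Rightarrow> ('a \<Rightarrow> real) \<Rightarrow> ('a fset \<Rightarrow> real) set"
  where "pow_integral F f = pow_class F (\<lambda>z. 1 / real (fcard z) * (\<Sum>x\<in>fset z. f x))"

definition pow_measure :: "'a fset filter \<Rightarrow> 'a set \<Rightarrow> ('a fset \<Rightarrow> real) set"
  where "pow_measure F A = pow_integral F (indicator A)"

lemma equiv_ae_eq: "equiv UNIV (ae_eq F)"
proof (intro equivI reflI symI transI)
  show "(h, g) \<in> ae_eq F" if "(g, h) \<in> ae_eq F" for g h
    using that by (simp add: ae_eq_def eq_commute)
  show "(g, k) \<in> ae_eq F" if "(g, h) \<in> ae_eq F" "(h, k) \<in> ae_eq F" for g h k
    using that unfolding ae_eq_def mem_Collect_eq prod.case by eventually_elim simp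
qed (simp_all add: ae_eq_def)

lemma in_pow_class_iff: "h \<in> pow_class F g \<longleftrightarrow> (\<forall>\<^sub>F z in F. g z = h z)"
  by (simp add: pow_class_def ae_eq_def)

lemma pow_class_eq_iff: "pow_class F g = pow_class F h \<longleftrightarrow> (\<forall>\<^sub>F z in F. g z = h z)"
  unfolding pow_class_def by (subst eq_equiv_class_iff[OF equiv_ae_eq]) (auto simp: ae_eq_def)

lemma pow_class_in_carrier [simp]: "pow_class F g \<in> carrier (PowR F)"
  by (simp add: PowR_def pow_class_def quotientI)

lemma in_carrier_PowR_cases:
  assumes "a \<in> carrier (PowR F)"
  obtains g where "a = pow_class F g"
  using assms by (auto simp: PowR_def pow_class_def elim: quotientE)

lemma UN_UN_eq_const:
  assumes "\<And>a b. a \<in> A \<Longrightarrow> b \<in> B \<Longrightarrow> f a b = X" and "a \<in> A" "b \<in> B"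
  shows "(\<Union>a\<in>A. \<Union>b\<in>B. f a b) = X"
  using assms by auto

lemma pow_class_mult:
  "pow_class F g \<otimes>\<^bsub>PowR F\<^esub> pow_class F h = pow_class F (\<lambda>z. g z * h z)"
proof -
  have "pow_class F (\<lambda>z. g' z * h' z) = pow_class F (\<lambda>z. g z * h z)"
    if "g' \<in> pow_class F g" "h' \<in> pow_class F h" for g' h'
    using that unfolding in_pow_class_iff pow_class_eq_iff by eventually_elim simp
  moreover have "g \<in> pow_class F g" "h \<in> pow_class F h"
    by (simp_all add: in_pow_class_iff)
  ultimately have "(\<Union>g'\<in>pow_class F g. \<Union>h'\<in>pow_class F h. pow_class F (\<lambda>z. g' z * h' z)) =
      pow_class F (\<lambda>z. g z * h z)"
    by (intro UN_UN_eq_const)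
  then show ?thesis
    by (simp add: PowR_def)
qed

lemma pow_class_add:
  "pow_class F g \<oplus>\<^bsub>PowR F\<^esub> pow_class F h = pow_class F (\<lambda>z. g z + h z)"
proof -
  have "pow_class F (\<lambda>z. g' z + h' z) = pow_class F (\<lambda>z. g z + h z)"
    if "g' \<in> pow_class F g" "h' \<in> pow_class F h" for g' h'
    using that unfolding in_pow_class_iff pow_class_eq_iff by eventually_elim simp
  moreover have "g \<in> pow_class F g" "h \<in> pow_class F h"
    by (simp_all add: in_pow_class_iff)
  ultimately have "(\<Union>g'\<in>pow_class F g. \<Union>h'\<in>pow_class F h. pow_class F (\<lambda>z. g' z + h' z)) =
      pow_class F (\<lambda>z. g z + h z)"
    by (intro UN_UN_eq_const)
  then show ?thesis
    by (simp add: PowR_def)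
qed

lemma PowR_one: "\<one>\<^bsub>PowR F\<^esub> = pow_class F (\<lambda>_. 1)"
  and PowR_zero: "\<zero>\<^bsub>PowR F\<^esub> = pow_class F (\<lambda>_. 0)"
  by (simp_all add: PowR_def pow_const_def)

lemma cring_PowR: "cring (PowR F)"
proof (intro cringI abelian_groupI comm_monoidI)
  fix a b c assume "a \<in> carrier (PowR F)" "b \<in> carrier (PowR F)" "c \<in> carrier (PowR F)"
  then obtain g h k where abc: "a = pow_class F g" "b = pow_class F h" "c = pow_class F k"
    by (metis in_carrier_PowR_cases)
  note [simp] = abc pow_class_add pow_class_mult PowR_one PowR_zero
  show "a \<oplus>\<^bsub>PowR F\<^esub> b \<in> carrier (PowR F)"
    and "a \<otimes>\<^bsub>PowR F\<^esub> b \<in> carrier (PowR F)"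
    and "\<zero>\<^bsub>PowR F\<^esub> \<oplus>\<^bsub>PowR F\<^esub> a = a"
    and "\<one>\<^bsub>PowR F\<^esub> \<otimes>\<^bsub>PowR F\<^esub> a = a"
    by simp_all
  show "a \<oplus>\<^bsub>PowR F\<^esub> b = b \<oplus>\<^bsub>PowR F\<^esub> a"
    and "a \<otimes>\<^bsub>PowR F\<^esub> b = b \<otimes>\<^bsub>PowR F\<^esub> a"
    by (simp_all add: add.commute mult.commute)
  show "a \<oplus>\<^bsub>PowR F\<^esub> b \<oplus>\<^bsub>PowR F\<^esub> c = a \<oplus>\<^bsub>PowR F\<^esub> (b \<oplus>\<^bsub>PowR F\<^esub> c)"
    and "a \<otimes>\<^bsub>PowR F\<^esub> b \<otimes>\<^bsub>PowR F\<^esub> c = a \<otimes>\<^bsub>PowR F\<^esub> (b \<otimes>\<^bsub>PowR F\<^esub> c)"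
    by (simp_all add: add.assoc mult.assoc)
  show "(a \<oplus>\<^bsub>PowR F\<^esub> b) \<otimes>\<^bsub>PowR F\<^esub> c = a \<otimes>\<^bsub>PowR F\<^esub> c \<oplus>\<^bsub>PowR F\<^esub> b \<otimes>\<^bsub>PowR F\<^esub> c"
    by (simp add: distrib_right)
  show "\<exists>b\<in>carrier (PowR F). b \<oplus>\<^bsub>PowR F\<^esub> a = \<zero>\<^bsub>PowR F\<^esub>"
    by (intro bexI[of _ "pow_class F (\<lambda>z. - g z)"]) simp_all
qed (simp_all add: PowR_one PowR_zero)

lemma pow_class_uminus: "\<ominus>\<^bsub>PowR F\<^esub> pow_class F g = pow_class F (\<lambda>z. - g z)"
proof -
  interpret cring "PowR F" by (rule cring_PowR)
  have "\<ominus>\<^bsub>PowR F\<^esub> pow_class F g = pow_class F (\<lambda>z. - g z)"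
    by (rule minus_equality) (simp_all add: pow_class_add PowR_zero)
  then show ?thesis .
qed

lemma pow_less_class_iff: "pow_less F (pow_class F g) (pow_class F h) \<longleftrightarrow> (\<forall>\<^sub>F z in F. g z < h z)"
proof
  assume "pow_less F (pow_class F g) (pow_class F h)"
  then obtain g' h' where
    "\<forall>\<^sub>F z in F. g z = g' z" "\<forall>\<^sub>F z in F. h z = h' z" "\<forall>\<^sub>F z in F. g' z < h' z"
    by (auto simp: pow_less_def in_pow_class_iff)
  then show "\<forall>\<^sub>F z in F. g z < h z"
    by eventually_elim simp
next
  assume "\<forall>\<^sub>F z in F. g z < h z"
  then show "pow_less F (pow_class F g) (pow_class F h)"
    unfolding pow_less_def by (intro bexI[of _ g] bexI[of _ h]) (simp_all add: in_pow_class_iff)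
qed


section \<open>Surfaces and their volume\<close>

text \<open>
  The same notion of continuous differentiability is used for a map on a relatively open subset of
  \<^term>\<open>Rn k\<close> and for the inverse parameterization, whose domain is in general not open in
  any \<^term>\<open>Rn N\<close>. On a set that is not open in the whole type the derivative is not unique;
  it is only required that it can be chosen continuously.
\<close>

definition C1_on :: "fseq set \<Rightarrow> (fseq \<Rightarrow> fseq) \<Rightarrow> bool"
  where "C1_on S f \<longleftrightarrow>
    (\<exists>f' :: fseq \<Rightarrow> fseq \<Rightarrow>\<^sub>L fseq. continuous_on S f' \<and>
      (\<forall>x\<in>S. (f has_derivative blinfun_apply (f' x)) (at x within S)))"

definition parameterization ::
    "nat \<Rightarrow> nat \<Rightarrow> fseq set \<Rightarrow> fseq set \<Rightarrow> (fseq \<Rightarrow> fseq) \<Rightarrow> bool"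
  where "parameterization k N U V \<phi> \<longleftrightarrow>
    openin (top_of_set (Rn k)) U \<and> bounded U \<and>
    openin (top_of_set (Rn k)) V \<and> bounded V \<and>
    U \<subseteq> V \<and> closure U \<subseteq> V \<and>
    \<phi> ` V \<subseteq> Rn N \<and> inj_on \<phi> V \<and>
    C1_on V \<phi> \<and> C1_on (\<phi> ` V) (inv_into V \<phi>)"

definition smooth_surface :: "nat \<Rightarrow> nat \<Rightarrow> fseq set \<Rightarrow> bool"
  where "smooth_surface k N S \<longleftrightarrow> (\<exists>U V \<phi>. parameterization k N U V \<phi> \<and> S = \<phi> ` U)"

definition partial_deriv :: "(fseq \<Rightarrow> fseq) \<Rightarrow> nat \<Rightarrow> fseq \<Rightarrow> fseq"
  where "partial_deriv \<phi> j x = vector_derivative (\<lambda>t. \<phi> (x + t *\<^sub>R unit_fseq j)) (at 0)"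

definition gram_matrix :: "nat \<Rightarrow> (fseq \<Rightarrow> fseq) \<Rightarrow> fseq \<Rightarrow> real mat"
  where "gram_matrix k \<phi> x =
    mat k k (\<lambda>(i, j). inner (partial_deriv \<phi> i x) (partial_deriv \<phi> j x))"

text \<open>
  Volumes are introduced as a relation between a set and a real number, in the manner of
  \<^const>\<open>has_integral\<close>: one value for each parameterization, or each decomposition into pieces.
\<close>

definition has_fragment_volume :: "nat \<Rightarrow> fseq set \<Rightarrow> real \<Rightarrow> bool"
  where "has_fragment_volume k P v \<longleftrightarrow>
    (\<exists>N U V \<phi> A. parameterization k N U V \<phi> \<and> A \<subseteq> U \<and> A \<in> sets (lebesgue_Rn k) \<and>
      P = \<phi> ` A \<and>
      v = set_lebesgue_integral (lebesgue_Rn k) A (\<lambda>x. sqrt (Determinant.det (gram_matrix k \<phi> x))))"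

definition piecewise_smooth_surface :: "nat \<Rightarrow> fseq set \<Rightarrow> bool"
  where "piecewise_smooth_surface k S \<longleftrightarrow>
    (\<exists>N \<T>. finite \<T> \<and> (\<forall>T\<in>\<T>. smooth_surface k N T) \<and> S = \<Union>\<T>)"

definition has_volume :: "nat \<Rightarrow> fseq set \<Rightarrow> real \<Rightarrow> bool"
  where "has_volume k A v \<longleftrightarrow>
    (\<exists>\<P> w. finite \<P> \<and> disjoint \<P> \<and> A = \<Union>\<P> \<and>
      (\<forall>P\<in>\<P>. has_fragment_volume k P (w P)) \<and> v = (\<Sum>P\<in>\<P>. w P))"

definition measurable_fragment :: "nat \<Rightarrow> fseq set \<Rightarrow> fseq set \<Rightarrow> bool"
  where "measurable_fragment k S A \<longleftrightarrow> A \<subseteq> S \<and> (\<exists>v. has_volume k A v)"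


section \<open>Middling sets\<close>

definition middling :: "fseq set \<Rightarrow> bool"
  where "middling A \<longleftrightarrow>
    (\<forall>\<^sub>F n in sequentially. emeasure (lebesgue_Rn n) (A \<inter> Rn n) < \<infinity>) \<and>
    (\<exists>\<^sub>F n in sequentially. emeasure (lebesgue_Rn n) (A \<inter> Rn n) > 0)"

end

theory Submission
  imports Defs
begin

text \<open>
  The filter is generated by requirements on a finite set \<open>z\<close>: to contain a given point, or to satisfy
  one of the inequalities between cardinalities \<open>|z \<inter> A|\<close> that express the four claims up to a factor
  \<open>K\<close>. It is proper as soon as any finitely many requirements are met by one finite set, and this is
  what has to be shown (\<open>meets_requirements_exists\<close>).

  Such a set is a union of samples, one for every dimension. Suppose that \<open>\<sigma>\<close> is a measure in which
  finite sets are null. Finitely many sets of finite measure cut the space into finitely many atoms;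
  choosing about \<open>T * \<sigma>(P)\<close> points from each atom \<open>P\<close> produces a sample that meets each of the sets in
  \<open>T * \<sigma>(A) + O(1)\<close> points (\<open>finite_sample\<close>), and the sample can be kept away from any given null
  set. In dimension \<open>n\<close> the null sets to avoid are the sets of smaller dimension and the countable sets. If
  moreover \<open>T\<close> is chosen after all points of smaller dimension, and much larger than their number,
  then the samples of the other dimensions do not disturb the proportions in dimension \<open>n\<close>
  (\<open>tower_of_samples\<close>).

  The measure for dimension \<open>n\<close> is the Hausdorff measure, normalized to be \<open>1\<close> on the unit cube. That it
  yields the volume of every measurable fragment, whatever the parameterization, is the area formula
  (\<open>C1_embedding.area_formula\<close>). Hausdorff measure depends on distances only. Near a point \<open>\<phi>\<close> changes
  distances like its derivative, up to a factor close to \<open>1\<close>, and the derivative changes them like a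
  triangular matrix \<open>R\<close> with \<open>R\<^sup>T R\<close> equal to the Gram matrix. Triangular matrices are compositions of
  shears, so \<open>R\<close> multiplies Lebesgue measure by the product of its diagonal entries, which is
  the square root of the Gram determinant. Finally, Hausdorff and Lebesgue measure on \<open>\<real>\<^sup>n\<close> are
  proportional, because both are translation invariant (\<open>hausdorff_eq_leb\<close>).

  Middling sets are treated in dimensions above all those of the fragments and of the translation
  vectors, where Lebesgue measure on \<open>\<real>\<^sup>n\<close> is sampled, which is invariant under these translations. Only
  dimensions up to some \<open>M\<close> are sampled, so each middling set \<open>A\<close> has a last sampled dimension in which it is
  not null; the sample of that dimension outweighs the earlier ones, and the later ones avoid both \<open>A\<close> and
  its translate.
\<close>

hide_const (open) Order.top

section \<open>The topology of the sequence space\<close>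

lemma ex_in_Rn: "\<exists>n. x \<in> Rn n"
  using eventually_coord_eq_0[of x] unfolding eventually_sequentially Rn_def by auto

lemma Rn_mono: "m \<le> n \<Longrightarrow> Rn m \<subseteq> Rn n"
  by (auto simp: Rn_def)

lemma Rn_0: "Rn 0 = {0}"
  by (force simp: Rn_def coord_inject[symmetric])

lemma subspace_Rn: "subspace (Rn n)"
  by (auto simp: subspace_def Rn_def)

lemma Rn_add: "x \<in> Rn n \<Longrightarrow> y \<in> Rn n \<Longrightarrow> x + y \<in> Rn n"
  and Rn_diff: "x \<in> Rn n \<Longrightarrow> y \<in> Rn n \<Longrightarrow> x - y \<in> Rn n"
  and Rn_uminus: "x \<in> Rn n \<Longrightarrow> - x \<in> Rn n"
  and Rn_scaleR: "x \<in> Rn n \<Longrightarrow> c *\<^sub>R x \<in> Rn n"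
  and Rn_zero: "0 \<in> Rn n"
  by (auto simp: Rn_def)

lemma coord_sum: "coord (sum f A) i = (\<Sum>a\<in>A. coord (f a) i)"
  by (induction A rule: infinite_finite_induct) auto

lemma coord_unit_fseq: "coord (unit_fseq j) i = (if i = j then 1 else 0)"
  by transfer simp

lemma unit_fseq_in_Rn: "j < n \<Longrightarrow> unit_fseq j \<in> Rn n"
  by (auto simp: Rn_def coord_unit_fseq)

lemma inner_Rn: "x \<in> Rn n \<Longrightarrow> inner x y = (\<Sum>i<n. coord x i * coord y i)"
  unfolding inner_fseq_def Rn_def by (intro suminf_finite) auto

lemma inner_unit_fseq: "inner (unit_fseq i) x = coord x i"
proof -
  have "inner (unit_fseq i) x = (\<Sum>k<Suc i. coord (unit_fseq i) k * coord x k)"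
    by (rule inner_Rn) (simp add: unit_fseq_in_Rn)
  then show ?thesis
    by (simp add: coord_unit_fseq)
qed

lemma norm_unit_fseq [simp]: "norm (unit_fseq i) = 1"
  by (simp add: norm_eq_sqrt_inner inner_unit_fseq coord_unit_fseq)

lemma abs_coord_le_norm: "\<bar>coord x i\<bar> \<le> norm x"
  using Cauchy_Schwarz_ineq2[of "unit_fseq i" x] by (simp add: inner_unit_fseq)

lemma bounded_linear_coord: "bounded_linear (\<lambda>x. coord x i)"
  using bounded_linear_inner_right[of "unit_fseq i"] by (simp add: inner_unit_fseq)

lemmas continuous_on_coord [continuous_intros] =
  bounded_linear.continuous_on[OF bounded_linear_coord]

lemma borel_measurable_coord [measurable]: "(\<lambda>x. coord x i) \<in> borel_measurable borel"
  by (intro borel_measurable_continuous_onI continuous_intros)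

lemma norm_Rn: "x \<in> Rn n \<Longrightarrow> norm x = sqrt (\<Sum>i<n. (coord x i)\<^sup>2)"
  by (simp add: norm_eq_sqrt_inner inner_Rn power2_eq_square)

lemma closed_Rn: "closed (Rn n)"
proof -
  have "Rn n = (\<Inter>j\<in>{n..}. {x. coord x j = 0})"
    by (auto simp: Rn_def)
  then show ?thesis
    by (simp only:) (intro closed_INT ballI closed_Collect_eq continuous_intros)
qed

lemma Rn_borel [measurable]: "Rn n \<in> sets borel"
  by (simp add: closed_Rn)

lemma extend_zero_in_Rn [simp]: "extend_zero n f \<in> Rn n"
  by (simp add: Rn_def coord_extend_zero)

lemma extend_zero_eq_sum: "extend_zero n f = (\<Sum>i<n. f i *\<^sub>R unit_fseq i)"
proof (rule fseq_eqI)
  fix k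
  have "(\<Sum>i<n. f i * (if k = i then 1 else 0)) = (if k < n then f k else 0)"
    by (simp add: if_distrib cong: if_cong)
  then show "coord (extend_zero n f) k = coord (\<Sum>i<n. f i *\<^sub>R unit_fseq i) k"
    by (simp add: coord_extend_zero coord_sum coord_unit_fseq)
qed

lemma extend_zero_coord: "x \<in> Rn n \<Longrightarrow> extend_zero n (coord x) = x"
  by (rule fseq_eqI) (auto simp: coord_extend_zero Rn_def)

lemma Rn_eq_sum: "x \<in> Rn n \<Longrightarrow> x = (\<Sum>i<n. coord x i *\<^sub>R unit_fseq i)"
  using extend_zero_coord[of x n] by (simp add: extend_zero_eq_sum)

lemma norm_Rn_le_sum: "x \<in> Rn n \<Longrightarrow> norm x \<le> (\<Sum>i<n. \<bar>coord x i\<bar>)"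
  by (subst Rn_eq_sum, assumption) (rule order_trans[OF norm_sum], simp)

text \<open>
  The balls with centres among the finite rational sequences and radii \<open>1/(k+1)\<close> form a basis. Second
  countability makes sums of Borel functions measurable and allows countable subcovers.
\<close>

instance fseq :: second_countable_topology
proof
  define d :: "rat list \<Rightarrow> fseq" where "d l = extend_zero (length l) (\<lambda>i. of_rat (l ! i))" for l
  define \<B> where "\<B> = (\<lambda>(l, k). ball (d l) (1 / real (Suc k))) ` (UNIV :: (rat list \<times> nat) set)"
  have dense: "\<exists>l. dist (d l) x < e" if "e > 0" for x e
  proof -
    obtain n where n: "x \<in> Rn n" using ex_in_Rn by blast
    have "\<exists>q::rat. \<bar>real_of_rat q - coord x i\<bar> < e / real (Suc n)" for i
    proof -
      have "coord x i < coord x i + e / real (Suc n)"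
        using that by simp
      then obtain q where "coord x i < of_rat q" "of_rat q < coord x i + e / real (Suc n)"
        using of_rat_dense by blast
      then show ?thesis
        by (intro exI[of _ q]) linarith
    qed
    then obtain q :: "nat \<Rightarrow> rat" where q: "\<And>i. \<bar>real_of_rat (q i) - coord x i\<bar> < e / real (Suc n)"
      by metis
    let ?l = "map q [0..<n]"
    have "dist (d ?l) x = norm (d ?l - x)"
      by (simp add: dist_norm)
    also have "\<dots> \<le> (\<Sum>i<n. \<bar>coord (d ?l - x) i\<bar>)"
      by (rule norm_Rn_le_sum) (use n in \<open>auto intro!: Rn_diff simp: d_def Rn_def coord_extend_zero\<close>)
    also have "\<dots> \<le> (\<Sum>i<n. e / real (Suc n))"
      by (rule sum_mono) (use q in \<open>auto simp: d_def coord_extend_zero less_imp_le\<close>)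
    also have "\<dots> < e"
      using that by (simp add: field_simps)
    finally show ?thesis by blast
  qed
  have "topological_basis \<B>"
  proof (rule topological_basisI)
    show "open B" if "B \<in> \<B>" for B using that by (auto simp: \<B>_def)
    fix O' :: "fseq set" and x assume "open O'" "x \<in> O'"
    then obtain e where e: "e > 0" "ball x e \<subseteq> O'"
      using open_contains_ball by blast
    obtain k where k: "1 / real (Suc k) < e / 2"
      using e(1) nat_approx_posE[of "e / 2"] by auto
    obtain l where l: "dist (d l) x < 1 / real (Suc k)"
      using dense[of "1 / real (Suc k)" x] by auto
    show "\<exists>B'\<in>\<B>. x \<in> B' \<and> B' \<subseteq> O'"
    proof (intro bexI conjI)
      show "x \<in> ball (d l) (1 / real (Suc k))" using l by simp
      have "dist x y < e" if "dist (d l) y < 1 / real (Suc k)" for y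
        using dist_triangle[of x y "d l"] l k that by (simp add: dist_commute)
      then show "ball (d l) (1 / real (Suc k)) \<subseteq> O'"
        using e(2) by auto
      show "ball (d l) (1 / real (Suc k)) \<in> \<B>"
        unfolding \<B>_def by auto
    qed
  qed
  moreover have "countable \<B>"
    by (simp add: \<B>_def)
  ultimately show "\<exists>B::fseq set set. countable B \<and> open = generate_topology B"
    using topological_basis_imp_subbasis by blast
qed

lemma compact_closed_subset: "compact T \<Longrightarrow> closed S \<Longrightarrow> S \<subseteq> T \<Longrightarrow> compact S"
  using closed_Int_compact[of S T] by (simp add: inf.absorb1)

text \<open>
  The ball of \<open>Rn (Suc n)\<close> is covered by the continuous image of the product of the ball of \<open>Rn n\<close> with an
  interval.
\<close>

lemma compact_cball_Rn: "compact {x \<in> Rn n. norm x \<le> r}"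
proof (induction n)
  case 0
  show ?case
    unfolding Rn_0
    by (cases "r \<ge> 0") (auto intro: finite_imp_compact)
next
  case (Suc n)
  let ?f = "\<lambda>(x, t). x + t *\<^sub>R unit_fseq n"
  have "compact (?f ` ({x \<in> Rn n. norm x \<le> r} \<times> {-r..r}))"
    using Suc by (intro compact_continuous_image compact_Times)
      (auto simp: case_prod_unfold intro!: continuous_intros)
  moreover have "closed {x \<in> Rn (Suc n). norm x \<le> r}"
    using closed_Int[OF closed_Rn closed_cball[of 0 r]] by (simp add: cball_def Int_def)
  moreover have "{x \<in> Rn (Suc n). norm x \<le> r} \<subseteq> ?f ` ({x \<in> Rn n. norm x \<le> r} \<times> {-r..r})"
  proof safe
    fix x assume x: "x \<in> Rn (Suc n)" "norm x \<le> r"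
    let ?y = "x - coord x n *\<^sub>R unit_fseq n"
    have y: "?y \<in> Rn n"
      using x(1) by (auto simp: Rn_def coord_unit_fseq)
    have "(\<Sum>i<n. (coord ?y i)\<^sup>2) = (\<Sum>i<n. (coord x i)\<^sup>2)"
      by (intro sum.cong) (auto simp: coord_unit_fseq)
    then have "(norm ?y)\<^sup>2 \<le> (norm x)\<^sup>2"
      by (simp add: norm_Rn[OF y] norm_Rn[OF x(1)] sum_nonneg)
    then have "norm ?y \<le> r"
      using x(2) by (meson norm_ge_zero order_trans power2_le_imp_le)
    moreover have "\<bar>coord x n\<bar> \<le> r"
      using x(2) abs_coord_le_norm order_trans by blast
    ultimately show "x \<in> ?f ` ({x \<in> Rn n. norm x \<le> r} \<times> {-r..r})"
      using y by (intro image_eqI[of _ _ "(?y, coord x n)"]) auto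
  qed
  ultimately show ?case
    by (rule compact_closed_subset)
qed

lemma compact_Rn:
  assumes "closed S" "bounded S" "S \<subseteq> Rn n"
  shows "compact S"
proof -
  obtain r where "\<forall>x\<in>S. norm x \<le> r"
    using assms(2) by (auto simp: bounded_iff)
  then have "S = S \<inter> {x \<in> Rn n. norm x \<le> r}"
    using assms(3) by auto
  then show ?thesis
    using closed_Int_compact[OF assms(1) compact_cball_Rn, of n r] by simp
qed

text \<open>
  On a compact set a continuous injection maps relatively closed sets to compact sets; being injective, it
  commutes with complements and countable unions.
\<close>

lemma image_borel:
  fixes f :: "'a::t2_space \<Rightarrow> 'b::t2_space"
  assumes K: "compact K" and f: "continuous_on K f" "inj_on f K" and E: "E \<in> sets borel"
  shows "f ` (E \<inter> K) \<in> sets borel"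
proof -
  have fK: "f ` K \<in> sets borel"
    using compact_continuous_image[OF f(1) K] by (simp add: borel_compact)
  have "E \<in> sigma_sets UNIV (Collect closed)"
    using E by (simp add: borel_eq_closed)
  then show ?thesis
  proof induction
    case (Basic F)
    then have "compact (F \<inter> K)" using K by (simp add: closed_Int_compact)
    then show ?case
      using compact_continuous_image[OF continuous_on_subset[OF f(1)], of "F \<inter> K"]
      by (simp add: borel_compact)
  next
    case (Compl F)
    have "f ` ((UNIV - F) \<inter> K) = f ` K - f ` (F \<inter> K)"
      using inj_on_image_set_diff[OF f(2), of K "F \<inter> K"] by (simp add: Diff_Int_distrib2 Int_commute[of F K] Diff_Int)
    then show ?case using Compl fK by auto
  next
    case (Union A)
    have "f ` (\<Union> (range A) \<inter> K) = (\<Union>i. f ` (A i \<inter> K))" by auto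
    then show ?case using Union by auto
  qed simp
qed

section \<open>Hausdorff measure on metric spaces\<close>

text \<open>
  A cover carries bounds \<open>r i\<close> for the diameters of its members instead of the diameters themselves. An
  upper bound says at once that the member is bounded, and the empty set admits the bound \<open>0\<close>.
\<close>

definition hausdorff_cover :: "real \<Rightarrow> 'a::metric_space set \<Rightarrow> ((nat \<Rightarrow> 'a set) \<times> (nat \<Rightarrow> real)) set"
  where "hausdorff_cover \<delta> E = {(A, r). E \<subseteq> (\<Union>i. A i) \<and>
    (\<forall>i. 0 \<le> r i \<and> r i \<le> \<delta> \<and> (\<forall>x\<in>A i. \<forall>y\<in>A i. dist x y \<le> r i))}"

definition hausdorff_pre :: "nat \<Rightarrow> real \<Rightarrow> 'a::metric_space set \<Rightarrow> ennreal"
  where "hausdorff_pre k \<delta> E = (INF (A, r)\<in>hausdorff_cover \<delta> E. \<Sum>i. ennreal (r i ^ k))"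

text \<open>
  Since the premeasures grow as \<open>\<delta>\<close> decreases, the numbers \<open>1/(n+1)\<close> give the supremum over all
  \<open>\<delta> > 0\<close>, as the limit of an increasing sequence. For \<open>k = 0\<close> a member of diameter \<open>0\<close>
  would count \<open>1\<close>, so the measure is meant for \<open>k > 0\<close>.
\<close>

definition hausdorff :: "nat \<Rightarrow> 'a::metric_space set \<Rightarrow> ennreal"
  where "hausdorff k E = (SUP n. hausdorff_pre k (1 / real (Suc n)) E)"

lemma hausdorff_coverI:
  assumes "E \<subseteq> (\<Union>i. A i)" "\<And>i. 0 \<le> r i" "\<And>i. r i \<le> \<delta>"
    and "\<And>i x y. x \<in> A i \<Longrightarrow> y \<in> A i \<Longrightarrow> dist x y \<le> r i"
  shows "(A, r) \<in> hausdorff_cover \<delta> E"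
  using assms by (auto simp: hausdorff_cover_def)

lemma hausdorff_coverD:
  assumes "(A, r) \<in> hausdorff_cover \<delta> E"
  shows "E \<subseteq> (\<Union>i. A i)" "0 \<le> r i" "r i \<le> \<delta>" "x \<in> A i \<Longrightarrow> y \<in> A i \<Longrightarrow> dist x y \<le> r i"
  using assms by (auto simp: hausdorff_cover_def)

lemma hausdorff_pre_le:
  "(A, r) \<in> hausdorff_cover \<delta> E \<Longrightarrow> hausdorff_pre k \<delta> E \<le> (\<Sum>i. ennreal (r i ^ k))"
  unfolding hausdorff_pre_def by (rule INF_lower2) auto

lemma hausdorff_pre_greatest:
  "(\<And>A r. (A, r) \<in> hausdorff_cover \<delta> E \<Longrightarrow> c \<le> (\<Sum>i. ennreal (r i ^ k))) \<Longrightarrow> c \<le> hausdorff_pre k \<delta> E"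
  unfolding hausdorff_pre_def by (rule INF_greatest) auto

lemma hausdorff_pre_close:
  assumes "hausdorff_pre k \<delta> E < e"
  obtains A r where "(A, r) \<in> hausdorff_cover \<delta> E" "(\<Sum>i. ennreal (r i ^ k)) < e"
  using assms unfolding hausdorff_pre_def INF_less_iff by auto

lemma hausdorff_cover_mono:
  "(A, r) \<in> hausdorff_cover \<delta> E' \<Longrightarrow> E \<subseteq> E' \<Longrightarrow> \<delta> \<le> \<delta>' \<Longrightarrow> (A, r) \<in> hausdorff_cover \<delta>' E"
  by (rule hausdorff_coverI) (meson hausdorff_coverD order_trans subset_trans)+

lemma hausdorff_pre_mono: "E \<subseteq> E' \<Longrightarrow> hausdorff_pre k \<delta> E \<le> hausdorff_pre k \<delta> E'"
  by (rule hausdorff_pre_greatest, rule hausdorff_pre_le) (auto intro: hausdorff_cover_mono)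

lemma hausdorff_pre_antimono: "\<delta> \<le> \<delta>' \<Longrightarrow> hausdorff_pre k \<delta>' E \<le> hausdorff_pre k \<delta> E"
  by (rule hausdorff_pre_greatest, rule hausdorff_pre_le) (auto intro: hausdorff_cover_mono)

lemma hausdorff_pre_subadditive:
  "hausdorff_pre k \<delta> (\<Union>i. E i) \<le> (\<Sum>i. hausdorff_pre k \<delta> (E i))"
proof (rule ennreal_le_epsilon)
  fix e :: real assume "0 < e" "(\<Sum>n. hausdorff_pre k \<delta> (E n)) < top"
  then have *: "\<And>n. hausdorff_pre k \<delta> (E n) < hausdorff_pre k \<delta> (E n) + e * (1/2)^Suc n"
    by (auto simp add: less_top dest!: ennreal_suminf_lessD)
  have "\<exists>A r. (A, r) \<in> hausdorff_cover \<delta> (E n) \<and>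
      (\<Sum>i. ennreal (r i ^ k)) \<le> hausdorff_pre k \<delta> (E n) + e * (1/2)^Suc n" for n
    using hausdorff_pre_close[OF *[of n]] less_imp_le by metis
  then obtain A r where cov: "\<And>n. (A n, r n) \<in> hausdorff_cover \<delta> (E n)"
    and le: "\<And>n. (\<Sum>i. ennreal (r n i ^ k)) \<le> hausdorff_pre k \<delta> (E n) + e * (1/2)^Suc n"
    by metis
  define A' where "A' = (\<lambda>(n, i). A n i) \<circ> prod_decode"
  define r' where "r' = (\<lambda>(n, i). r n i) \<circ> prod_decode"
  have "(A', r') \<in> hausdorff_cover \<delta> (\<Union>i. E i)"
  proof (rule hausdorff_coverI)
    show "(\<Union>i. E i) \<subseteq> (\<Union>i. A' i)"
    proof
      fix x assume "x \<in> (\<Union>i. E i)"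
      then obtain n i where "x \<in> A n i"
        using hausdorff_coverD(1)[OF cov] by blast
      then have "x \<in> A' (prod_encode (n, i))"
        by (simp add: A'_def)
      then show "x \<in> (\<Union>i. A' i)" by blast
    qed
  qed (use hausdorff_coverD(2-4)[OF cov] in \<open>auto simp: A'_def r'_def split: prod.splits\<close>)
  then have "hausdorff_pre k \<delta> (\<Union>i. E i) \<le> (\<Sum>i. ennreal (r' i ^ k))"
    by (rule hausdorff_pre_le)
  also have "\<dots> = (\<Sum>i. ((\<lambda>(n, i). ennreal (r n i ^ k)) \<circ> prod_decode) i)"
    by (intro suminf_cong) (simp add: r'_def split: prod.splits)
  also have "\<dots> = (\<Sum>n. \<Sum>i. ennreal (r n i ^ k))"
    unfolding comp_def by (rule suminf_ennreal_2dimen) simp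
  also have "\<dots> \<le> (\<Sum>n. hausdorff_pre k \<delta> (E n) + e * (1/2) ^ Suc n)"
    by (intro suminf_le allI le) auto
  also have "\<dots> = (\<Sum>n. hausdorff_pre k \<delta> (E n)) + (\<Sum>n. ennreal e * ennreal ((1/2) ^ Suc n))"
    using \<open>0 < e\<close> by (subst suminf_add[symmetric])
                     (auto simp del: ennreal_suminf_cmult simp add: ennreal_mult[symmetric])
  also have "\<dots> = (\<Sum>n. hausdorff_pre k \<delta> (E n)) + e"
    unfolding ennreal_suminf_cmult
    by (subst suminf_ennreal_eq[OF zero_le_power power_half_series]) auto
  finally show "hausdorff_pre k \<delta> (\<Union>i. E i) \<le> (\<Sum>n. hausdorff_pre k \<delta> (E n)) + e" .
qed

lemma hausdorff_pre_le_hausdorff: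
  assumes "\<delta> > 0"
  shows "hausdorff_pre k \<delta> E \<le> hausdorff k E"
proof -
  obtain n where "1 / real (Suc n) < \<delta>"
    using nat_approx_posE[OF assms] by blast
  then have "hausdorff_pre k \<delta> E \<le> hausdorff_pre k (1 / real (Suc n)) E"
    by (intro hausdorff_pre_antimono) simp
  also have "\<dots> \<le> hausdorff k E"
    unfolding hausdorff_def by (rule SUP_upper) simp
  finally show ?thesis .
qed

lemma hausdorff_least:
  "(\<And>\<delta>. \<delta> > 0 \<Longrightarrow> hausdorff_pre k \<delta> E \<le> c) \<Longrightarrow> hausdorff k E \<le> c"
  unfolding hausdorff_def by (rule SUP_least) auto

lemma hausdorff_mono: "E \<subseteq> E' \<Longrightarrow> hausdorff k E \<le> hausdorff k E'"
  by (rule hausdorff_least)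
    (meson hausdorff_pre_mono hausdorff_pre_le_hausdorff order_trans)

lemma hausdorff_subadditive: "hausdorff k (\<Union>i. E i) \<le> (\<Sum>i. hausdorff k (E i))"
proof (rule hausdorff_least)
  fix \<delta> :: real assume "\<delta> > 0"
  then have "(\<Sum>i. hausdorff_pre k \<delta> (E i)) \<le> (\<Sum>i. hausdorff k (E i))"
    by (intro suminf_le) (auto intro: hausdorff_pre_le_hausdorff)
  then show "hausdorff_pre k \<delta> (\<Union>i. E i) \<le> (\<Sum>i. hausdorff k (E i))"
    using hausdorff_pre_subadditive order_trans by blast
qed

lemma hausdorff_singleton: "k > 0 \<Longrightarrow> hausdorff k {x} = 0"
proof -
  assume k: "k > 0"
  have "hausdorff k {x} \<le> 0"
  proof (rule hausdorff_least)
    fix \<delta> :: real assume "\<delta> > 0"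
    then have "((\<lambda>_. {x}), (\<lambda>_. 0)) \<in> hausdorff_cover \<delta> {x}"
      by (auto simp: hausdorff_cover_def)
    from hausdorff_pre_le[OF this, of k] k show "hausdorff_pre k \<delta> {x} \<le> 0"
      by (simp add: zero_power)
  qed
  then show ?thesis by simp
qed

lemma hausdorff_empty: "k > 0 \<Longrightarrow> hausdorff k ({} :: 'a::metric_space set) = 0"
  using hausdorff_mono[of "{}" "{undefined :: 'a}" k] hausdorff_singleton[of k "undefined :: 'a"] by simp

lemma hausdorff_Un: "k > 0 \<Longrightarrow> hausdorff k (A \<union> B) \<le> hausdorff k A + hausdorff k B"
proof -
  assume "k > 0"
  have "A \<union> B = (\<Union>i. binaryset A B i)"
    by (simp add: UN_binaryset_eq)
  then have "hausdorff k (A \<union> B) \<le> (\<Sum>i. hausdorff k (binaryset A B i))"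
    using hausdorff_subadditive by metis
  also have "\<dots> = hausdorff k A + hausdorff k B"
    using hausdorff_empty[OF \<open>k > 0\<close>] by (intro suminf_binaryset_eq) simp
  finally show ?thesis .
qed

text \<open>
  Comparing two maps on a common domain, rather than the identity with a Lipschitz map, lets the estimate be
  used in both directions between a parameterization and its derivative.
\<close>

lemma hausdorff_image_le:
  assumes lip: "\<And>x y. x \<in> E \<Longrightarrow> y \<in> E \<Longrightarrow> dist (f x) (f y) \<le> C * dist (g x) (g y)" and C: "C > 0"
  shows "hausdorff k (f ` E) \<le> ennreal (C ^ k) * hausdorff k (g ` E)"
proof (rule hausdorff_least)
  fix \<delta> :: real assume "\<delta> > 0"
  have *: "ennreal (inverse (C ^ k)) * hausdorff_pre k \<delta> (f ` E) \<le> hausdorff_pre k (\<delta> / C) (g ` E)"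
  proof (rule hausdorff_pre_greatest)
    fix A r assume cov: "(A, r) \<in> hausdorff_cover (\<delta> / C) (g ` E)"
    have "(\<lambda>i. f ` (E \<inter> g -` A i), \<lambda>i. C * r i) \<in> hausdorff_cover \<delta> (f ` E)"
    proof (rule hausdorff_coverI)
      show "C * r i \<le> \<delta>" for i
        using hausdorff_coverD(3)[OF cov, of i] C by (simp add: field_simps)
      show "dist x y \<le> C * r i" if x: "x \<in> f ` (E \<inter> g -` A i)" and y: "y \<in> f ` (E \<inter> g -` A i)" for i x y
      proof -
        obtain a b where "a \<in> E" "b \<in> E" "g a \<in> A i" "g b \<in> A i" and xy: "x = f a" "y = f b"
          using x y by blast
        then have "dist (f a) (f b) \<le> C * dist (g a) (g b)" "dist (g a) (g b) \<le> r i"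
          using lip hausdorff_coverD(4)[OF cov] by auto
        then show ?thesis
          unfolding xy using C by (meson mult_left_mono order_trans less_imp_le)
      qed
      show "f ` E \<subseteq> (\<Union>i. f ` (E \<inter> g -` A i))"
        using hausdorff_coverD(1)[OF cov] by blast
    qed (use hausdorff_coverD(2)[OF cov] C in auto)
    then have "hausdorff_pre k \<delta> (f ` E) \<le> (\<Sum>i. ennreal ((C * r i) ^ k))"
      by (rule hausdorff_pre_le)
    also have "\<dots> = ennreal (C ^ k) * (\<Sum>i. ennreal (r i ^ k))"
      using C hausdorff_coverD(2)[OF cov] by (simp add: power_mult_distrib ennreal_mult)
    finally have "ennreal (inverse (C ^ k)) * hausdorff_pre k \<delta> (f ` E)
        \<le> ennreal (inverse (C ^ k)) * (ennreal (C ^ k) * (\<Sum>i. ennreal (r i ^ k)))"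
      by (rule mult_left_mono) simp
    also have "\<dots> = (\<Sum>i. ennreal (r i ^ k))"
      using C by (simp add: mult.assoc[symmetric] ennreal_mult[symmetric])
    finally show "ennreal (inverse (C ^ k)) * hausdorff_pre k \<delta> (f ` E) \<le> (\<Sum>i. ennreal (r i ^ k))" .
  qed
  have "hausdorff_pre k \<delta> (f ` E) = ennreal (C ^ k) * (ennreal (inverse (C ^ k)) * hausdorff_pre k \<delta> (f ` E))"
    using C by (simp add: mult.assoc[symmetric] ennreal_mult[symmetric])
  also have "\<dots> \<le> ennreal (C ^ k) * hausdorff_pre k (\<delta> / C) (g ` E)"
    by (intro mult_left_mono *) simp
  also have "\<dots> \<le> ennreal (C ^ k) * hausdorff k (g ` E)"
    using C \<open>\<delta> > 0\<close> by (intro mult_left_mono hausdorff_pre_le_hausdorff) auto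
  finally show "hausdorff_pre k \<delta> (f ` E) \<le> ennreal (C ^ k) * hausdorff k (g ` E)" .
qed

lemma hausdorff_isometry:
  assumes "\<And>x y. x \<in> E \<Longrightarrow> y \<in> E \<Longrightarrow> dist (f x) (f y) = dist (g x) (g y)"
  shows "hausdorff k (f ` E) = hausdorff k (g ` E)"
  using hausdorff_image_le[of E f 1 g k] hausdorff_image_le[of E g 1 f k] assms
  by (simp add: antisym)

lemma hausdorff_translation:
  fixes x :: "'a::real_normed_vector"
  shows "hausdorff k ((\<lambda>a. a + x) ` E) = hausdorff k E"
  using hausdorff_isometry[of E "\<lambda>a. a + x" "\<lambda>a. a" k] by simp

text \<open>
  For covers with diameters at most \<open>d \<le> 1\<close>, raising the exponent from \<open>k\<close> to \<open>l > k\<close> reduces the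
  sums by at least the factor \<open>d\<close>.
\<close>

lemma hausdorff_higher_dim_eq_0:
  assumes "hausdorff k E < top" "k < l"
  shows "hausdorff l E = 0"
proof -
  obtain h where h: "hausdorff k E = ennreal h" "h \<ge> 0"
    using assms(1) by (cases "hausdorff k E" rule: ennreal_cases) auto
  have *: "hausdorff l E \<le> ennreal (1 / real (Suc m) * h)" for m
  proof (rule hausdorff_least)
    fix \<delta> :: real assume "\<delta> > 0"
    define d where "d = min \<delta> (1 / real (Suc m))"
    have d: "d > 0" "d \<le> \<delta>" "d \<le> 1 / real (Suc m)"
      using \<open>\<delta> > 0\<close> by (auto simp: d_def)
    then have "d \<le> 1"
      by (rule_tac order_trans[OF d(3)]) simp
    have "hausdorff_pre l \<delta> E \<le> hausdorff_pre l d E"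
      by (rule hausdorff_pre_antimono) fact
    also have "\<dots> \<le> ennreal d * hausdorff_pre k d E"
    proof (rule ennreal_le_epsilon)
      fix e :: real assume e: "e > 0" and fin: "ennreal d * hausdorff_pre k d E < top"
      then have "hausdorff_pre k d E < hausdorff_pre k d E + ennreal (e / d)"
        using d(1) by (auto simp: ennreal_mult_less_top less_top)
      then obtain A r where cov: "(A, r) \<in> hausdorff_cover d E"
        and le: "(\<Sum>i. ennreal (r i ^ k)) < hausdorff_pre k d E + ennreal (e / d)"
        by (rule hausdorff_pre_close)
      have "r i ^ l \<le> d * r i ^ k" for i
      proof -
        have r: "0 \<le> r i" "r i \<le> d"
          using hausdorff_coverD(2,3)[OF cov] by auto
        have "r i ^ l = r i ^ (l - k) * r i ^ k"
          using assms(2) by (simp flip: power_add)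
        also have "r i ^ (l - k) \<le> r i ^ 1"
          using r \<open>d \<le> 1\<close> assms(2) by (intro power_decreasing) auto
        finally show ?thesis
          using r by (simp add: mult_right_mono order_trans[OF _ mult_right_mono[OF r(2)]])
      qed
      then have "(\<Sum>i. ennreal (r i ^ l)) \<le> (\<Sum>i. ennreal (d * r i ^ k))"
        by (intro suminf_le ennreal_leI) auto
      also have "\<dots> = ennreal d * (\<Sum>i. ennreal (r i ^ k))"
        using d hausdorff_coverD(2)[OF cov] by (simp add: ennreal_mult)
      also have "\<dots> \<le> ennreal d * (hausdorff_pre k d E + ennreal (e / d))"
        using le by (intro mult_left_mono) auto
      also have "\<dots> = ennreal d * hausdorff_pre k d E + ennreal e"
        using d e by (simp add: distrib_left ennreal_mult[symmetric])
      finally show "hausdorff_pre l d E \<le> ennreal d * hausdorff_pre k d E + ennreal e"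
        using hausdorff_pre_le[OF cov, of l] order_trans by blast
    qed
    also have "\<dots> \<le> ennreal (1 / real (Suc m)) * ennreal h"
      using d(1,3) hausdorff_pre_le_hausdorff[OF d(1), of k E] h
      by (intro mult_mono ennreal_leI) auto
    finally show "hausdorff_pre l \<delta> E \<le> ennreal (1 / real (Suc m) * h)"
      by (subst ennreal_mult) (use h in auto)
  qed
  have "(\<lambda>m. ennreal (1 / real (Suc m) * h)) \<longlonglongrightarrow> ennreal (0 * h)"
    using LIMSEQ_inverse_real_of_nat
    by (intro tendsto_ennrealI tendsto_mult_right) (simp add: inverse_eq_divide)
  then have "hausdorff l E \<le> ennreal (0 * h)"
    by (rule LIMSEQ_le_const) (use * in auto)
  then show ?thesis by simp
qed

text \<open>
  A cover by sets of diameter less than the distance \<open>d\<close> splits into a cover of \<open>A\<close> and a cover of \<open>B\<close>.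
\<close>

lemma hausdorff_separated:
  assumes sep: "\<And>x y. x \<in> A \<Longrightarrow> y \<in> B \<Longrightarrow> d \<le> dist x y" and d: "d > 0" and k: "k > 0"
  shows "hausdorff k (A \<union> B) = hausdorff k A + hausdorff k B"
proof (rule antisym)
  have inc: "incseq (\<lambda>n. hausdorff_pre k (1 / real (Suc n)) E)" for E :: "'a set"
    by (intro incseq_SucI hausdorff_pre_antimono divide_left_mono) auto
  have "hausdorff_pre k \<delta> A + hausdorff_pre k \<delta> B \<le> hausdorff k (A \<union> B)" if "\<delta> > 0" for \<delta>
  proof -
    define \<epsilon> where "\<epsilon> = min \<delta> (d / 2)"
    have \<epsilon>: "\<epsilon> > 0" "\<epsilon> \<le> \<delta>" "\<epsilon> < d"
      using that d by (auto simp: \<epsilon>_def)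
    have "hausdorff_pre k \<delta> A + hausdorff_pre k \<delta> B \<le> hausdorff_pre k \<epsilon> A + hausdorff_pre k \<epsilon> B"
      by (intro add_mono hausdorff_pre_antimono \<epsilon>)
    also have "\<dots> \<le> hausdorff_pre k \<epsilon> (A \<union> B)"
    proof (rule hausdorff_pre_greatest)
      fix S r assume cov: "(S, r) \<in> hausdorff_cover \<epsilon> (A \<union> B)"
      let ?R = "\<lambda>X i. if S i \<inter> X = {} then 0 else r i"
      have "(\<lambda>i. S i \<inter> X, ?R X) \<in> hausdorff_cover \<epsilon> X" if "X = A \<or> X = B" for X
        by (rule hausdorff_coverI) (use that hausdorff_coverD[OF cov] \<epsilon>(1) in \<open>auto simp: less_imp_le\<close>)
      then have "hausdorff_pre k \<epsilon> A + hausdorff_pre k \<epsilon> B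
          \<le> (\<Sum>i. ennreal (?R A i ^ k)) + (\<Sum>i. ennreal (?R B i ^ k))"
        by (intro add_mono hausdorff_pre_le) auto
      also have "\<dots> = (\<Sum>i. ennreal (?R A i ^ k) + ennreal (?R B i ^ k))"
        by (rule suminf_add) auto
      also have "\<dots> \<le> (\<Sum>i. ennreal (r i ^ k))"
      proof (intro suminf_le)
        fix i
        have "S i \<inter> A = {} \<or> S i \<inter> B = {}"
        proof (rule ccontr)
          assume "\<not> ?thesis"
          then obtain x y where "x \<in> S i" "x \<in> A" "y \<in> S i" "y \<in> B" by auto
          then have "d \<le> dist x y" "dist x y \<le> \<epsilon>"
            using sep hausdorff_coverD(3)[OF cov, of i] hausdorff_coverD(4)[OF cov, of x i y] by auto
          then show False using \<epsilon>(3) by simp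
        qed
        then show "ennreal (?R A i ^ k) + ennreal (?R B i ^ k) \<le> ennreal (r i ^ k)"
          using k by (auto simp: zero_power)
      qed auto
      finally show "hausdorff_pre k \<epsilon> A + hausdorff_pre k \<epsilon> B \<le> (\<Sum>i. ennreal (r i ^ k))" .
    qed
    also have "\<dots> \<le> hausdorff k (A \<union> B)"
      by (rule hausdorff_pre_le_hausdorff) fact
    finally show ?thesis .
  qed
  then have "(SUP n. hausdorff_pre k (1 / real (Suc n)) A + hausdorff_pre k (1 / real (Suc n)) B)
      \<le> hausdorff k (A \<union> B)"
    by (intro SUP_least) auto
  then show "hausdorff k A + hausdorff k B \<le> hausdorff k (A \<union> B)"
    unfolding hausdorff_def by (subst (asm) ennreal_SUP_add[OF inc inc])
qed (rule hausdorff_Un[OF k])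

lemma hausdorff_outer_measure_space: "k > 0 \<Longrightarrow> outer_measure_space UNIV (hausdorff k)"
  by (auto simp: outer_measure_space_def positive_def increasing_def countably_subadditive_def
      hausdorff_empty hausdorff_mono hausdorff_subadditive)

text \<open>
  These are the sets that are measurable in the sense of Caratheodory. They include all null sets, so that
  images of Lebesgue measurable sets can be measured, not just Borel sets.
\<close>

definition hausdorff_sets :: "nat \<Rightarrow> 'a::metric_space set set"
  where "hausdorff_sets k = lambda_system UNIV UNIV (hausdorff k)"

definition hausdorff_measure :: "nat \<Rightarrow> 'a::metric_space measure"
  where "hausdorff_measure k = measure_of UNIV (hausdorff_sets k) (hausdorff k)"

lemma measure_space_hausdorff:
  assumes "k > 0"
  shows "measure_space (UNIV :: 'a::metric_space set) (hausdorff_sets k) (hausdorff k)"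
proof -
  interpret sigma_algebra "UNIV :: 'a set" UNIV
    using sigma_algebra_Pow[of UNIV] by simp
  show ?thesis
    unfolding hausdorff_sets_def
    by (rule caratheodory_lemma[OF hausdorff_outer_measure_space[OF assms]])
qed

lemma space_hausdorff_measure [simp]: "space (hausdorff_measure k) = UNIV"
  by (simp add: hausdorff_measure_def space_measure_of_conv)

lemma sets_hausdorff_measure: "k > 0 \<Longrightarrow> sets (hausdorff_measure k) = hausdorff_sets k"
  using measure_space_hausdorff[of k]
  unfolding hausdorff_measure_def measure_space_def
  by (metis sigma_algebra.sets_measure_of_eq)

lemma emeasure_hausdorff_measure:
  fixes E :: "'a::metric_space set"
  assumes "k > 0" "E \<in> sets (hausdorff_measure k)"
  shows "emeasure (hausdorff_measure k) E = hausdorff k E"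
proof -
  have "E \<in> hausdorff_sets k"
    using assms by (simp add: sets_hausdorff_measure)
  then show ?thesis
    using measure_space_hausdorff[OF assms(1), where 'a = 'a] unfolding hausdorff_measure_def
    by (intro emeasure_measure_of_sigma) (auto simp: measure_space_def)
qed

lemma hausdorff_setsI:
  assumes "k > 0" "\<And>T. hausdorff k (E \<inter> T) + hausdorff k (T - E) \<le> hausdorff k T"
  shows "E \<in> hausdorff_sets k"
proof -
  have "hausdorff k T \<le> hausdorff k (E \<inter> T) + hausdorff k (T - E)" for T
    using hausdorff_Un[OF assms(1), of "E \<inter> T" "T - E"]
    by (metis Int_Diff_Un Int_commute)
  then show ?thesis
    using assms(2) by (auto simp: hausdorff_sets_def lambda_system_def Compl_eq_Diff_UNIV[symmetric]
        Diff_eq Int_commute intro!: antisym)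
qed

lemma hausdorff_null_in_sets:
  assumes "k > 0" "hausdorff k E = 0"
  shows "E \<in> hausdorff_sets k"
  using assms hausdorff_mono[of "E \<inter> _" E k] hausdorff_mono[of "_ - E" _ k]
  by (intro hausdorff_setsI) auto

text \<open>
  The part of \<open>T\<close> at distance at least \<open>1/(n+1)\<close> from \<open>F\<close> is separated from \<open>F\<close>, so additivity holds for
  it. What remains of \<open>T - F\<close> is a union of annuli, whose measures form a convergent series because
  annuli whose indices differ by two are separated from each other; its tails are therefore small.
\<close>

lemma closed_in_hausdorff_sets:
  fixes F :: "'a::metric_space set"
  assumes k: "k > 0" and F: "closed F"
  shows "F \<in> hausdorff_sets k"
proof (cases "F = {}")
  case True
  then show ?thesis using k hausdorff_empty hausdorff_null_in_sets by blast
next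
  case False
  show ?thesis
  proof (rule hausdorff_setsI[OF k])
    fix T :: "'a set"
    show "hausdorff k (F \<inter> T) + hausdorff k (T - F) \<le> hausdorff k T"
    proof (rule ennreal_le_epsilon)
      fix e :: real assume e: "e > 0" and fin: "hausdorff k T < top"
      define u where "u n = 1 / real (Suc n)" for n
      define g where "g x = infdist x F" for x
      define E where "E n = {x\<in>T. u n \<le> g x}" for n
      define D where "D n = {x\<in>T. u (Suc n) \<le> g x \<and> g x < u n}" for n
      have u: "u n > 0" "m \<le> n \<Longrightarrow> u n \<le> u m" "m < n \<Longrightarrow> u n < u m" for m n
        by (auto simp: u_def divide_simps)
      have gd: "g x \<le> g y + dist x y" for x y
        unfolding g_def by (rule infdist_triangle)
      \<comment> \<open>Annuli of equal parity are pairwise separated.\<close>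
      have odd_even: "(\<Sum>j<m. hausdorff k (D (2 * j + p))) \<le> hausdorff k (\<Union>j<m. D (2 * j + p))" for p m
      proof (induction m)
        case 0
        then show ?case by simp
      next
        case (Suc m)
        let ?A = "\<Union>j<m. D (2 * j + p)" and ?B = "D (2 * m + p)"
        have "hausdorff k (?A \<union> ?B) = hausdorff k ?A + hausdorff k ?B"
        proof (cases "m = 0")
          case True
          then show ?thesis using hausdorff_empty[OF k, where 'a = 'a] by simp
        next
          case False
          show ?thesis
          proof (rule hausdorff_separated[OF _ _ k])
            show "0 < u (2 * m + p - 1) - u (2 * m + p)"
              using u(3)[of "2 * m + p - 1" "2 * m + p"] False by simp
            fix x y assume "x \<in> ?A" "y \<in> ?B"
            then obtain j where "j < m" "u (Suc (2 * j + p)) \<le> g x" "g y < u (2 * m + p)"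
              by (auto simp: D_def)
            moreover from this have "u (2 * m + p - 1) \<le> u (Suc (2 * j + p))"
              by (intro u(2)) auto
            ultimately show "u (2 * m + p - 1) - u (2 * m + p) \<le> dist x y"
              using gd[of x y] by linarith
          qed
        qed
        then show ?case
          using Suc by (simp add: lessThan_Suc Un_commute add.commute add_left_mono)
      qed
      have sum_le: "(\<Sum>j<m. hausdorff k (D j)) \<le> 2 * hausdorff k T" for m
      proof -
        have "(\<Sum>j<m. hausdorff k (D j)) \<le> (\<Sum>j<2 * m. hausdorff k (D j))"
          by (intro sum_mono2) auto
        also have "\<dots> = (\<Sum>j<m. hausdorff k (D (2 * j + 0))) + (\<Sum>j<m. hausdorff k (D (2 * j + 1)))"
          by (induction m) (auto simp: algebra_simps)
        also have "\<dots> \<le> hausdorff k T + hausdorff k T"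
          by (intro add_mono order_trans[OF odd_even] hausdorff_mono) (auto simp: D_def)
        finally show ?thesis by (simp add: mult_2)
      qed
      have "(\<Sum>j. hausdorff k (D j)) \<le> 2 * hausdorff k T"
        using ennreal_suminf_bound_add[of "\<lambda>j. hausdorff k (D j)" 0] sum_le by simp
      then have finD: "(\<Sum>j. hausdorff k (D j)) < top"
        using fin by (metis ennreal_mult_less_top ennreal_numeral_less_top order_le_less_trans less_top)
      obtain n where n: "(\<Sum>j. hausdorff k (D j)) \<le> (\<Sum>j<n. hausdorff k (D j)) + ennreal e"
      proof -
        have "\<exists>n\<in>UNIV. (\<Sum>j. hausdorff k (D j)) < (\<Sum>j<n. hausdorff k (D j)) + ennreal e"
          by (rule SUP_approx_ennreal[OF e]) (use finD in \<open>simp_all only: suminf_eq_SUP infinity_ennreal_def less_irrefl, auto\<close>)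
        then show ?thesis
          using that less_imp_le by blast
      qed
      have "(\<Sum>j<n. hausdorff k (D j)) + (\<Sum>j. hausdorff k (D (j + n))) \<le> (\<Sum>j<n. hausdorff k (D j)) + ennreal e"
        using n suminf_offset[of "\<lambda>j. hausdorff k (D j)" n] by (simp add: add.commute)
      moreover have "(\<Sum>j<n. hausdorff k (D j)) < top"
        by (rule le_less_trans[OF sum_le_suminf finD]) auto
      ultimately have tail: "(\<Sum>j. hausdorff k (D (j + n))) \<le> ennreal e"
        unfolding ennreal_add_left_cancel_le infinity_ennreal_def by (blast dest: less_imp_neq)
      have "T - F \<subseteq> E n \<union> (\<Union>j. D (j + n))"
      proof
        fix x assume x: "x \<in> T - F"
        then have "g x > 0"
          using False F in_closed_iff_infdist_zero infdist_nonneg[of x F] unfolding g_def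
          by (metis DiffE order_le_less)
        then obtain m where "u m < g x"
          unfolding u_def using nat_approx_posE by blast
        define m0 where "m0 = (LEAST m. u m \<le> g x)"
        have m0: "u m0 \<le> g x" "\<And>m. m < m0 \<Longrightarrow> g x < u m"
          unfolding m0_def using LeastI[of "\<lambda>m. u m \<le> g x" m] \<open>u m < g x\<close> not_less_Least
          by (auto simp: not_le[symmetric])
        show "x \<in> E n \<union> (\<Union>j. D (j + n))"
        proof (cases "m0 \<le> n")
          case True
          then have "u n \<le> g x" using m0(1) u(2)[of m0 n] by simp
          then show ?thesis using x by (simp add: E_def)
        next
          case False
          then have "x \<in> D ((m0 - 1 - n) + n)"
            using x m0(1) m0(2)[of "m0 - 1"] by (auto simp: D_def)
          then show ?thesis by blast
        qed
      qed
      then have "hausdorff k (T - F) \<le> hausdorff k (E n \<union> (\<Union>j. D (j + n)))"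
        by (rule hausdorff_mono)
      also have "\<dots> \<le> hausdorff k (E n) + hausdorff k (\<Union>j. D (j + n))"
        by (rule hausdorff_Un[OF k])
      also have "\<dots> \<le> hausdorff k (E n) + ennreal e"
        using hausdorff_subadditive[of k "\<lambda>j. D (j + n)"] tail order_trans by (intro add_left_mono) blast
      finally have "hausdorff k (F \<inter> T) + hausdorff k (T - F) \<le> (hausdorff k (F \<inter> T) + hausdorff k (E n)) + ennreal e"
        by (simp add: add.assoc add_left_mono)
      also have "hausdorff k (F \<inter> T) + hausdorff k (E n) = hausdorff k ((F \<inter> T) \<union> E n)"
      proof (rule hausdorff_separated[symmetric, OF _ u(1) k])
        fix x y assume "x \<in> F \<inter> T" "y \<in> E n"
        then show "u n \<le> dist x y"
          using gd[of y x] by (auto simp: E_def g_def dist_commute)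
      qed
      also have "\<dots> \<le> hausdorff k T"
        by (rule hausdorff_mono) (auto simp: E_def)
      finally show "hausdorff k (F \<inter> T) + hausdorff k (T - F) \<le> hausdorff k T + ennreal e"
        by (simp add: add_right_mono)
    qed
  qed
qed

lemma borel_subset_hausdorff_sets:
  assumes "k > 0"
  shows "sets borel \<subseteq> sets (hausdorff_measure k :: 'a::metric_space measure)"
proof -
  have "Collect closed \<subseteq> sets (hausdorff_measure k :: 'a measure)"
    using closed_in_hausdorff_sets[OF assms] by (auto simp: sets_hausdorff_measure[OF assms])
  then show ?thesis
    unfolding borel_eq_closed
    by (metis sets.sigma_sets_subset sets_measure_of space_hausdorff_measure top_greatest Pow_UNIV)
qed

section \<open>Lebesgue measure as a multiple of Hausdorff measure\<close>

text \<open>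
  Lebesgue measure on \<open>\<real>\<^sup>n\<close>, as a Borel measure on the whole sequence space that vanishes outside \<open>Rn n\<close>.
  In this form the measures for different \<open>n\<close> share one type and one \<open>\<sigma>\<close>-algebra.
\<close>

definition leb :: "nat \<Rightarrow> fseq measure"
  where "leb n = distr (Pi\<^sub>M {..<n} (\<lambda>_. lborel)) borel (extend_zero n)"

interpretation lborel_product: product_sigma_finite "\<lambda>_::nat. lborel :: real measure"
  by standard

lemma measurable_extend_zero [measurable]:
  "extend_zero n \<in> measurable (Pi\<^sub>M {..<n} (\<lambda>_. lborel)) borel"
  unfolding extend_zero_eq_sum[abs_def] by measurable

lemma sets_leb [simp, measurable_cong]: "sets (leb n) = sets borel"
  by (simp add: leb_def)

lemma space_leb [simp]: "space (leb n) = UNIV"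
  by (simp add: leb_def)

lemma nn_integral_leb:
  "f \<in> borel_measurable borel \<Longrightarrow>
    (\<integral>\<^sup>+x. f x \<partial>leb n) = (\<integral>\<^sup>+x. f (extend_zero n x) \<partial>Pi\<^sub>M {..<n} (\<lambda>_. lborel))"
  unfolding leb_def by (rule nn_integral_distr) auto

lemma emeasure_leb_box:
  assumes "\<And>i. i < n \<Longrightarrow> A i \<in> sets borel"
  shows "{x \<in> Rn n. \<forall>i<n. coord x i \<in> A i} \<in> sets borel"
    and "emeasure (leb n) {x \<in> Rn n. \<forall>i<n. coord x i \<in> A i} = (\<Prod>i<n. emeasure lborel (A i))"
proof -
  have "{x \<in> Rn n. \<forall>i<n. coord x i \<in> A i} = Rn n \<inter> (\<Inter>i\<in>{..<n}. (\<lambda>x. coord x i) -` A i) "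
    by auto
  moreover have "(\<lambda>x. coord x i) -` A i \<in> sets borel" if "i < n" for i
    using measurable_sets[OF borel_measurable_coord assms[OF that], of i] by simp
  ultimately show *: "{x \<in> Rn n. \<forall>i<n. coord x i \<in> A i} \<in> sets borel"
    by (cases "n = 0") (auto intro!: sets.Int sets.finite_INT)
  have "extend_zero n -` {x \<in> Rn n. \<forall>i<n. coord x i \<in> A i} \<inter> space (Pi\<^sub>M {..<n} (\<lambda>_. lborel))
      = Pi\<^sub>E {..<n} A"
    by (auto simp: space_PiM coord_extend_zero PiE_iff)
  then show "emeasure (leb n) {x \<in> Rn n. \<forall>i<n. coord x i \<in> A i} = (\<Prod>i<n. emeasure lborel (A i))"
    unfolding leb_def using assms *
    by (subst emeasure_distr) (auto intro!: lborel_product.emeasure_PiM)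
qed

lemma unit_cube_eq: "unit_cube n = {x \<in> Rn n. \<forall>i<n. coord x i \<in> {0..1}}"
  by (auto simp: unit_cube_def)

lemma unit_cube_borel [measurable]: "unit_cube n \<in> sets borel"
  unfolding unit_cube_eq by (rule emeasure_leb_box) auto

lemma emeasure_leb_unit_cube [simp]: "emeasure (leb n) (unit_cube n) = 1"
  unfolding unit_cube_eq by (subst emeasure_leb_box) auto

lemma AE_leb_Rn: "AE x in leb n. x \<in> Rn n"
  unfolding leb_def by (subst AE_distr_iff) (auto simp: pred_def)

lemma emeasure_leb_Int_Rn: "E \<in> sets borel \<Longrightarrow> emeasure (leb n) (E \<inter> Rn n) = emeasure (leb n) E"
  using AE_leb_Rn[of n] by (intro emeasure_eq_AE) auto

lemma sigma_finite_on_Rn: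
  assumes "sets M = sets borel" "emeasure M (- Rn n) = 0"
    and "\<And>k::nat. emeasure M {x \<in> Rn n. \<forall>i<n. coord x i \<in> {-real k..real k}} < \<infinity>"
  shows "sigma_finite_measure M"
proof
  define B where "B k = {x \<in> Rn n. \<forall>i<n. coord x i \<in> {-real k..real k}}" for k
  have "x \<in> (\<Union>k. B k)" if "x \<in> Rn n" for x
  proof -
    obtain k where "norm x \<le> real k" using real_arch_simple by blast
    then have "\<bar>coord x i\<bar> \<le> real k" for i
      using abs_coord_le_norm order_trans by blast
    then have "x \<in> B k"
      using that unfolding B_def by (simp add: abs_le_iff minus_le_iff)
    then show ?thesis by blast
  qed
  moreover have "B k \<in> sets borel" for k
    unfolding B_def by (rule emeasure_leb_box) auto
  ultimately show "\<exists>A. countable A \<and> A \<subseteq> sets M \<and> \<Union> A = space M \<and> (\<forall>a\<in>A. emeasure M a \<noteq> \<infinity>)"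
    using assms sets_eq_imp_space_eq[OF assms(1)]
    by (intro exI[of _ "insert (- Rn n) (range B)"]) (auto simp: B_def less_top)
qed

lemma sigma_finite_leb: "sigma_finite_measure (leb n)"
proof (rule sigma_finite_on_Rn)
  show "emeasure (leb n) (- Rn n) = 0"
    using AE_leb_Rn[of n] by (subst (asm) AE_iff_measurable[of "- Rn n"]) auto
  show "emeasure (leb n) {x \<in> Rn n. \<forall>i<n. coord x i \<in> {-real k..real k}} < \<infinity>" for k
    by (subst emeasure_leb_box) (auto simp: ennreal_power simp del: power_eq_top_ennreal)
qed simp

lemma emeasure_leb_translate:
  assumes x: "x \<in> Rn n" and E: "E \<in> sets borel"
  shows "emeasure (leb n) ((\<lambda>a. a + x) -` E) = emeasure (leb n) E"
proof -
  let ?P = "Pi\<^sub>M {..<n} (\<lambda>_. lborel :: real measure)"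
  let ?t = "\<lambda>f. \<lambda>i\<in>{..<n}. f i + coord x i"
  have t [measurable]: "?t \<in> measurable ?P ?P"
    by measurable
  have "distr ?P ?P ?t = ?P"
  proof (rule lborel_product.PiM_eqI)
    fix A :: "nat \<Rightarrow> real set" assume A: "\<And>i. i \<in> {..<n} \<Longrightarrow> A i \<in> sets lborel"
    have "?t -` Pi\<^sub>E {..<n} A \<inter> space ?P = Pi\<^sub>E {..<n} (\<lambda>i. (\<lambda>a. a + coord x i) -` A i)"
      by (auto simp: space_PiM PiE_iff)
    moreover have "emeasure lborel ((\<lambda>a. a + coord x i) -` A i) = emeasure lborel (A i)" if "i < n" for i
      using A[of i] that lborel_distr_plus[of "coord x i"]
        emeasure_distr[of "(+) (coord x i)" lborel borel "A i"]
      by (simp add: add.commute[of _ "coord x i"])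
    moreover have "(\<lambda>a. a + coord x i) -` A i \<in> sets borel" if "i < n" for i
      using A[of i] that measurable_sets[of "\<lambda>a. a + coord x i" borel borel "A i"] by simp
    moreover have "Pi\<^sub>E {..<n} A \<in> sets ?P"
      using A by (intro sets_PiM_I_finite) auto
    ultimately show "emeasure (distr ?P ?P ?t) (Pi\<^sub>E {..<n} A) = (\<Prod>i<n. emeasure lborel (A i))"
      using lborel_product.emeasure_PiM[of "{..<n}" "\<lambda>i. (\<lambda>a. a + coord x i) -` A i"]
      by (simp add: emeasure_distr[OF t])
  qed auto
  then have eq: "emeasure (leb n) E = emeasure (distr (distr ?P ?P ?t) borel (extend_zero n)) E"
    by (simp add: leb_def)
  have "extend_zero n (?t f) = extend_zero n f + x" for f
    using x by (intro fseq_eqI) (auto simp: coord_extend_zero Rn_def)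
  then have "extend_zero n \<circ> ?t = (\<lambda>a. a + x) \<circ> extend_zero n"
    by (simp add: fun_eq_iff)
  then have "distr (distr ?P ?P ?t) borel (extend_zero n) = distr (leb n) borel (\<lambda>a. a + x)"
    unfolding leb_def by (subst (1 2) distr_distr) auto
  then show ?thesis
    using eq E by (simp add: emeasure_distr)
qed

text \<open>
  This is the uniqueness of translation invariant measures up to a factor: integrating
  \<open>indicator E x * indicator F (x + y)\<close> first over \<open>y\<close> gives the left-hand side, and first over \<open>x\<close>,
  after a translation by \<open>y\<close>, the right-hand side.
\<close>

lemma translation_invariant_exchange:
  fixes M N :: "fseq measure"
  assumes sets: "sets M = sets borel" "sets N = sets borel"
    and sf: "sigma_finite_measure M" "sigma_finite_measure N"
    and ae: "AE x in M. x \<in> Rn n" "AE x in N. x \<in> Rn n"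
    and tM: "\<And>x E. x \<in> Rn n \<Longrightarrow> E \<in> sets borel \<Longrightarrow> emeasure M ((\<lambda>a. a + x) -` E) = emeasure M E"
    and tN: "\<And>x E. x \<in> Rn n \<Longrightarrow> E \<in> sets borel \<Longrightarrow> emeasure N ((\<lambda>a. a + x) -` E) = emeasure N E"
    and E[measurable]: "E \<in> sets borel" and F[measurable]: "F \<in> sets borel"
  shows "emeasure M E * emeasure N F = emeasure M F * emeasure N (uminus -` E)"
proof -
  interpret M: sigma_finite_measure M by fact
  interpret N: sigma_finite_measure N by fact
  interpret pair_sigma_finite M N ..
  note [measurable_cong] = sets
  have pre: "g -` S \<in> sets borel" if "g \<in> borel_measurable borel" "S \<in> sets borel"
    for g :: "fseq \<Rightarrow> fseq" and S
    using measurable_sets[OF that] by simp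
  have tr: "(\<lambda>a. a + x) -` S \<in> sets borel" if "S \<in> sets borel" for x :: fseq and S
    by (rule pre[OF _ that]) simp
  have rf: "(\<lambda>a. x - a) -` S \<in> sets borel" if "S \<in> sets borel" for x :: fseq and S
    by (rule pre[OF _ that]) simp
  have "emeasure M E * emeasure N F = (\<integral>\<^sup>+x. indicator E x * emeasure N F \<partial>M)"
    using sets by (simp add: nn_integral_multc)
  also have "\<dots> = (\<integral>\<^sup>+x. indicator E x * emeasure N ((\<lambda>a. a + x) -` F) \<partial>M)"
    using ae(1) by (intro nn_integral_cong_AE) (auto simp: tN)
  also have "\<dots> = (\<integral>\<^sup>+x. (\<integral>\<^sup>+y. indicator E x * indicator F (y + x) \<partial>N) \<partial>M)"
    using sets tr[OF F]
    by (intro nn_integral_cong)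
      (simp add: nn_integral_cmult nn_integral_indicator[symmetric] indicator_def vimage_def
        del: nn_integral_indicator)
  also have "\<dots> = (\<integral>\<^sup>+y. (\<integral>\<^sup>+x. indicator E x * indicator F (y + x) \<partial>M) \<partial>N)"
    by (rule Fubini'[symmetric]) measurable
  also have "\<dots> = (\<integral>\<^sup>+y. emeasure M (E \<inter> (\<lambda>a. a + y) -` F) \<partial>N)"
    using sets tr[OF F]
    by (intro nn_integral_cong)
      (simp add: nn_integral_indicator[symmetric] indicator_inter_arith indicator_vimage comp_def add.commute
        del: nn_integral_indicator)
  also have "\<dots> = (\<integral>\<^sup>+y. emeasure M (F \<inter> (\<lambda>a. a + (- y)) -` E) \<partial>N)"
  proof (rule nn_integral_cong_AE, use ae(2) in eventually_elim)
    fix y assume y: "y \<in> Rn n"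
    have "E \<inter> (\<lambda>a. a + y) -` F = (\<lambda>a. a + y) -` (F \<inter> (\<lambda>a. a + (- y)) -` E)"
      by auto
    then show "emeasure M (E \<inter> (\<lambda>a. a + y) -` F) = emeasure M (F \<inter> (\<lambda>a. a + (- y)) -` E)"
      using tM[OF y sets.Int[OF F tr[OF E, of "- y"]]] by simp
  qed
  also have "\<dots> = (\<integral>\<^sup>+y. (\<integral>\<^sup>+x. indicator F x * indicator E (x - y) \<partial>M) \<partial>N)"
    using sets tr[OF E, of "- _"]
    by (intro nn_integral_cong)
      (simp add: nn_integral_indicator[symmetric] indicator_inter_arith indicator_vimage comp_def
        del: nn_integral_indicator)
  also have "\<dots> = (\<integral>\<^sup>+x. (\<integral>\<^sup>+y. indicator F x * indicator E (x - y) \<partial>N) \<partial>M)"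
    by (rule Fubini') measurable
  also have "\<dots> = (\<integral>\<^sup>+x. indicator F x * emeasure N ((\<lambda>a. x - a) -` E) \<partial>M)"
    using sets rf[OF E]
    by (intro nn_integral_cong)
      (simp add: nn_integral_cmult nn_integral_indicator[symmetric] indicator_def vimage_def
        del: nn_integral_indicator)
  also have "\<dots> = (\<integral>\<^sup>+x. indicator F x * emeasure N (uminus -` E) \<partial>M)"
  proof (rule nn_integral_cong_AE, use ae(1) in eventually_elim)
    fix x assume x: "x \<in> Rn n"
    have "uminus -` E = (\<lambda>a. a + x) -` ((\<lambda>a. x - a) -` E)"
      by auto
    then show "indicator F x * emeasure N ((\<lambda>a. x - a) -` E) = indicator F x * emeasure N (uminus -` E)"
      using tN[OF x rf[OF E]] by simp
  qed
  also have "\<dots> = emeasure M F * emeasure N (uminus -` E)"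
    using sets by (simp add: nn_integral_multc)
  finally show ?thesis .
qed

text \<open>
  The cube is covered by \<open>(m+1)^n\<close> cubes of side \<open>1/(m+1)\<close>, whose diameter is at most \<open>n/(m+1)\<close>.
\<close>

lemma hausdorff_unit_cube_finite:
  assumes n: "n > 0"
  shows "hausdorff n (unit_cube n) < top"
proof -
  have "hausdorff n (unit_cube n) \<le> ennreal (real n ^ n)"
  proof (rule hausdorff_least)
    fix \<delta> :: real assume "\<delta> > 0"
    obtain m where m: "real n / real (Suc m) < \<delta>"
    proof -
      obtain m where "1 / real (Suc m) < \<delta> / n"
        using nat_approx_posE[of "\<delta> / n"] \<open>\<delta> > 0\<close> n by auto
      then show ?thesis
        using that[of m] n by (simp add: field_simps)
    qed
    define G where "G = Pi\<^sub>E {..<n} (\<lambda>_. {..m})"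
    have "finite G" "card G = Suc m ^ n"
      by (auto simp: G_def card_PiE intro!: finite_PiE)
    then obtain h where h: "bij_betw h {..<Suc m ^ n} G"
      by (metis ex_bij_betw_nat_finite atLeast0LessThan)
    define box where "box g = {x \<in> Rn n. \<forall>i<n. real (g i) \<le> Suc m * coord x i \<and> Suc m * coord x i \<le> g i + 1}"
      for g :: "nat \<Rightarrow> nat"
    define A where "A i = (if i < Suc m ^ n then box (h i) else {})" for i
    define r where "r i = (if i < Suc m ^ n then real n / real (Suc m) else 0)" for i :: nat
    have "(A, r) \<in> hausdorff_cover \<delta> (unit_cube n)"
    proof (rule hausdorff_coverI)
      show "unit_cube n \<subseteq> (\<Union>i. A i)"
      proof
        fix x assume x: "x \<in> unit_cube n"
        define g where "g = (\<lambda>i\<in>{..<n}. min m (nat \<lfloor>Suc m * coord x i\<rfloor>))"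
        have "x \<in> box g"
          unfolding box_def
        proof (intro CollectI conjI allI impI)
          fix i assume i: "i < n"
          have c: "0 \<le> coord x i" "coord x i \<le> 1"
            using x i by (auto simp: unit_cube_def)
          have "real (nat \<lfloor>Suc m * coord x i\<rfloor>) \<le> Suc m * coord x i"
               "Suc m * coord x i \<le> real (nat \<lfloor>Suc m * coord x i\<rfloor>) + 1"
            using c by (simp_all del: of_nat_Suc)
          moreover have "Suc m * coord x i \<le> real m + 1"
            using mult_left_mono[OF c(2) of_nat_0_le_iff[of "Suc m"]] by (simp add: add.commute)
          moreover have "real (g i) = min (real m) (real (nat \<lfloor>Suc m * coord x i\<rfloor>))"
            using i by (simp add: g_def)
          ultimately show "real (g i) \<le> Suc m * coord x i" "Suc m * coord x i \<le> g i + 1"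
            by linarith+
        qed (use x in \<open>simp add: unit_cube_def\<close>)
        moreover have "g \<in> G"
          by (auto simp: g_def G_def)
        then obtain i where "i < Suc m ^ n" "h i = g"
          using h unfolding bij_betw_def by (metis imageE lessThan_iff)
        ultimately have "x \<in> A i"
          by (simp add: A_def)
        then show "x \<in> (\<Union>i. A i)" by blast
      qed
      show "dist x y \<le> r i" if "x \<in> A i" "y \<in> A i" for i x y
      proof -
        have i: "i < Suc m ^ n" and xy: "x \<in> box (h i)" "y \<in> box (h i)"
          using that by (auto simp: A_def split: if_splits)
        have "dist x y \<le> (\<Sum>j<n. \<bar>coord (x - y) j\<bar>)"
          using xy unfolding dist_norm by (intro norm_Rn_le_sum Rn_diff) (auto simp: box_def)
        also have "\<dots> \<le> (\<Sum>j<n. 1 / real (Suc m))"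
        proof (rule sum_mono)
          fix j assume "j \<in> {..<n}"
          then have "\<bar>Suc m * coord x j - Suc m * coord y j\<bar> \<le> 1"
            using xy by (fastforce simp: box_def)
          then have "Suc m * \<bar>coord x j - coord y j\<bar> \<le> 1"
            by (simp add: abs_mult flip: right_diff_distrib)
          then show "\<bar>coord (x - y) j\<bar> \<le> 1 / real (Suc m)"
            by (simp add: field_simps)
        qed
        finally show ?thesis using i by (simp add: r_def)
      qed
    qed (use m \<open>\<delta> > 0\<close> in \<open>auto simp: r_def less_imp_le\<close>)
    then have "hausdorff_pre n \<delta> (unit_cube n) \<le> (\<Sum>i. ennreal (r i ^ n))"
      by (rule hausdorff_pre_le)
    also have "\<dots> = (\<Sum>i<Suc m ^ n. ennreal (r i ^ n))"
      by (rule suminf_finite) (use n in \<open>auto simp: r_def zero_power\<close>)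
    also have "\<dots> = (\<Sum>i<Suc m ^ n. ennreal ((real n / real (Suc m)) ^ n))"
      by (rule sum.cong) (auto simp: r_def)
    also have "\<dots> = ennreal (real (Suc m ^ n) * (real n / real (Suc m)) ^ n)"
      by (subst sum_ennreal) (auto simp del: of_nat_Suc)
    also have "\<dots> = ennreal (real n ^ n)"
      by (simp add: power_divide del: of_nat_Suc)
    finally show "hausdorff_pre n \<delta> (unit_cube n) \<le> ennreal (real n ^ n)" .
  qed
  then show ?thesis
    using ennreal_less_top le_less_trans by blast
qed

text \<open>
  A subset of \<open>\<real>\<^sup>n\<close> of diameter at most \<open>r\<close> lies in a cube of side \<open>2 * r\<close>. The factor is not sharp; the
  lemma only serves to show that the unit cube is not null.
\<close>

lemma leb_le_hausdorff:
  assumes n: "n > 0" and E: "E \<in> sets borel" "E \<subseteq> Rn n"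
  shows "ennreal (inverse (2 ^ n)) * emeasure (leb n) E \<le> hausdorff n E"
proof -
  have "ennreal (inverse (2 ^ n)) * emeasure (leb n) E \<le> hausdorff_pre n 1 E"
  proof (rule hausdorff_pre_greatest)
    fix A r assume cov: "(A, r) \<in> hausdorff_cover 1 E"
    define p where "p i = (SOME x. x \<in> A i \<inter> E)" for i
    define box where "box i = {x \<in> Rn n. \<forall>j<n. coord x j \<in> {coord (p i) j - r i .. coord (p i) j + r i}}" for i
    have r: "r i \<ge> 0" for i using hausdorff_coverD(2)[OF cov] .
    have box: "box i \<in> sets borel" "emeasure (leb n) (box i) = ennreal ((2 * r i) ^ n)" for i
      unfolding box_def
      by (rule emeasure_leb_box, simp, subst emeasure_leb_box)
        (use r[of i] in \<open>auto simp: prod_ennreal ennreal_power\<close>)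
    have "E \<subseteq> (\<Union>i. box i)"
    proof
      fix x assume x: "x \<in> E"
      then obtain i where i: "x \<in> A i"
        using hausdorff_coverD(1)[OF cov] by blast
      then have "p i \<in> A i \<inter> E"
        unfolding p_def using x by (intro someI) auto
      then have "norm (x - p i) \<le> r i"
        using hausdorff_coverD(4)[OF cov i] by (simp add: dist_norm)
      then have "\<bar>coord x j - coord (p i) j\<bar> \<le> r i" for j
        using abs_coord_le_norm[of "x - p i" j] by simp
      then have "coord x j \<in> {coord (p i) j - r i .. coord (p i) j + r i}" for j
        by (auto simp: abs_le_iff algebra_simps)
      then have "x \<in> box i"
        using x E(2) by (auto simp: box_def)
      then show "x \<in> (\<Union>i. box i)" by blast
    qed
    then have "emeasure (leb n) E \<le> emeasure (leb n) (\<Union>i. box i)"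
      using box(1) by (intro emeasure_mono) auto
    also have "\<dots> \<le> (\<Sum>i. emeasure (leb n) (box i))"
      using box(1) by (intro emeasure_subadditive_countably) auto
    also have "\<dots> = ennreal (2 ^ n) * (\<Sum>i. ennreal (r i ^ n))"
      using r by (simp add: box(2) power_mult_distrib ennreal_mult del: ennreal_power)
    finally have "ennreal (inverse (2 ^ n)) * emeasure (leb n) E
        \<le> ennreal (inverse (2 ^ n)) * (ennreal (2 ^ n) * (\<Sum>i. ennreal (r i ^ n)))"
      by (rule mult_left_mono) simp
    also have "\<dots> = (\<Sum>i. ennreal (r i ^ n))"
      by (simp add: mult.assoc[symmetric] ennreal_mult[symmetric] del: ennreal_power)
    finally show "ennreal (inverse (2 ^ n)) * emeasure (leb n) E \<le> (\<Sum>i. ennreal (r i ^ n))" .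
  qed
  also have "\<dots> \<le> hausdorff n E"
    by (rule hausdorff_pre_le_hausdorff) simp
  finally show ?thesis .
qed

lemma hausdorff_unit_cube_pos: "n > 0 \<Longrightarrow> hausdorff n (unit_cube n) > 0"
proof -
  assume "n > 0"
  moreover have "unit_cube n \<subseteq> Rn n"
    by (auto simp: unit_cube_def)
  ultimately have "ennreal (inverse (2 ^ n)) * 1 \<le> hausdorff n (unit_cube n)"
    using leb_le_hausdorff[of n "unit_cube n"] by (simp only: emeasure_leb_unit_cube unit_cube_borel)
  then show ?thesis
    by (rule less_le_trans[rotated]) simp
qed

lemma hausdorff_eq_leb:
  assumes n: "n > 0" and E: "E \<in> sets borel" "E \<subseteq> Rn n"
  shows "hausdorff n E = hausdorff n (unit_cube n) * emeasure (leb n) E"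
proof -
  define H where "H = density (distr (hausdorff_measure n) borel (\<lambda>x. x)) (indicator (Rn n))"
  have bs: "S \<in> sets (hausdorff_measure n)" if "S \<in> sets borel" for S :: "fseq set"
    using borel_subset_hausdorff_sets[OF n] that by blast
  have id: "(\<lambda>x :: fseq. x) \<in> measurable (hausdorff_measure n) borel"
    using bs by (auto simp: measurable_def)
  have H: "emeasure H S = hausdorff n (Rn n \<inter> S)" if "S \<in> sets borel" for S
    unfolding H_def using that
    by (subst emeasure_restricted)
      (simp_all add: emeasure_distr[OF id] emeasure_hausdorff_measure[OF n] bs)
  have sets: "sets H = sets borel"
    by (simp add: H_def)
  have null: "emeasure H (- Rn n) = 0"
    by (subst H) (auto simp: hausdorff_empty[OF n])
  have ae: "AE x in H. x \<in> Rn n"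
    using null sets sets_eq_imp_space_eq[OF sets] by (subst AE_iff_measurable[of "- Rn n"]) auto
  have sf: "sigma_finite_measure H"
  proof (rule sigma_finite_on_Rn[OF sets null])
    fix k :: nat
    define b where "b = extend_zero n (\<lambda>_. real k)"
    \<comment> \<open>A similarity whose image of the unit cube contains the cube of half-side k; the extra 1 keeps the
      factor positive for k = 0.\<close>
    let ?f = "\<lambda>x. (2 * real k + 1) *\<^sub>R x - b"
    have B: "{x \<in> Rn n. \<forall>i<n. coord x i \<in> {-real k..real k}} \<subseteq> ?f ` unit_cube n"
    proof safe
      fix x assume x: "x \<in> Rn n" "\<forall>i<n. coord x i \<in> {-real k..real k}"
      show "x \<in> ?f ` unit_cube n"
      proof (rule image_eqI)
        let ?y = "(1 / (2 * real k + 1)) *\<^sub>R (x + b)"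
        show "x = ?f ?y" by simp
        have "0 \<le> coord x i + real k" "coord x i + real k \<le> 2 * real k + 1" if "i < n" for i
          using x(2) that by fastforce+
        then show "?y \<in> unit_cube n"
          using x(1) unfolding unit_cube_def
          by (auto simp: b_def coord_extend_zero intro!: Rn_add Rn_scaleR divide_nonneg_pos)
      qed
    qed
    have "hausdorff n (?f ` unit_cube n) \<le> ennreal ((2 * real k + 1) ^ n) * hausdorff n ((\<lambda>x. x) ` unit_cube n)"
      by (rule hausdorff_image_le) (auto simp: dist_norm simp flip: scaleR_diff_right)
    also have "\<dots> < top"
      using hausdorff_unit_cube_finite[OF n] by (simp add: ennreal_mult_less_top del: ennreal_power)
    finally have "hausdorff n (?f ` unit_cube n) < top" .
    moreover have "hausdorff n (Rn n \<inter> {x \<in> Rn n. \<forall>i<n. coord x i \<in> {-real k..real k}})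
        \<le> hausdorff n (?f ` unit_cube n)"
      using B by (intro hausdorff_mono) blast
    moreover have "{x \<in> Rn n. \<forall>i<n. coord x i \<in> {-real k..real k}} \<in> sets borel"
      by (rule emeasure_leb_box) auto
    ultimately show "emeasure H {x \<in> Rn n. \<forall>i<n. coord x i \<in> {-real k..real k}} < \<infinity>"
      by (subst H) (auto simp only: infinity_ennreal_def intro: le_less_trans)
  qed
  have tH: "emeasure H ((\<lambda>a. a + x) -` S) = emeasure H S" if x: "x \<in> Rn n" and S: "S \<in> sets borel" for x S
  proof -
    have "(\<lambda>a. a + x) -` S \<in> sets borel"
      using measurable_sets[of "\<lambda>a. a + x" borel borel S] S by simp
    moreover have "Rn n \<inter> S = (\<lambda>a. a + x) ` (Rn n \<inter> (\<lambda>a. a + x) -` S)"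
    proof safe
      fix y assume "y \<in> Rn n" "y \<in> S"
      then show "y \<in> (\<lambda>a. a + x) ` (Rn n \<inter> (\<lambda>a. a + x) -` S)"
        using x by (intro image_eqI[of _ _ "y - x"]) (auto intro: Rn_diff)
    qed (use x in \<open>auto intro: Rn_add\<close>)
    ultimately show ?thesis
      using S hausdorff_translation[of n x "Rn n \<inter> (\<lambda>a. a + x) -` S"] by (simp add: H)
  qed
  have "emeasure H E * emeasure (leb n) (unit_cube n) = emeasure H (unit_cube n) * emeasure (leb n) (uminus -` E)"
    by (rule translation_invariant_exchange[OF sets sets_leb sf sigma_finite_leb ae AE_leb_Rn tH
          emeasure_leb_translate E(1) unit_cube_borel])
  moreover have "emeasure (leb n) E * emeasure (leb n) (unit_cube n)
      = emeasure (leb n) (unit_cube n) * emeasure (leb n) (uminus -` E)"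
    by (rule translation_invariant_exchange[OF sets_leb sets_leb sigma_finite_leb sigma_finite_leb
          AE_leb_Rn AE_leb_Rn emeasure_leb_translate emeasure_leb_translate E(1) unit_cube_borel])
  moreover have "Rn n \<inter> E = E" "Rn n \<inter> unit_cube n = unit_cube n"
    using E(2) by (auto simp: unit_cube_def)
  ultimately show ?thesis
    using E(1) by (simp add: H)
qed

section \<open>Linear images and the Gram determinant\<close>

text \<open>
  The map replaces coordinate \<open>j\<close> by \<open>s\<close> times itself plus \<open>g x\<close>. It is used for functions \<open>g\<close> that do
  not depend on coordinate \<open>j\<close>, so that Fubini's theorem reduces its effect on Lebesgue measure to an affine
  map of the line.
\<close>

definition shear :: "real \<Rightarrow> (fseq \<Rightarrow> real) \<Rightarrow> nat \<Rightarrow> fseq \<Rightarrow> fseq"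
  where "shear s g j x = x + ((s - 1) * coord x j + g x) *\<^sub>R unit_fseq j"

lemma nn_integral_leb_shear:
  assumes f [measurable]: "f \<in> borel_measurable borel" and g [measurable]: "g \<in> borel_measurable borel"
    and j: "j < n" and s: "s \<noteq> 0" and indep: "\<And>x t. g (x + t *\<^sub>R unit_fseq j) = g x"
  shows "(\<integral>\<^sup>+x. f x \<partial>leb n) = ennreal \<bar>s\<bar> * (\<integral>\<^sup>+x. f (shear s g j x) \<partial>leb n)"
proof -
  define J where "J = {..<n} - {j}"
  have J: "finite J" "j \<notin> J" "insert j J = {..<n}"
    using j by (auto simp: J_def)
  let ?P = "\<lambda>I. Pi\<^sub>M I (\<lambda>_::nat. lborel :: real measure)"
  let ?e = "extend_zero n"
  have e: "?e (x(j := y)) = ?e x + (y - x j) *\<^sub>R unit_fseq j" for x y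
    using j by (intro fseq_eqI) (auto simp: coord_extend_zero coord_unit_fseq)
  have g_e: "g (?e (x(j := y))) = g (?e x)" for x y
    by (simp add: e indep)
  have sh: "shear s g j (?e (x(j := y))) = ?e (x(j := g (?e x) + s * y))" for x y
    using j by (intro fseq_eqI) (auto simp: shear_def g_e coord_extend_zero coord_unit_fseq algebra_simps)
  have meas: "(\<lambda>y. f (?e (x(j := y)))) \<in> borel_measurable borel" if "x \<in> space (?P J)" for x
    using measurable_comp[OF measurable_comp[OF measurable_component_update[OF that J(2)]
        measurable_extend_zero[of n, folded J(3)]] f]
    by (simp add: comp_def)
  have sh_meas [measurable]: "(\<lambda>x. f (shear s g j x)) \<in> borel_measurable borel"
    unfolding shear_def by measurable
  have "(\<integral>\<^sup>+x. f x \<partial>leb n) = (\<integral>\<^sup>+x. (\<integral>\<^sup>+y. f (?e (x(j := y))) \<partial>lborel) \<partial>?P J)"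
    by (simp add: nn_integral_leb flip: J(3))
      (rule lborel_product.product_nn_integral_insert[OF J(1,2)], simp add: J(3))
  also have "\<dots> = (\<integral>\<^sup>+x. ennreal \<bar>s\<bar> * (\<integral>\<^sup>+y. f (shear s g j (?e (x(j := y)))) \<partial>lborel) \<partial>?P J)"
    unfolding sh by (intro nn_integral_cong nn_integral_real_affine[OF meas s])
  also have "\<dots> = ennreal \<bar>s\<bar> * (\<integral>\<^sup>+x. (\<integral>\<^sup>+y. f (shear s g j (?e (x(j := y)))) \<partial>lborel) \<partial>?P J)"
  proof (rule nn_integral_cmult)
    have [measurable]: "(\<lambda>x. ?e x) \<in> measurable (?P (insert j J)) borel"
      unfolding J(3) by measurable
    show "(\<lambda>x. \<integral>\<^sup>+y. f (shear s g j (?e (x(j := y)))) \<partial>lborel) \<in> borel_measurable (?P J)"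
      by measurable
  qed
  also have "(\<integral>\<^sup>+x. (\<integral>\<^sup>+y. f (shear s g j (?e (x(j := y)))) \<partial>lborel) \<partial>?P J) = (\<integral>\<^sup>+x. f (shear s g j x) \<partial>leb n)"
    by (subst nn_integral_leb, measurable, simp flip: J(3))
      (rule lborel_product.product_nn_integral_insert[OF J(1,2), symmetric], simp add: J(3))
  finally show ?thesis .
qed

text \<open>
  The map of the upper triangular part of \<open>R\<close>; entries below the diagonal are ignored.
\<close>

definition upper_map :: "nat \<Rightarrow> (nat \<Rightarrow> nat \<Rightarrow> real) \<Rightarrow> fseq \<Rightarrow> fseq"
  where "upper_map n R x = extend_zero n (\<lambda>i. \<Sum>j\<in>{i..<n}. R i j * coord x j)"

lemma upper_map_in_Rn [simp]: "upper_map n R x \<in> Rn n"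
  by (simp add: upper_map_def)

lemma upper_map_diff: "upper_map n R (x - y) = upper_map n R x - upper_map n R y"
  by (rule fseq_eqI) (simp add: upper_map_def coord_extend_zero algebra_simps sum_subtractf)

lemma continuous_on_upper_map: "continuous_on S (upper_map n R)"
  unfolding upper_map_def extend_zero_eq_sum by (intro continuous_intros)

lemma measurable_upper_map [measurable]: "upper_map n R \<in> borel_measurable borel"
  by (intro borel_measurable_continuous_onI continuous_on_upper_map)

text \<open>
  An upper triangular matrix acts by one shear for each coordinate, in increasing order: row \<open>m\<close> only
  reads the coordinates from \<open>m\<close> on, which the earlier shears have left unchanged.
\<close>

lemma nn_integral_leb_upper_map:
  assumes f: "f \<in> borel_measurable borel" and R: "\<And>i. i < n \<Longrightarrow> R i i > 0"
  shows "(\<integral>\<^sup>+x. f x \<partial>leb n) = ennreal (\<Prod>i<n. R i i) * (\<integral>\<^sup>+x. f (upper_map n R x) \<partial>leb n)"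
proof -
  define g where "g m x = (\<Sum>k\<in>{m<..<n}. R m k * coord x k)" for m x
  \<comment> \<open>T m applies the first m rows of the matrix.\<close>
  define T where "T = rec_nat (\<lambda>x. x) (\<lambda>m t x. shear (R m m) (g m) m (t x))"
  have T [simp]: "T 0 = (\<lambda>x. x)" "T (Suc m) = (\<lambda>x. shear (R m m) (g m) m (T m x))" for m
    by (simp_all add: T_def)
  have coord_T: "m \<le> n \<Longrightarrow> coord (T m x) i = (if i < m then \<Sum>j\<in>{i..<n}. R i j * coord x j else coord x i)"
    for m x i
  proof (induction m arbitrary: i)
    case (Suc m)
    have "{m..<n} = insert m {m<..<n}"
      using Suc.prems by auto
    moreover have "g m (T m x) = (\<Sum>k\<in>{m<..<n}. R m k * coord x k)"
      unfolding g_def using Suc by (intro sum.cong) auto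
    ultimately show ?case
      using Suc by (auto simp: shear_def coord_unit_fseq algebra_simps less_Suc_eq)
  qed simp
  have "m \<le> n \<Longrightarrow> f \<in> borel_measurable borel \<Longrightarrow>
      (\<integral>\<^sup>+x. f x \<partial>leb n) = ennreal (\<Prod>i<m. R i i) * (\<integral>\<^sup>+x. f (T m x) \<partial>leb n)" for m and f :: "fseq \<Rightarrow> ennreal"
  proof (induction m arbitrary: f)
    case (Suc m)
    note [measurable] = Suc.prems(2)
    have [measurable]: "g m \<in> borel_measurable borel"
      unfolding g_def[abs_def] by measurable
    have "g m (x + t *\<^sub>R unit_fseq m) = g m x" for x t
      unfolding g_def by (intro sum.cong) (auto simp: coord_unit_fseq)
    then have "(\<integral>\<^sup>+x. f x \<partial>leb n) = ennreal \<bar>R m m\<bar> * (\<integral>\<^sup>+x. f (shear (R m m) (g m) m x) \<partial>leb n)"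
      using Suc.prems R[of m] by (intro nn_integral_leb_shear) auto
    also have "(\<integral>\<^sup>+x. f (shear (R m m) (g m) m x) \<partial>leb n)
        = ennreal (\<Prod>i<m. R i i) * (\<integral>\<^sup>+x. f (shear (R m m) (g m) m (T m x)) \<partial>leb n)"
      using Suc.prems by (intro Suc.IH) (auto simp: shear_def[abs_def])
    moreover have "ennreal (\<Prod>i<Suc m. R i i) = ennreal (R m m) * ennreal (\<Prod>i<m. R i i)"
      using R Suc.prems by (subst ennreal_mult[symmetric])
        (auto intro!: prod_nonneg simp: less_imp_le mult.commute)
    ultimately show ?case
      using R[of m] Suc.prems by (simp add: mult.assoc)
  qed simp
  from this[OF order_refl f]
  have "(\<integral>\<^sup>+x. f x \<partial>leb n) = ennreal (\<Prod>i<n. R i i) * (\<integral>\<^sup>+x. f (T n x) \<partial>leb n)" .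
  also have "(\<integral>\<^sup>+x. f (T n x) \<partial>leb n) = (\<integral>\<^sup>+x. f (upper_map n R x) \<partial>leb n)"
  proof (rule nn_integral_cong_AE, use AE_leb_Rn in eventually_elim)
    fix x assume "x \<in> Rn n"
    then have "T n x = upper_map n R x"
      by (intro fseq_eqI) (auto simp: coord_T upper_map_def coord_extend_zero Rn_def)
    then show "f (T n x) = f (upper_map n R x)" by simp
  qed
  finally show ?thesis .
qed

text \<open>
  The Gram-Schmidt process, keeping the triangular matrix of coefficients.
\<close>

lemma qr_decomposition:
  fixes v :: "nat \<Rightarrow> 'a::real_inner"
  assumes "\<forall>m<n. v m \<notin> span (v ` {..<m})"
  shows "\<exists>q R. (\<forall>i<n. \<forall>j<n. inner (q i) (q j) = (if i = j then 1 else 0)) \<and>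
    (\<forall>i<n. q i \<in> span (v ` {..<n})) \<and>
    (\<forall>j<n. v j = (\<Sum>i<n. R i j *\<^sub>R q i)) \<and> (\<forall>i<n. R i i > (0::real)) \<and> (\<forall>i j. j < i \<longrightarrow> R i j = 0)"
  using assms
proof (induction n)
  case 0
  show ?case by (intro exI[of _ undefined] exI[of _ "\<lambda>_ _. 0"]) auto
next
  case (Suc n)
  have "\<forall>m<n. v m \<notin> span (v ` {..<m})"
    using Suc.prems by simp
  from Suc.IH[OF this] obtain q R where
    qR: "\<forall>i<n. \<forall>j<n. inner (q i) (q j) = (if i = j then 1 else 0)"
    "\<forall>i<n. q i \<in> span (v ` {..<n})" "\<forall>j<n. v j = (\<Sum>i<n. R i j *\<^sub>R q i)"
    "\<forall>i<n. R i i > (0::real)" "\<forall>i j. j < i \<longrightarrow> R i j = 0"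
    by (elim exE conjE) assumption+
  note q = qR(1)[rule_format] and sp = qR(2)[rule_format] and v = qR(3)[rule_format]
    and R = qR(4,5)[rule_format]
  define p where "p = (\<Sum>i<n. inner (q i) (v n) *\<^sub>R q i)"
  define u where "u = v n - p"
  have p: "p \<in> span (v ` {..<n})"
    unfolding p_def by (intro span_sum span_scale sp) auto
  have "u \<noteq> 0"
    using Suc.prems p by (auto simp: u_def)
  have uq: "inner (q i) u = 0" if "i < n" for i
  proof -
    have "inner (q i) p = (\<Sum>k<n. if i = k then inner (q k) (v n) else 0)"
      unfolding p_def inner_sum_right by (intro sum.cong) (use q that in auto)
    also have "\<dots> = inner (q i) (v n)"
      using that by simp
    finally show ?thesis by (simp add: u_def inner_diff_right)
  qed
  define q' where "q' = q(n := u /\<^sub>R norm u)"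
  define R' where "R' i j = (if j = n then (if i < n then inner (q i) (v n) else if i = n then norm u else 0)
    else R i j)" for i j
  show ?case
  proof (intro exI[of _ q'] exI[of _ R'] conjI allI impI)
    fix i j assume "i < Suc n" "j < Suc n"
    then consider "i < n" "j < n" | "i < n" "j = n" | "i = n" "j < n" | "i = n" "j = n"
      by linarith
    then show "inner (q' i) (q' j) = (if i = j then 1 else 0)"
    proof cases
      case 3
      then show ?thesis
        using uq[of j] by (simp add: q'_def inner_commute[of u])
    next
      case 4
      have "inner u u = norm u * norm u"
        by (simp add: power2_norm_eq_inner[symmetric] power2_eq_square)
      with 4 show ?thesis
        using \<open>u \<noteq> 0\<close> by (simp add: q'_def field_simps)
    qed (simp_all add: q'_def q uq)
  next
    fix i assume "i < Suc n"
    have sub: "span (v ` {..<n}) \<subseteq> span (v ` {..<Suc n})"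
      by (intro span_mono) auto
    have "u \<in> span (v ` {..<Suc n})"
      unfolding u_def using p sub by (intro span_diff) (auto intro: span_base)
    then show "q' i \<in> span (v ` {..<Suc n})"
      using \<open>i < Suc n\<close> sp sub by (auto simp: q'_def less_Suc_eq intro!: span_scale)
  next
    fix j assume j: "j < Suc n"
    show "v j = (\<Sum>i<Suc n. R' i j *\<^sub>R q' i)"
    proof (cases "j = n")
      case True
      have "(\<Sum>i<n. R' i n *\<^sub>R q' i) = p"
        unfolding p_def by (intro sum.cong) (auto simp: R'_def q'_def)
      then show ?thesis
        using True \<open>u \<noteq> 0\<close> by (simp add: R'_def[of n n] q'_def u_def)
    next
      case False
      have "(\<Sum>i<n. R' i j *\<^sub>R q' i) = (\<Sum>i<n. R i j *\<^sub>R q i)"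
        using False by (intro sum.cong) (auto simp: R'_def q'_def)
      moreover have "R' n j = 0"
        using False j R(2) by (simp add: R'_def)
      ultimately show ?thesis
        using v[of j] False j by simp
    qed
  next
    fix i assume "i < Suc n"
    then show "R' i i > 0"
      using R(1) \<open>u \<noteq> 0\<close> by (auto simp: R'_def less_Suc_eq)
  next
    fix i j :: nat assume "j < i"
    then show "R' i j = 0"
      using R(2) by (auto simp: R'_def)
  qed
qed

definition gram_det :: "nat \<Rightarrow> (nat \<Rightarrow> 'a::real_inner) \<Rightarrow> real"
  where "gram_det n v = Determinant.det (mat n n (\<lambda>(i, j). inner (v i) (v j)))"

lemma gram_det_eq_prod_square:
  fixes R :: "nat \<Rightarrow> nat \<Rightarrow> real"
  assumes "\<And>i j. i < n \<Longrightarrow> j < n \<Longrightarrow> inner (v i) (v j) = (\<Sum>k<n. R k i * R k j)"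
    and "\<And>i j. j < i \<Longrightarrow> R i j = 0"
  shows "gram_det n v = (\<Prod>i<n. R i i)\<^sup>2"
proof -
  define M where "M = mat n n (\<lambda>(i, j). R i j)"
  have M: "M \<in> carrier_mat n n"
    by (simp add: M_def)
  have "mat n n (\<lambda>(i, j). inner (v i) (v j)) = M\<^sup>T * M"
    using assms(1) by (intro eq_matI) (auto simp: M_def scalar_prod_def atLeast0LessThan)
  then have "gram_det n v = (Determinant.det M)\<^sup>2"
    using M by (simp add: gram_det_def det_mult[of _ n] det_transpose[OF M] power2_eq_square)
  moreover have "Determinant.det M = prod_list (diag_mat M)"
    using assms(2) M by (intro det_upper_triangular[of _ n]) (auto simp: upper_triangular_def M_def)
  moreover have "prod_list (diag_mat M) = (\<Prod>i\<in>set [0..<n]. R i i)"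
    by (subst prod.distinct_set_conv_list) (auto simp: diag_mat_def M_def intro!: arg_cong[of _ _ prod_list])
  ultimately show ?thesis
    by (simp add: atLeast0LessThan)
qed

text \<open>
  With the orthonormal basis from the Gram-Schmidt process applied to the images of the unit vectors, \<open>L\<close>
  factors into a triangular map and an isometry.
\<close>

lemma linear_upper_map:
  fixes L :: "fseq \<Rightarrow> fseq"
  assumes L: "linear L" "inj_on L (Rn n)"
  obtains R where "\<forall>i<n. R i i > 0" "\<forall>x\<in>Rn n. norm (L x) = norm (upper_map n R x)"
    and "sqrt (gram_det n (\<lambda>i. L (unit_fseq i))) = (\<Prod>i<n. R i i)"
proof -
  define v where "v i = L (unit_fseq i)" for i
  have "\<forall>m<n. v m \<notin> span (v ` {..<m})"
  proof (intro allI impI notI)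
    fix m assume that: "m < n"
    assume "v m \<in> span (v ` {..<m})"
    then have "v m \<in> L ` span (unit_fseq ` {..<m})"
      using linear_span_image[OF L(1), of "unit_fseq ` {..<m}"] by (simp add: v_def image_image)
    then obtain y where y: "y \<in> span (unit_fseq ` {..<m})" "L (unit_fseq m) = L y"
      by (auto simp: v_def)
    have "span (unit_fseq ` {..<m}) \<subseteq> Rn m"
      by (intro span_minimal subspace_Rn) (auto intro: unit_fseq_in_Rn)
    then have "y \<in> Rn m" using y(1) by blast
    moreover have "unit_fseq m = y"
      using L(2) y(2) \<open>y \<in> Rn m\<close> Rn_mono[of m n] that
      by (auto simp: inj_on_def unit_fseq_in_Rn subset_iff)
    ultimately show False
      using coord_unit_fseq[of m m] by (auto simp: Rn_def)
  qed
  from qr_decomposition[of n v, OF this] obtain q and R :: "nat \<Rightarrow> nat \<Rightarrow> real" where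
    qR: "\<forall>i<n. \<forall>j<n. inner (q i) (q j) = (if i = j then 1 else 0)"
    "\<forall>i<n. q i \<in> span (v ` {..<n})" "\<forall>j<n. v j = (\<Sum>i<n. R i j *\<^sub>R q i)"
    "\<forall>i<n. R i i > 0" "\<forall>i j. j < i \<longrightarrow> R i j = 0"
    by (elim exE conjE) assumption+
  note q = qR(1)[rule_format] and v = qR(3)[rule_format] and R = qR(4,5)[rule_format]
  have inner_q: "inner (\<Sum>i<n. a i *\<^sub>R q i) (\<Sum>i<n. b i *\<^sub>R q i) = (\<Sum>i<n. a i * b i)" for a b
  proof -
    have "inner (q i) (\<Sum>j<n. b j *\<^sub>R q j) = b i" if "i < n" for i
    proof -
      have "inner (q i) (\<Sum>j<n. b j *\<^sub>R q j) = (\<Sum>j<n. if i = j then b j else 0)"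
        unfolding inner_sum_right by (intro sum.cong) (use q that in auto)
      then show ?thesis using that by simp
    qed
    then show ?thesis
      by (simp add: inner_sum_left)
  qed
  have "inner (v i) (v j) = (\<Sum>k<n. R k i * R k j)" if "i < n" "j < n" for i j
    using v[OF that(1)] v[OF that(2)] inner_q by simp
  then have "gram_det n v = (\<Prod>i<n. R i i)\<^sup>2"
    by (rule gram_det_eq_prod_square[OF _ R(2)])
  then have 1: "sqrt (gram_det n (\<lambda>i. L (unit_fseq i))) = (\<Prod>i<n. R i i)"
    using R(1) prod_nonneg[of "{..<n}" "\<lambda>i. R i i"] by (simp add: v_def[abs_def] less_imp_le)
  have 2: "norm (L x) = norm (upper_map n R x)" if "x \<in> Rn n" for x
  proof -
    have "L x = L (\<Sum>j<n. coord x j *\<^sub>R unit_fseq j)"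
      using Rn_eq_sum[OF that] by simp
    also have "\<dots> = (\<Sum>j<n. coord x j *\<^sub>R v j)"
      by (simp add: linear_sum[OF L(1)] linear_scale[OF L(1)] v_def)
    also have "\<dots> = (\<Sum>j<n. \<Sum>i<n. (R i j * coord x j) *\<^sub>R q i)"
      by (intro sum.cong refl) (simp add: v scaleR_sum_right mult.commute)
    also have "\<dots> = (\<Sum>i<n. (\<Sum>j<n. R i j * coord x j) *\<^sub>R q i)"
      by (subst sum.swap) (simp add: scaleR_sum_left)
    finally have "(norm (L x))\<^sup>2 = (\<Sum>i<n. (\<Sum>j<n. R i j * coord x j)\<^sup>2)"
      by (simp only: power2_norm_eq_inner inner_q) (simp add: power2_eq_square)
    also have "\<dots> = (\<Sum>i<n. (coord (upper_map n R x) i)\<^sup>2)"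
    proof (intro sum.cong refl)
      fix i assume "i \<in> {..<n}"
      have "(\<Sum>j<n. R i j * coord x j) = (\<Sum>j\<in>{i..<n}. R i j * coord x j)"
        by (rule sum.mono_neutral_right) (use R(2) in auto)
      then show "(\<Sum>j<n. R i j * coord x j)\<^sup>2 = (coord (upper_map n R x) i)\<^sup>2"
        using \<open>i \<in> {..<n}\<close> by (simp add: upper_map_def coord_extend_zero)
    qed
    also have "\<dots> = (norm (upper_map n R x))\<^sup>2"
      by (simp add: norm_Rn[of _ n] sum_nonneg)
    finally show ?thesis by simp
  qed
  show thesis
    using that[of R] R(1) 1 2 by blast
qed

lemma hausdorff_linear_image:
  fixes L :: "fseq \<Rightarrow> fseq"
  assumes n: "n > 0" and L: "linear L" "inj_on L (Rn n)"
    and E: "E \<in> sets borel" "E \<subseteq> K" "compact K" "K \<subseteq> Rn n"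
  shows "hausdorff n (L ` E) =
    hausdorff n (unit_cube n) * (ennreal (sqrt (gram_det n (\<lambda>i. L (unit_fseq i)))) * emeasure (leb n) E)"
    and "sqrt (gram_det n (\<lambda>i. L (unit_fseq i))) > 0"
proof -
  obtain R where R': "\<forall>i<n. R i i > 0" "\<forall>x\<in>Rn n. norm (L x) = norm (upper_map n R x)"
    and det: "sqrt (gram_det n (\<lambda>i. L (unit_fseq i))) = (\<Prod>i<n. R i i)"
    using linear_upper_map[OF L] by blast
  note R = R'(1)[rule_format] R'(2)[rule_format]
  let ?T = "upper_map n R"
  have dist: "dist (L x) (L y) = dist (?T x) (?T y)" if "x \<in> Rn n" "y \<in> Rn n" for x y
    using R(2)[OF Rn_diff[OF that]]
    by (simp add: dist_norm upper_map_diff linear_diff[OF L(1)])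
  have inj: "inj_on ?T (Rn n)"
    using L(2) dist by (auto simp: inj_on_def) (metis dist_eq_0_iff)
  have TE: "?T ` E \<in> sets borel"
    using image_borel[OF E(3) continuous_on_upper_map inj_on_subset[OF inj E(4)] E(1)] E(2)
    by (simp add: inf.absorb1)
  have "hausdorff n (L ` E) = hausdorff n (?T ` E)"
    using dist E by (intro hausdorff_isometry) auto
  also have "\<dots> = hausdorff n (unit_cube n) * emeasure (leb n) (?T ` E)"
    by (rule hausdorff_eq_leb[OF n TE]) auto
  also have "emeasure (leb n) (?T ` E) = (\<integral>\<^sup>+x. indicator (?T ` E) x \<partial>leb n)"
    using TE by simp
  also have "\<dots> = ennreal (\<Prod>i<n. R i i) * (\<integral>\<^sup>+x. indicator (?T ` E) (?T x) \<partial>leb n)"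
    using TE R(1) by (intro nn_integral_leb_upper_map) auto
  also have "(\<integral>\<^sup>+x. indicator (?T ` E) (?T x) \<partial>leb n) = (\<integral>\<^sup>+x. indicator E x \<partial>leb n)"
  proof (rule nn_integral_cong_AE, use AE_leb_Rn in eventually_elim)
    fix x assume "x \<in> Rn n"
    then have "?T x \<in> ?T ` E \<longleftrightarrow> x \<in> E"
      using inj E(2,4) by (auto simp: inj_on_def subset_iff)
    then show "indicator (?T ` E) (?T x) = (indicator E x :: ennreal)"
      by (simp add: indicator_def)
  qed
  also have "\<dots> = emeasure (leb n) E"
    using E(1) by simp
  finally show "hausdorff n (L ` E) =
    hausdorff n (unit_cube n) * (ennreal (sqrt (gram_det n (\<lambda>i. L (unit_fseq i)))) * emeasure (leb n) E)"
    by (simp add: det)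
  show "sqrt (gram_det n (\<lambda>i. L (unit_fseq i))) > 0"
    unfolding det using R(1) by (intro prod_pos) auto
qed

section \<open>The area formula for parameterized surfaces\<close>

text \<open>
  The data of a parameterization of positive dimension, together with a chosen continuous derivative. The
  bounded open set on which the surface proper lives only enters later.
\<close>

locale C1_embedding =
  fixes n :: nat and V :: "fseq set" and \<phi> :: "fseq \<Rightarrow> fseq" and D :: "fseq \<Rightarrow> fseq \<Rightarrow>\<^sub>L fseq"
  assumes n_pos: "n > 0" and open_V: "openin (top_of_set (Rn n)) V" and inj: "inj_on \<phi> V"
    and cont_D: "continuous_on V D"
    and deriv: "\<And>x. x \<in> V \<Longrightarrow> (\<phi> has_derivative blinfun_apply (D x)) (at x within V)"
    and C1_inv: "C1_on (\<phi> ` V) (inv_into V \<phi>)"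
begin

abbreviation L :: "fseq \<Rightarrow> fseq \<Rightarrow> fseq"
  where "L x \<equiv> blinfun_apply (D x)"

definition jac :: "fseq \<Rightarrow> real"
  where "jac x = sqrt (gram_det n (\<lambda>i. L x (unit_fseq i)))"

lemma V_subset: "V \<subseteq> Rn n"
  using openin_subset[OF open_V] by simp

lemma V_ball:
  assumes "x \<in> V"
  obtains r where "r > 0" "cball x r \<inter> Rn n \<subseteq> V"
  using open_V assms unfolding openin_contains_cball by blast

lemma V_borel [measurable]: "V \<in> sets borel"
proof -
  obtain T where "open T" "V = Rn n \<inter> T"
    using open_V by (auto simp: openin_open)
  then show ?thesis by auto
qed

lemma cont_phi: "continuous_on V \<phi>"
  unfolding continuous_on_eq_continuous_within by (intro ballI has_derivative_continuous[OF deriv])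

lemma phi_curve_derivative:
  assumes x: "x \<in> V" and w: "w \<in> Rn n"
  shows "\<exists>e>0. \<forall>t. \<bar>t\<bar> < e \<longrightarrow> x + t *\<^sub>R w \<in> V"
    and "((\<lambda>t. \<phi> (x + t *\<^sub>R w)) has_vector_derivative L x w) (at 0)"
proof -
  obtain r where r: "r > 0" "cball x r \<inter> Rn n \<subseteq> V"
    using V_ball[OF x] by blast
  define e where "e = r / (norm w + 1)"
  have e: "e > 0"
    using r by (simp add: e_def add_nonneg_pos)
  have inV: "x + t *\<^sub>R w \<in> V" if "\<bar>t\<bar> < e" for t
  proof -
    have "\<bar>t\<bar> * norm w \<le> e * (norm w + 1)"
      using that e by (intro mult_mono) auto
    also have "\<dots> = r"
      using norm_ge_zero[of w] by (simp add: e_def add_nonneg_eq_0_iff)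
    finally have "x + t *\<^sub>R w \<in> cball x r"
      by (simp add: dist_norm)
    moreover have "x + t *\<^sub>R w \<in> Rn n"
      using x w V_subset by (auto intro: Rn_add Rn_scaleR)
    ultimately show ?thesis using r(2) by auto
  qed
  have "((\<lambda>t. x + t *\<^sub>R w) has_derivative (\<lambda>t. t *\<^sub>R w)) (at 0 within {-e<..<e})"
    by (auto intro!: derivative_eq_intros)
  moreover have "(\<phi> has_derivative L x) (at (x + 0 *\<^sub>R w) within (\<lambda>t. x + t *\<^sub>R w) ` {-e<..<e})"
    using inV by (simp, intro has_derivative_subset[OF deriv[OF x]]) (auto simp: abs_less_iff)
  ultimately have "((\<lambda>t. \<phi> (x + t *\<^sub>R w)) has_derivative (\<lambda>t. L x (t *\<^sub>R w))) (at 0 within {-e<..<e})"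
    by (rule has_derivative_in_compose)
  then show "((\<lambda>t. \<phi> (x + t *\<^sub>R w)) has_vector_derivative L x w) (at 0)"
    using e by (simp add: has_vector_derivative_def at_within_open[of 0 "{-e<..<e}"] blinfun.scaleR_right)
  show "\<exists>e>0. \<forall>t. \<bar>t\<bar> < e \<longrightarrow> x + t *\<^sub>R w \<in> V"
    using e inV by blast
qed

lemma partial_deriv_eq:
  assumes "x \<in> V" "i < n"
  shows "partial_deriv \<phi> i x = L x (unit_fseq i)"
  unfolding partial_deriv_def
  by (rule vector_derivative_at[OF phi_curve_derivative(2)[OF assms(1) unit_fseq_in_Rn[OF assms(2)]]])

lemma jac_eq:
  assumes "x \<in> V"
  shows "jac x = sqrt (Determinant.det (gram_matrix n \<phi> x))"
proof -
  have "gram_matrix n \<phi> x = mat n n (\<lambda>(i, j). inner (L x (unit_fseq i)) (L x (unit_fseq j)))"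
    unfolding gram_matrix_def by (intro eq_matI) (auto simp: partial_deriv_eq[OF assms])
  then show ?thesis by (simp add: jac_def gram_det_def)
qed

text \<open>
  The derivative of the inverse parameterization is a bounded left inverse of the derivative on \<open>Rn n\<close>.
  Only curves inside \<open>V\<close> are differentiated, because the derivative on the surface is not unique.
\<close>

lemma D_bounded_below:
  assumes x: "x \<in> V"
  shows "\<exists>B>0. \<forall>w\<in>Rn n. norm w \<le> B * norm (L x w)"
proof -
  obtain M :: "fseq \<Rightarrow> fseq \<Rightarrow>\<^sub>L fseq" where
    M: "\<And>y. y \<in> \<phi> ` V \<Longrightarrow> (inv_into V \<phi> has_derivative blinfun_apply (M y)) (at y within \<phi> ` V)"
    using C1_inv unfolding C1_on_def by blast
  have "norm w \<le> (norm (M (\<phi> x)) + 1) * norm (L x w)" if w: "w \<in> Rn n" for w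
  proof -
    obtain e where e: "e > 0" "\<And>t. \<bar>t\<bar> < e \<Longrightarrow> x + t *\<^sub>R w \<in> V"
      using phi_curve_derivative(1)[OF x w] by blast
    note d = phi_curve_derivative(2)[OF x w]
    have "((\<lambda>t. \<phi> (x + t *\<^sub>R w)) has_derivative (\<lambda>t. t *\<^sub>R L x w)) (at 0 within {-e<..<e})"
      using d by (auto simp: has_vector_derivative_def intro: has_derivative_at_withinI)
    moreover have "(inv_into V \<phi> has_derivative blinfun_apply (M (\<phi> x)))
        (at (\<phi> (x + 0 *\<^sub>R w)) within (\<lambda>t. \<phi> (x + t *\<^sub>R w)) ` {-e<..<e})"
      using M[of "\<phi> x"] x e(2) by (auto intro!: has_derivative_subset[of _ _ _ "\<phi> ` V"])
    ultimately have "((\<lambda>t. inv_into V \<phi> (\<phi> (x + t *\<^sub>R w))) has_derivative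
        (\<lambda>t. blinfun_apply (M (\<phi> x)) (t *\<^sub>R L x w))) (at 0 within {-e<..<e})"
      by (rule has_derivative_in_compose)
    then have "((\<lambda>t. x + t *\<^sub>R w) has_derivative
        (\<lambda>t. blinfun_apply (M (\<phi> x)) (t *\<^sub>R L x w))) (at 0 within {-e<..<e})"
      by (rule has_derivative_transform[rotated 2])
        (use e inv_into_f_f[OF inj] in \<open>auto simp: abs_less_iff\<close>)
    then have "((\<lambda>t. x + t *\<^sub>R w) has_derivative
        (\<lambda>t. blinfun_apply (M (\<phi> x)) (t *\<^sub>R L x w))) (at 0)"
      using e by (simp add: at_within_open[of 0 "{-e<..<e}"])
    moreover have "((\<lambda>t. x + t *\<^sub>R w) has_derivative (\<lambda>t. t *\<^sub>R w)) (at (0::real))"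
      by (auto intro!: derivative_eq_intros)
    ultimately have "(\<lambda>t. blinfun_apply (M (\<phi> x)) (t *\<^sub>R L x w)) = (\<lambda>t. t *\<^sub>R w)"
      by (rule has_derivative_unique)
    from fun_cong[OF this, of 1] have "norm w = norm (blinfun_apply (M (\<phi> x)) (L x w))"
      by simp
    also have "\<dots> \<le> norm (M (\<phi> x)) * norm (L x w)"
      by (rule norm_blinfun)
    finally show ?thesis
      by (simp add: distrib_right add_increasing2)
  qed
  then show ?thesis
    by (intro exI[of _ "norm (M (\<phi> x)) + 1"]) (simp add: add_nonneg_pos)
qed

lemma D_inj: "x \<in> V \<Longrightarrow> inj_on (L x) (Rn n)"
proof (rule inj_onI)
  fix a b assume x: "x \<in> V" and ab: "a \<in> Rn n" "b \<in> Rn n" "L x a = L x b"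
  obtain B where "norm (a - b) \<le> B * norm (L x (a - b))"
    using D_bounded_below[OF x] Rn_diff[OF ab(1,2)] by blast
  then show "a = b"
    using ab(3) by (simp add: blinfun.diff_right)
qed

lemma jac_pos: "x \<in> V \<Longrightarrow> jac x > 0"
  unfolding jac_def
  by (rule hausdorff_linear_image(2)[OF n_pos _ D_inj, of x "{}" "{}"])
    (auto simp: blinfun.bounded_linear_right bounded_linear.linear)

lemma cont_jac: "continuous_on V jac"
  unfolding jac_def gram_det_def Determinant.det_def
  by (auto intro!: continuous_intros cont_D)

text \<open>
  The mean value inequality for \<open>\<phi>\<close> minus its derivative at \<open>x\<close> on a convex neighbourhood, combined with
  the lower bound for the derivative.
\<close>

lemma locally_almost_linear:
  assumes x: "x \<in> V" and q: "q > 1"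
  shows "\<exists>r>0. cball x r \<inter> Rn n \<subseteq> V \<and>
    (\<forall>y\<in>cball x r \<inter> Rn n. \<forall>z\<in>cball x r \<inter> Rn n.
      dist (\<phi> y) (\<phi> z) \<le> q * dist (L x y) (L x z) \<and>
      dist (L x y) (L x z) \<le> q * dist (\<phi> y) (\<phi> z)) \<and>
    (\<forall>y\<in>cball x r \<inter> Rn n. jac y \<le> q * jac x \<and> jac x \<le> q * jac y)"
proof -
  obtain B where B: "B > 0" "\<And>w. w \<in> Rn n \<Longrightarrow> norm w \<le> B * norm (L x w)"
    using D_bounded_below[OF x] by blast
  \<comment> \<open>An error of proportion at most this changes lengths by a factor between 1 / q and q.\<close>
  define \<eta> where "\<eta> = 1 - 1 / q"
  have \<eta>: "\<eta> > 0" "1 + \<eta> \<le> q" "q * (1 - \<eta>) = 1"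
  proof -
    show "\<eta> > 0" "q * (1 - \<eta>) = 1" using q by (auto simp: \<eta>_def field_simps)
    have "0 \<le> (q - 1) * (q - 1)" by simp
    then have "2 * q - 1 \<le> q * q" by (simp add: algebra_simps)
    then show "1 + \<eta> \<le> q" using q by (simp add: \<eta>_def field_simps)
  qed
  obtain r0 where r0: "r0 > 0" "cball x r0 \<inter> Rn n \<subseteq> V"
    using V_ball[OF x] by blast
  obtain r1 where r1: "r1 > 0" "\<And>y. y \<in> V \<Longrightarrow> dist y x < r1 \<Longrightarrow> dist (D y) (D x) < \<eta> / B"
    using continuous_on_iff[THEN iffD1, OF cont_D, rule_format, OF x divide_pos_pos[OF \<eta>(1) B(1)]]
    by blast
  define j where "j = min ((q - 1) * jac x) ((1 - 1 / q) * jac x)"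
  have j: "j > 0"
    using q jac_pos[OF x] by (auto simp: j_def)
  obtain r2 where r2: "r2 > 0" "\<And>y. y \<in> V \<Longrightarrow> dist y x < r2 \<Longrightarrow> dist (jac y) (jac x) < j"
    using continuous_on_iff[THEN iffD1, OF cont_jac, rule_format, OF x j] by blast
  define r where "r = min r0 (min (r1 / 2) (r2 / 2))"
  have r: "r > 0" "r \<le> r0" "r < r1" "r < r2"
    using r0(1) r1(1) r2(1) by (auto simp: r_def min_def)
  let ?K = "cball x r \<inter> Rn n"
  have K: "?K \<subseteq> V"
    using r0(2) r(2) by auto
  have convex: "convex ?K"
    by (intro convex_Int convex_cball subspace_imp_convex subspace_Rn)
  have lin: "norm ((\<phi> y - L x y) - (\<phi> z - L x z)) \<le> (\<eta> / B) * norm (y - z)"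
    if "y \<in> ?K" "z \<in> ?K" for y z
  proof (rule differentiable_bound[OF convex _ _ that])
    fix u assume u: "u \<in> ?K"
    show "((\<lambda>y. \<phi> y - L x y) has_derivative blinfun_apply (D u - D x)) (at u within ?K)"
      unfolding minus_blinfun.rep_eq
      using u K by (intro has_derivative_diff has_derivative_subset[OF deriv] bounded_linear_imp_has_derivative
          blinfun.bounded_linear_right) auto
    have "norm (D u - D x) < \<eta> / B"
      using r1(2)[of u] u subsetD[OF K u] r(3) by (auto simp: dist_norm[symmetric] dist_commute)
    then show "onorm (blinfun_apply (D u - D x)) \<le> \<eta> / B"
      by (simp add: norm_blinfun.rep_eq)
  qed
  have near: "norm ((\<phi> y - \<phi> z) - L x (y - z)) \<le> \<eta> * norm (L x (y - z))"
    if "y \<in> ?K" "z \<in> ?K" for y z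
  proof -
    have "norm ((\<phi> y - \<phi> z) - L x (y - z)) \<le> (\<eta> / B) * norm (y - z)"
      using lin[OF that] by (simp add: blinfun.diff_right algebra_simps)
    also have "\<dots> \<le> (\<eta> / B) * (B * norm (L x (y - z)))"
      using that \<eta>(1) B(1) by (intro mult_left_mono B(2) Rn_diff) auto
    finally show ?thesis using B(1) by simp
  qed
  show ?thesis
  proof (intro exI conjI ballI r(1) K)
    fix y z assume yz: "y \<in> ?K" "z \<in> ?K"
    let ?p = "norm (\<phi> y - \<phi> z)" and ?l = "norm (L x (y - z))"
    have "?p \<le> ?l + norm ((\<phi> y - \<phi> z) - L x (y - z))"
      by (rule norm_triangle_sub)
    then have "?p \<le> (1 + \<eta>) * ?l"
      using near[OF yz] by (simp add: algebra_simps)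
    also have "\<dots> \<le> q * ?l"
      by (intro mult_right_mono \<eta>) auto
    finally show "dist (\<phi> y) (\<phi> z) \<le> q * dist (L x y) (L x z)"
      by (simp add: dist_norm blinfun.diff_right)
    have "?l \<le> ?p + norm ((\<phi> y - \<phi> z) - L x (y - z))"
      by (metis norm_minus_commute norm_triangle_sub)
    then have "(1 - \<eta>) * ?l \<le> ?p"
      using near[OF yz] by (simp add: algebra_simps)
    then have "q * ((1 - \<eta>) * ?l) \<le> q * ?p"
      using q by simp
    then show "dist (L x y) (L x z) \<le> q * dist (\<phi> y) (\<phi> z)"
      using \<eta>(3) by (simp add: mult.assoc[symmetric] dist_norm blinfun.diff_right)
  next
    fix y assume y: "y \<in> ?K"
    then have "\<bar>jac y - jac x\<bar> < j"
      using r2(2)[of y] subsetD[OF K y] r(4) by (auto simp: dist_real_def dist_commute)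
    then have *: "jac y \<le> jac x + (q - 1) * jac x" "jac x - (1 - 1 / q) * jac x \<le> jac y"
      by (auto simp: j_def)
    show "jac y \<le> q * jac x"
      using *(1) by (simp add: algebra_simps)
    have "(1 / q) * jac x \<le> jac y"
      using *(2) by (simp add: algebra_simps)
    then show "jac x \<le> q * jac y"
      using q by (simp add: field_simps)
  qed (use r K in auto)
qed

text \<open>
  The integral of the Jacobian over \<open>E\<close>. The indicator of \<open>V\<close> makes the integrand measurable: the
  Jacobian is continuous on \<open>V\<close>, but arbitrary outside.
\<close>

definition vol :: "fseq set \<Rightarrow> ennreal"
  where "vol E = (\<integral>\<^sup>+x. ennreal (indicator V x * jac x) * indicator E x \<partial>leb n)"

lemma jac_measurable [measurable]: "(\<lambda>x. indicator V x * jac x) \<in> borel_measurable borel"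
  using borel_measurable_continuous_on_indicator[OF V_borel cont_jac] by simp

lemma vol_eq_density: "E \<in> sets borel \<Longrightarrow>
    vol E = emeasure (density (leb n) (\<lambda>x. ennreal (indicator V x * jac x))) E"
  unfolding vol_def by (subst emeasure_density) auto

lemma vol_bounds:
  assumes E: "E \<in> sets borel" "E \<subseteq> V" and c: "0 \<le> c" "\<And>x. x \<in> E \<Longrightarrow> c \<le> jac x"
  shows "ennreal c * emeasure (leb n) E \<le> vol E"
proof -
  have "ennreal c * emeasure (leb n) E = (\<integral>\<^sup>+x. ennreal c * indicator E x \<partial>leb n)"
    using E by (simp add: nn_integral_cmult_indicator)
  also have "\<dots> \<le> vol E"
    unfolding vol_def using E c by (intro nn_integral_mono) (auto simp: indicator_def intro!: ennreal_leI)
  finally show ?thesis .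
qed

lemma vol_upper:
  assumes E: "E \<in> sets borel" "E \<subseteq> V" and c: "\<And>x. x \<in> E \<Longrightarrow> jac x \<le> c"
  shows "vol E \<le> ennreal c * emeasure (leb n) E"
proof -
  have "vol E \<le> (\<integral>\<^sup>+x. ennreal c * indicator E x \<partial>leb n)"
    unfolding vol_def using E c by (intro nn_integral_mono) (auto simp: indicator_def intro!: ennreal_leI)
  also have "\<dots> = ennreal c * emeasure (leb n) E"
    using E by (simp add: nn_integral_cmult_indicator)
  finally show ?thesis .
qed

abbreviation "c\<^sub>n \<equiv> hausdorff n (unit_cube n)"

text \<open>
  Near \<open>x\<close> the set \<open>\<phi> ` E\<close> has almost the same distances as the image of \<open>E\<close> under the derivative at \<open>x\<close>,
  whose measure is known, and the Jacobian is almost constant. The exponent is \<open>n\<close> for the distances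
  and \<open>1\<close> more for the Jacobian.
\<close>

lemma local_area_estimate:
  assumes x: "x \<in> V" and q: "q > 1"
  shows "\<exists>r>0. cball x r \<inter> Rn n \<subseteq> V \<and>
    (\<forall>E\<in>sets borel. E \<subseteq> cball x r \<inter> Rn n \<longrightarrow>
      hausdorff n (\<phi> ` E) \<le> ennreal (q ^ Suc n) * (c\<^sub>n * vol E) \<and>
      c\<^sub>n * vol E \<le> ennreal (q ^ Suc n) * hausdorff n (\<phi> ` E))"
proof -
  obtain r where r: "r > 0" "cball x r \<inter> Rn n \<subseteq> V"
    and d: "\<forall>y\<in>cball x r \<inter> Rn n. \<forall>z\<in>cball x r \<inter> Rn n.
      dist (\<phi> y) (\<phi> z) \<le> q * dist (L x y) (L x z) \<and>
      dist (L x y) (L x z) \<le> q * dist (\<phi> y) (\<phi> z)"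
    and jac: "\<forall>y\<in>cball x r \<inter> Rn n. jac y \<le> q * jac x \<and> jac x \<le> q * jac y"
    using locally_almost_linear[OF x q] by (elim exE conjE) (rule that)
  have K: "compact (cball x r \<inter> Rn n)"
    by (rule compact_Rn[of _ n]) (auto intro: closed_Int closed_Rn bounded_subset[OF bounded_cball])
  show ?thesis
  proof (intro exI conjI ballI impI r)
    fix E :: "fseq set" assume E: "E \<in> sets borel" "E \<subseteq> cball x r \<inter> Rn n"
    have EV: "E \<subseteq> V" using E(2) r(2) by blast
    have qn: "ennreal (q ^ Suc n) = ennreal (q ^ n) * ennreal q"
      using q by (simp add: ennreal_mult[symmetric] mult.commute)
    have lin: "linear (L x)"
      by (simp add: blinfun.bounded_linear_right bounded_linear.linear)
    have img: "hausdorff n (L x ` E) = c\<^sub>n * (ennreal (jac x) * emeasure (leb n) E)"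
      unfolding jac_def using hausdorff_linear_image(1)[OF n_pos lin D_inj[OF x] E K] by simp
    have "hausdorff n (\<phi> ` E) \<le> ennreal (q ^ n) * hausdorff n (L x ` E)"
      using E(2) q by (intro hausdorff_image_le) (use d in auto)
    also have "\<dots> \<le> ennreal (q ^ n) * (c\<^sub>n * (ennreal q * vol E))"
    proof -
      have "ennreal (jac x / q) * emeasure (leb n) E \<le> vol E"
        using jac E(2) q jac_pos[OF x] by (intro vol_bounds E(1) EV) (auto simp: field_simps)
      then have "ennreal q * (ennreal (jac x / q) * emeasure (leb n) E) \<le> ennreal q * vol E"
        by (rule mult_left_mono) simp
      then have "ennreal (jac x) * emeasure (leb n) E \<le> ennreal q * vol E"
        using q jac_pos[OF x] by (simp add: mult.assoc[symmetric] ennreal_mult[symmetric])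
      then show ?thesis
        unfolding img by (intro mult_left_mono) auto
    qed
    finally have 1: "hausdorff n (\<phi> ` E) \<le> ennreal (q ^ Suc n) * (c\<^sub>n * vol E)"
      unfolding qn by (simp add: mult_ac)
    have "vol E \<le> ennreal (q * jac x) * emeasure (leb n) E"
      using jac E(2) by (intro vol_upper E(1) EV) auto
    then have "c\<^sub>n * vol E \<le> c\<^sub>n * (ennreal (q * jac x) * emeasure (leb n) E)"
      by (rule mult_left_mono) simp
    also have "\<dots> = ennreal q * hausdorff n (L x ` E)"
      unfolding img using q jac_pos[OF x] by (subst ennreal_mult) (auto simp: mult_ac)
    also have "\<dots> \<le> ennreal q * (ennreal (q ^ n) * hausdorff n (\<phi> ` E))"
      using E(2) q by (intro mult_left_mono hausdorff_image_le) (use d in auto)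
    finally have 2: "c\<^sub>n * vol E \<le> ennreal (q ^ Suc n) * hausdorff n (\<phi> ` E)"
      unfolding qn by (simp add: mult_ac)
    from 1 2 show "hausdorff n (\<phi> ` E) \<le> ennreal (q ^ Suc n) * (c\<^sub>n * vol E)"
      "c\<^sub>n * vol E \<le> ennreal (q ^ Suc n) * hausdorff n (\<phi> ` E)" .
  qed (use r in auto)
qed

text \<open>
  Countably many of the neighbourhoods from the local estimate cover \<open>V\<close>; made disjoint, they cut \<open>E\<close> into
  pieces whose estimates add up.
\<close>

lemma area_estimate:
  assumes q: "q > 1" and E: "E \<in> sets borel" "E \<subseteq> V"
  shows "\<phi> ` E \<in> sets borel" "hausdorff n (\<phi> ` E) \<le> ennreal (q ^ Suc n) * (c\<^sub>n * vol E)"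
    and "c\<^sub>n * vol E \<le> ennreal (q ^ Suc n) * hausdorff n (\<phi> ` E)"
proof -
  have "\<forall>x\<in>V. \<exists>r>0. cball x r \<inter> Rn n \<subseteq> V \<and>
    (\<forall>E\<in>sets borel. E \<subseteq> cball x r \<inter> Rn n \<longrightarrow>
      hausdorff n (\<phi> ` E) \<le> ennreal (q ^ Suc n) * (c\<^sub>n * vol E) \<and>
      c\<^sub>n * vol E \<le> ennreal (q ^ Suc n) * hausdorff n (\<phi> ` E))"
    using local_area_estimate[OF _ q] by blast
  from bchoice[OF this] obtain r where r': "\<forall>x\<in>V. r x > 0 \<and> cball x (r x) \<inter> Rn n \<subseteq> V \<and>
    (\<forall>E\<in>sets borel. E \<subseteq> cball x (r x) \<inter> Rn n \<longrightarrow>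
      hausdorff n (\<phi> ` E) \<le> ennreal (q ^ Suc n) * (c\<^sub>n * vol E) \<and>
      c\<^sub>n * vol E \<le> ennreal (q ^ Suc n) * hausdorff n (\<phi> ` E))" ..
  have r: "r x > 0" "cball x (r x) \<inter> Rn n \<subseteq> V" if "x \<in> V" for x
    using bspec[OF r' that] by simp_all
  have est: "hausdorff n (\<phi> ` E) \<le> ennreal (q ^ Suc n) * (c\<^sub>n * vol E)"
    "c\<^sub>n * vol E \<le> ennreal (q ^ Suc n) * hausdorff n (\<phi> ` E)"
    if "x \<in> V" "E \<in> sets borel" "E \<subseteq> cball x (r x) \<inter> Rn n" for x E
    using bspec[OF r' that(1)] that(2,3) by simp_all
  obtain \<G> where \<G>: "\<G> \<subseteq> (\<lambda>x. ball x (r x)) ` V" "countable \<G>" "\<Union>\<G> = (\<Union>x\<in>V. ball x (r x))"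
    by (rule Lindelof[of "(\<lambda>x. ball x (r x)) ` V"]) auto
  then obtain X where X: "X \<subseteq> V" "countable X" "\<G> = (\<lambda>x. ball x (r x)) ` X"
    using countable_subset_image[of \<G> "\<lambda>x. ball x (r x)" V] by blast
  have cover: "V \<subseteq> (\<Union>x\<in>X. ball x (r x))"
  proof
    fix x assume "x \<in> V"
    then have "x \<in> (\<Union>x\<in>V. ball x (r x))" using r(1) by force
    then show "x \<in> (\<Union>x\<in>X. ball x (r x))" using \<G>(3) X(3) by simp
  qed
  define B where "B i = (if X = {} then {} else ball (from_nat_into X i) (r (from_nat_into X i)))" for i
  define P where "P i = E \<inter> disjointed B i" for i
  have B: "B i \<in> sets borel" for i
    by (simp add: B_def)
  then have disj_B: "disjointed B i \<in> sets borel" for i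
    using sets.range_disjointed_sets[of B borel] by auto
  have P: "P i \<in> sets borel" for i
    unfolding P_def using E(1) disj_B by blast
  have disj: "disjoint_family P"
    using disjoint_family_disjointed[of B] by (auto simp: disjoint_family_on_def P_def)
  have "E \<subseteq> (\<Union>i. B i)"
  proof
    fix y assume "y \<in> E"
    then obtain x where x: "x \<in> X" "y \<in> ball x (r x)" using cover E(2) by blast
    then have "y \<in> B (to_nat_on X x)"
      using X(2) by (auto simp: B_def)
    then show "y \<in> (\<Union>i. B i)" by blast
  qed
  then have EP: "E = (\<Union>i. P i)"
    unfolding P_def using UN_disjointed_eq[of B] by auto
  have PK: "P i = {} \<or> (\<exists>x\<in>V. P i \<subseteq> cball x (r x) \<inter> Rn n)" for i
  proof (cases "X = {}")
    case True
    then show ?thesis using disjointed_subset[of B i] by (auto simp: P_def B_def)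
  next
    case False
    have "P i \<subseteq> B i \<inter> Rn n"
      unfolding P_def using disjointed_subset[of B i] E(2) V_subset by blast
    moreover have "from_nat_into X i \<in> V"
      using from_nat_into[OF False] X(1) by blast
    moreover have "B i \<subseteq> cball (from_nat_into X i) (r (from_nat_into X i))"
      using False by (simp add: B_def)
    ultimately show ?thesis by blast
  qed
  have phiP: "\<phi> ` P i \<in> sets borel" for i
  proof (cases "P i = {}")
    case False
    then obtain x where x: "x \<in> V" "P i \<subseteq> cball x (r x) \<inter> Rn n" using PK by blast
    have "compact (cball x (r x) \<inter> Rn n)"
      by (rule compact_Rn[of _ n]) (auto intro: closed_Int closed_Rn bounded_subset[OF bounded_cball])
    from image_borel[OF this continuous_on_subset[OF cont_phi] inj_on_subset[OF inj] P[of i]]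
    show ?thesis using r(2)[OF x(1)] x(2) by (simp add: inf.absorb1)
  qed simp
  have phiE: "\<phi> ` E = (\<Union>i. \<phi> ` P i)"
    unfolding EP by auto
  show phiE_borel: "\<phi> ` E \<in> sets borel"
    unfolding phiE using phiP by blast
  have disj': "disjoint_family (\<lambda>i. \<phi> ` P i)"
    unfolding disjoint_family_on_def
  proof (intro ballI impI)
    fix i j :: nat assume "i \<noteq> j"
    then have "P i \<inter> P j = {}"
      using disj by (simp add: disjoint_family_on_def)
    moreover have "P i \<subseteq> V" "P j \<subseteq> V"
      using E(2) by (auto simp: P_def)
    ultimately show "\<phi> ` P i \<inter> \<phi> ` P j = {}"
      using inj_on_image_Int[OF inj, of "P i" "P j"] by simp
  qed
  have H: "hausdorff n (\<phi> ` E) = (\<Sum>i. hausdorff n (\<phi> ` P i))"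
  proof -
    have s: "S \<in> sets (hausdorff_measure n)" if "S \<in> sets borel" for S :: "fseq set"
      using borel_subset_hausdorff_sets[OF n_pos] that by blast
    have "(\<Sum>i. emeasure (hausdorff_measure n) (\<phi> ` P i)) = emeasure (hausdorff_measure n) (\<Union>i. \<phi> ` P i)"
      by (rule suminf_emeasure[OF _ disj']) (use s phiP in auto)
    then show ?thesis
      using s phiP phiE_borel by (simp add: emeasure_hausdorff_measure[OF n_pos] phiE)
  qed
  have vol: "vol E = (\<Sum>i. vol (P i))"
  proof -
    have "(\<Sum>i. emeasure (density (leb n) (\<lambda>x. ennreal (indicator V x * jac x))) (P i))
        = emeasure (density (leb n) (\<lambda>x. ennreal (indicator V x * jac x))) (\<Union>i. P i)"
      by (rule suminf_emeasure[OF _ disj]) (use P in auto)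
    then show ?thesis
      using P E(1) by (simp add: vol_eq_density EP)
  qed
  have est_P: "hausdorff n (\<phi> ` P i) \<le> ennreal (q ^ Suc n) * (c\<^sub>n * vol (P i))"
    "c\<^sub>n * vol (P i) \<le> ennreal (q ^ Suc n) * hausdorff n (\<phi> ` P i)" for i
  proof -
    consider "P i = {}" | x where "x \<in> V" "P i \<subseteq> cball x (r x) \<inter> Rn n"
      using PK[of i] by blast
    then have "hausdorff n (\<phi> ` P i) \<le> ennreal (q ^ Suc n) * (c\<^sub>n * vol (P i)) \<and>
      c\<^sub>n * vol (P i) \<le> ennreal (q ^ Suc n) * hausdorff n (\<phi> ` P i)"
    proof cases
      case 1
      then have "hausdorff n (\<phi> ` P i) = 0" "vol (P i) = 0"
        using hausdorff_empty[OF n_pos] by (simp_all add: vol_def)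
      then show ?thesis by simp
    next
      case 2
      show ?thesis
        using est[OF 2(1) P 2(2)] by blast
    qed
    then show "hausdorff n (\<phi> ` P i) \<le> ennreal (q ^ Suc n) * (c\<^sub>n * vol (P i))"
      "c\<^sub>n * vol (P i) \<le> ennreal (q ^ Suc n) * hausdorff n (\<phi> ` P i)"
      by blast+
  qed
  have "hausdorff n (\<phi> ` E) \<le> (\<Sum>i. ennreal (q ^ Suc n) * (c\<^sub>n * vol (P i)))"
    unfolding H by (intro suminf_le est_P) auto
  then show "hausdorff n (\<phi> ` E) \<le> ennreal (q ^ Suc n) * (c\<^sub>n * vol E)"
    by (simp add: vol)
  have "(\<Sum>i. c\<^sub>n * vol (P i)) \<le> (\<Sum>i. ennreal (q ^ Suc n) * hausdorff n (\<phi> ` P i))"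
    by (intro suminf_le est_P) auto
  then show "c\<^sub>n * vol E \<le> ennreal (q ^ Suc n) * hausdorff n (\<phi> ` E)"
    by (simp add: vol H)
qed

text \<open>
  The factor \<open>q > 1\<close> of the estimates is arbitrary.
\<close>

lemma area_formula:
  assumes E: "E \<in> sets borel" "E \<subseteq> V"
  shows "\<phi> ` E \<in> sets borel" "hausdorff n (\<phi> ` E) = c\<^sub>n * vol E"
proof -
  show "\<phi> ` E \<in> sets borel"
    using area_estimate(1)[of 2] E by simp
  have lim: "(\<lambda>m. ennreal ((1 + 1 / real (Suc m)) ^ Suc n) * b) \<longlonglongrightarrow> b" for b
  proof -
    have "(\<lambda>m. (1 + 1 / real (Suc m)) ^ Suc n) \<longlonglongrightarrow> (1 + 0) ^ Suc n"
      using LIMSEQ_inverse_real_of_nat by (intro tendsto_intros) (simp add: inverse_eq_divide)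
    then have "(\<lambda>m. ennreal ((1 + 1 / real (Suc m)) ^ Suc n)) \<longlonglongrightarrow> ennreal 1"
      by (intro tendsto_ennrealI) simp
    then have "(\<lambda>m. ennreal ((1 + 1 / real (Suc m)) ^ Suc n) * b) \<longlonglongrightarrow> ennreal 1 * b"
      by (intro tendsto_mult_ennreal tendsto_const) auto
    then show ?thesis by simp
  qed
  show "hausdorff n (\<phi> ` E) = c\<^sub>n * vol E"
  proof (rule antisym)
    show "hausdorff n (\<phi> ` E) \<le> c\<^sub>n * vol E"
      by (rule LIMSEQ_le_const[OF lim]) (use area_estimate(2)[OF _ E] in auto)
    show "c\<^sub>n * vol E \<le> hausdorff n (\<phi> ` E)"
      by (rule LIMSEQ_le_const[OF lim]) (use area_estimate(3)[OF _ E] in auto)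
  qed
qed

end

section \<open>Surface measure\<close>

definition surface_measure :: "nat \<Rightarrow> fseq measure"
  where "surface_measure n = scale_measure (ennreal (1 / enn2real (hausdorff n (unit_cube n)))) (hausdorff_measure n)"

lemma space_surf [simp]: "space (surface_measure n) = UNIV"
  by (simp add: surface_measure_def space_scale_measure)

lemma borel_in_surf: "n > 0 \<Longrightarrow> E \<in> sets borel \<Longrightarrow> E \<in> sets (surface_measure n)"
  using borel_subset_hausdorff_sets[of n, where 'a = fseq] by (auto simp: surface_measure_def)

lemma emeasure_surf:
  "n > 0 \<Longrightarrow> E \<in> sets (surface_measure n) \<Longrightarrow>
    emeasure (surface_measure n) E = ennreal (1 / enn2real (hausdorff n (unit_cube n))) * hausdorff n E"
  by (simp add: surface_measure_def emeasure_hausdorff_measure)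

lemma emeasure_surf_multiple:
  assumes "n > 0" "E \<in> sets (surface_measure n)" "hausdorff n E = hausdorff n (unit_cube n) * a"
  shows "emeasure (surface_measure n) E = a"
proof -
  let ?c = "enn2real (hausdorff n (unit_cube n))"
  have c: "hausdorff n (unit_cube n) = ennreal ?c" "?c > 0"
    using hausdorff_unit_cube_finite[OF assms(1)] hausdorff_unit_cube_pos[OF assms(1)]
    by (auto simp: enn2real_positive_iff)
  have "emeasure (surface_measure n) E = ennreal (1 / ?c) * (ennreal ?c * a)"
    using assms c(1) by (simp add: emeasure_surf)
  also have "\<dots> = a"
    using c(2) by (simp add: mult.assoc[symmetric] ennreal_mult[symmetric])
  finally show ?thesis .
qed

lemma null_sets_surfI: "n > 0 \<Longrightarrow> hausdorff n E = 0 \<Longrightarrow> E \<in> null_sets (surface_measure n)"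
  using hausdorff_null_in_sets[of n E] sets_hausdorff_measure[of n, where 'a = fseq]
  by (intro null_setsI) (auto simp: surface_measure_def emeasure_hausdorff_measure)

lemma emeasure_surf_unit_cube: "n > 0 \<Longrightarrow> emeasure (surface_measure n) (unit_cube n) = 1"
  by (rule emeasure_surf_multiple) (auto intro: borel_in_surf)

lemma countable_null_surf:
  assumes "n > 0" "countable C"
  shows "C \<in> null_sets (surface_measure n)"
proof -
  have "(\<Union>x\<in>C. {x}) \<in> null_sets (surface_measure n)"
    using assms by (intro null_sets_UN' null_sets_surfI hausdorff_singleton)
  then show ?thesis by simp
qed

lemma emeasure_surf_Rn:
  assumes "n > 0" "E \<in> sets borel"
  shows "emeasure (surface_measure n) (E \<inter> Rn n) = emeasure (leb n) E"
proof (rule emeasure_surf_multiple[OF assms(1)])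
  show "E \<inter> Rn n \<in> sets (surface_measure n)"
    using assms by (intro borel_in_surf) auto
  show "hausdorff n (E \<inter> Rn n) = hausdorff n (unit_cube n) * emeasure (leb n) E"
    using hausdorff_eq_leb[of n "E \<inter> Rn n"] assms by (simp add: emeasure_leb_Int_Rn)
qed

lemma surf_finite_imp_null_higher:
  assumes "0 < m" "m < n" "A \<in> sets (surface_measure m)" "emeasure (surface_measure m) A < top"
  shows "A \<in> null_sets (surface_measure n)"
proof (rule null_sets_surfI)
  have "0 < ennreal (1 / enn2real (hausdorff m (unit_cube m)))"
    using hausdorff_unit_cube_finite[OF assms(1)] hausdorff_unit_cube_pos[OF assms(1)]
    by (auto simp: enn2real_positive_iff)
  then have "hausdorff m A < top"
    using assms(4) unfolding emeasure_surf[OF assms(1,3)]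
    by (auto simp: ennreal_mult_less_top)
  then show "hausdorff n A = 0"
    by (rule hausdorff_higher_dim_eq_0) fact
qed (use assms in simp)

lemma extend_zero_image_borel:
  assumes "S \<in> sets (Pi\<^sub>M {..<n} (\<lambda>_. lborel))"
  shows "extend_zero n ` S \<in> sets borel"
proof -
  let ?\<rho> = "\<lambda>x. \<lambda>i\<in>{..<n}. coord x i"
  have \<rho>: "?\<rho> \<in> measurable borel (Pi\<^sub>M {..<n} (\<lambda>_. lborel))"
    by measurable
  have S: "S \<subseteq> Pi\<^sub>E {..<n} (\<lambda>_. UNIV)"
    using sets.sets_into_space[OF assms] by (simp add: space_PiM)
  have "?\<rho> (extend_zero n f) = f" if "f \<in> S" for f
    using that S by (auto simp: fun_eq_iff coord_extend_zero PiE_def extensional_def)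
  moreover have "x = extend_zero n (?\<rho> x)" if "x \<in> Rn n" for x
    using that by (intro fseq_eqI) (auto simp: coord_extend_zero Rn_def)
  ultimately have "extend_zero n ` S = ?\<rho> -` S \<inter> Rn n"
    by (auto simp: image_iff)
  then show ?thesis
    using measurable_sets[OF \<rho> assms] by simp
qed

abbreviation completed_product :: "nat \<Rightarrow> (nat \<Rightarrow> real) measure"
  where "completed_product n \<equiv> completion (Pi\<^sub>M {..<n} (\<lambda>_. lborel))"

lemma inj_on_extend_zero_space: "inj_on (extend_zero n) (space (completed_product n))"
  using inj_on_extend_zero[of n] by (simp add: space_PiM)

lemma borel_Int_Rn_in_lebesgue_Rn:
  assumes "E \<in> sets borel"
  shows "E \<inter> Rn n \<in> sets (lebesgue_Rn n)"
proof -
  let ?P = "Pi\<^sub>M {..<n} (\<lambda>_::nat. lborel :: real measure)"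
  have "extend_zero n -` E \<inter> space ?P \<in> sets (completed_product n)"
    using measurable_sets[OF measurable_extend_zero assms] by (rule sets_completionI_sets)
  then have "extend_zero n ` (extend_zero n -` E \<inter> space ?P) \<in> sets (lebesgue_Rn n)"
    unfolding lebesgue_Rn_def sets_embed_measure'[OF inj_on_extend_zero_space] by blast
  moreover have "extend_zero n ` (extend_zero n -` E \<inter> space ?P) = E \<inter> Rn n"
    using space_lebesgue_Rn[of n] by (force simp: lebesgue_Rn_def space_embed_measure)
  ultimately show ?thesis by simp
qed

lemma emeasure_lebesgue_Rn:
  assumes "E \<in> sets borel"
  shows "emeasure (lebesgue_Rn n) (E \<inter> Rn n) = emeasure (leb n) E"
proof -
  let ?P = "Pi\<^sub>M {..<n} (\<lambda>_::nat. lborel :: real measure)"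
  have m: "extend_zero n -` E \<inter> space ?P \<in> sets ?P"
    using measurable_sets[OF measurable_extend_zero assms] .
  have "emeasure (lebesgue_Rn n) (E \<inter> Rn n) = emeasure (completed_product n) (extend_zero n -` (E \<inter> Rn n) \<inter> space (completed_product n))"
    unfolding lebesgue_Rn_def
    by (rule emeasure_embed_measure'[OF inj_on_extend_zero_space])
      (use borel_Int_Rn_in_lebesgue_Rn[OF assms] in \<open>simp add: lebesgue_Rn_def\<close>)
  also have "extend_zero n -` (E \<inter> Rn n) \<inter> space (completed_product n) = extend_zero n -` E \<inter> space ?P"
    by auto
  also have "emeasure (completed_product n) \<dots> = emeasure ?P (extend_zero n -` E \<inter> space ?P)"
    using m by simp
  also have "\<dots> = emeasure (leb n) E"
    unfolding leb_def using assms by (simp add: emeasure_distr)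
  finally show ?thesis .
qed

lemma lebesgue_Rn_approx:
  assumes A: "A \<in> sets (lebesgue_Rn n)"
  obtains B N where "B \<in> sets borel" "N \<in> sets borel" "B \<subseteq> A" "A \<subseteq> B \<union> N" "emeasure (leb n) N = 0"
proof -
  let ?P = "Pi\<^sub>M {..<n} (\<lambda>_::nat. lborel :: real measure)"
  obtain A0 where A0: "A0 \<in> sets (completed_product n)" "A = extend_zero n ` A0"
    using A unfolding lebesgue_Rn_def sets_embed_measure'[OF inj_on_extend_zero_space] by blast
  obtain S N N' where S: "A0 = S \<union> N" "N \<subseteq> N'" "N' \<in> null_sets ?P" "S \<in> sets ?P"
    using A0(1) by (auto elim: sets_completionE)
  have N'sp: "N' \<subseteq> space ?P"
    using S(3) sets.sets_into_space by blast
  have "extend_zero n -` (extend_zero n ` N') \<inter> space ?P = N'"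
    using N'sp inj_on_extend_zero_space[of n] by (auto simp: inj_on_def)
  then have "emeasure (leb n) (extend_zero n ` N') = 0"
    unfolding leb_def using S(3) extend_zero_image_borel[of N' n]
    by (subst emeasure_distr) auto
  then show thesis
    using that[of "extend_zero n ` S" "extend_zero n ` N'"] S extend_zero_image_borel A0(2) by blast
qed

lemma leb_bounded_finite:
  assumes "B \<in> sets borel" "bounded B"
  shows "emeasure (leb n) B < top"
proof -
  obtain r where r: "\<And>x. x \<in> B \<Longrightarrow> norm x \<le> r"
    using assms(2) by (auto simp: bounded_iff)
  let ?Q = "{x \<in> Rn n. \<forall>i<n. coord x i \<in> {-\<bar>r\<bar>..\<bar>r\<bar>}}"
  have "emeasure (leb n) B = emeasure (leb n) (B \<inter> Rn n)"
    by (simp add: emeasure_leb_Int_Rn assms)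
  also have "\<dots> \<le> emeasure (leb n) ?Q"
  proof (rule emeasure_mono)
    show "B \<inter> Rn n \<subseteq> ?Q"
    proof safe
      fix x i assume "x \<in> B"
      then have "\<bar>coord x i\<bar> \<le> \<bar>r\<bar>"
        using r[of x] abs_coord_le_norm[of x i] by linarith
      then show "coord x i \<in> {-\<bar>r\<bar>..\<bar>r\<bar>}"
        by (simp add: abs_le_iff minus_le_iff)
    qed
    have "?Q \<in> sets borel"
      by (rule emeasure_leb_box) simp
    then show "?Q \<in> sets (leb n)" by simp
  qed
  also have "\<dots> = (\<Prod>i<n. ennreal (2 * \<bar>r\<bar>))"
    by (subst emeasure_leb_box) auto
  also have "\<dots> < top"
    by (simp add: ennreal_power)
  finally show ?thesis .
qed

text \<open>
  The fragment is the image of a Borel set, to which the area formula applies, and of a subset of a null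
  set, which has Hausdorff measure zero. The closure of \<open>U\<close> is a compact subset of \<open>V\<close>, so the Jacobian is
  bounded on \<open>U\<close> and the integral that defines the volume is finite; otherwise its value would be \<open>0\<close> by
  convention.
\<close>

lemma fragment_volume_surf:
  assumes n: "n > 0" and P: "has_fragment_volume n P v"
  shows "P \<in> sets (surface_measure n)" "emeasure (surface_measure n) P = ennreal v" "v \<ge> 0"
proof -
  obtain N U V \<phi> A where par: "parameterization n N U V \<phi>" and AU: "A \<subseteq> U"
    and A: "A \<in> sets (lebesgue_Rn n)" and PA: "P = \<phi> ` A"
    and v: "v = set_lebesgue_integral (lebesgue_Rn n) A (\<lambda>x. sqrt (Determinant.det (gram_matrix n \<phi> x)))"
    using P unfolding has_fragment_volume_def by (elim exE conjE) (rule that)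
  have "C1_on V \<phi>"
    using par by (simp add: parameterization_def)
  then obtain D :: "fseq \<Rightarrow> fseq \<Rightarrow>\<^sub>L fseq" where D: "continuous_on V D"
    "\<forall>x\<in>V. (\<phi> has_derivative blinfun_apply (D x)) (at x within V)"
    unfolding C1_on_def by (elim exE conjE) (rule that)
  interpret C1_embedding n V \<phi> D
    using n par D(1) bspec[OF D(2)] by unfold_locales (simp_all add: parameterization_def)
  obtain B N where B: "B \<in> sets borel" "N \<in> sets borel" "B \<subseteq> A" "A \<subseteq> B \<union> N" "emeasure (leb n) N = 0"
    using lebesgue_Rn_approx[OF A] by blast
  have AV: "A \<subseteq> V" and BV: "B \<subseteq> V"
    using AU B(3) par by (auto simp: parameterization_def)
  define f where "f x = indicator V x * jac x" for x
  have f [measurable]: "f \<in> borel_measurable borel"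
    unfolding f_def[abs_def] by measurable
  have f0: "f x \<ge> 0" for x
    using jac_pos[of x] by (auto simp: f_def indicator_def less_imp_le)
  have id: "(\<lambda>x. x) \<in> measurable (lebesgue_Rn n) borel"
    using borel_Int_Rn_in_lebesgue_Rn[of _ n] by (auto simp: measurable_def space_lebesgue_Rn)
  have fM [measurable]: "f \<in> borel_measurable (lebesgue_Rn n)"
    using measurable_compose[OF id f] by simp
  note [measurable] = A
  have "v = (\<integral>x. indicator A x * f x \<partial>lebesgue_Rn n)"
    unfolding v set_lebesgue_integral_def using AV
    by (intro Bochner_Integration.integral_cong refl) (auto simp: indicator_def f_def jac_eq)
  also have "\<dots> = enn2real (\<integral>\<^sup>+x. ennreal (indicator A x * f x) \<partial>lebesgue_Rn n)"
    by (rule integral_eq_nn_integral) (auto simp: f0)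
  also have "(\<integral>\<^sup>+x. ennreal (indicator A x * f x) \<partial>lebesgue_Rn n)
      = (\<integral>\<^sup>+x. ennreal (indicator A (extend_zero n x) * f (extend_zero n x)) \<partial>completed_product n)"
  proof -
    have "(\<lambda>x. ennreal (indicator A x * f x)) \<in> borel_measurable (lebesgue_Rn n)"
      by measurable
    then show ?thesis
      unfolding lebesgue_Rn_def by (rule nn_integral_embed_measure'[OF inj_on_extend_zero_space])
  qed
  also have "\<dots> = (\<integral>\<^sup>+x. ennreal (indicator B (extend_zero n x) * f (extend_zero n x)) \<partial>completed_product n)"
  proof (rule nn_integral_cong_AE)
    have "AE x in leb n. x \<notin> N"
      using B(2,5) by (intro AE_not_in null_setsI) auto
    then have "AE x in Pi\<^sub>M {..<n} (\<lambda>_. lborel). extend_zero n x \<notin> N"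
      unfolding leb_def using B(2) by (subst (asm) AE_distr_iff) auto
    then have "AE x in completed_product n. extend_zero n x \<notin> N"
      by (rule AE_completion)
    then show "AE x in completed_product n. ennreal (indicator A (extend_zero n x) * f (extend_zero n x))
        = ennreal (indicator B (extend_zero n x) * f (extend_zero n x))"
      by eventually_elim (use B(3,4) in \<open>auto simp: indicator_def\<close>)
  qed
  also have "\<dots> = (\<integral>\<^sup>+x. ennreal (indicator B (extend_zero n x) * f (extend_zero n x)) \<partial>Pi\<^sub>M {..<n} (\<lambda>_. lborel))"
    by (rule nn_integral_completion)
  also have "\<dots> = (\<integral>\<^sup>+x. ennreal (indicator B x * f x) \<partial>leb n)"
    using B(1) by (subst nn_integral_leb) auto
  also have "\<dots> = vol B"
    unfolding vol_def f_def by (intro nn_integral_cong) (auto simp: indicator_def)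
  finally have v_vol: "v = enn2real (vol B)" .
  show "v \<ge> 0" by (simp add: v_vol)
  have "compact (closure U)"
  proof (rule compact_Rn[of _ n])
    show "closure U \<subseteq> Rn n"
      using par V_subset by (auto simp: parameterization_def)
  qed (use par in \<open>auto simp: parameterization_def\<close>)
  moreover have "continuous_on (closure U) jac"
    using par by (intro continuous_on_subset[OF cont_jac]) (auto simp: parameterization_def)
  ultimately have "bounded (jac ` closure U)"
    by (intro compact_imp_bounded compact_continuous_image)
  then obtain b where "\<forall>y\<in>jac ` closure U. \<bar>y\<bar> \<le> b"
    by (auto simp: bounded_real)
  then have b: "jac x \<le> b" if "x \<in> closure U" for x
    using that by fastforce
  have "vol B \<le> ennreal b * emeasure (leb n) B"
    using b B(3) AU closure_subset by (intro vol_upper[OF B(1) BV]) blast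
  also have "\<dots> < top"
  proof -
    have "bounded B"
      using par B(3) AU by (auto simp: parameterization_def intro: bounded_subset)
    then show ?thesis
      using leb_bounded_finite[OF B(1)] by (simp add: ennreal_mult_less_top)
  qed
  finally have vol_v: "vol B = ennreal v"
    by (simp add: v_vol)
  have "vol (N \<inter> V) = 0"
  proof -
    have "N \<in> null_sets (leb n)"
      using B(2,5) by (simp add: null_sets_def)
    from AE_not_in[OF this]
    have "AE x in leb n. ennreal (indicator V x * jac x) * indicator (N \<inter> V) x = 0"
      by eventually_elim simp
    then have "vol (N \<inter> V) = (\<integral>\<^sup>+x. 0 \<partial>leb n)"
      unfolding vol_def by (rule nn_integral_cong_AE)
    then show ?thesis by simp
  qed
  then have "hausdorff n (\<phi> ` (N \<inter> V)) = 0"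
    using area_formula(2)[of "N \<inter> V"] B(2) by simp
  moreover have "\<phi> ` (A - B) \<subseteq> \<phi> ` (N \<inter> V)"
    using B(4) AV by blast
  ultimately have "hausdorff n (\<phi> ` (A - B)) = 0"
    using hausdorff_mono[of "\<phi> ` (A - B)" "\<phi> ` (N \<inter> V)" n] by simp
  then have null: "\<phi> ` (A - B) \<in> null_sets (surface_measure n)"
    by (rule null_sets_surfI[OF n])
  have phiB: "\<phi> ` B \<in> sets (surface_measure n)"
    by (rule borel_in_surf[OF n area_formula(1)[OF B(1) BV]])
  have P_eq: "P = \<phi> ` B \<union> \<phi> ` (A - B)"
    using B(3) by (auto simp: PA)
  show "P \<in> sets (surface_measure n)"
    unfolding P_eq using phiB null by auto
  have "emeasure (surface_measure n) P = emeasure (surface_measure n) (\<phi> ` B)"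
    unfolding P_eq by (rule emeasure_Un_null_set[OF phiB null])
  also have "\<dots> = vol B"
    by (rule emeasure_surf_multiple[OF n phiB area_formula(2)[OF B(1) BV]])
  finally show "emeasure (surface_measure n) P = ennreal v"
    by (simp add: vol_v)
qed

lemma has_volume_surf:
  assumes n: "n > 0" and A: "has_volume n A v"
  shows "A \<in> sets (surface_measure n)" "emeasure (surface_measure n) A = ennreal v" "v \<ge> 0"
proof -
  obtain \<P> w where \<P>: "finite \<P>" "disjoint \<P>" "A = \<Union>\<P>"
    and w: "\<And>P. P \<in> \<P> \<Longrightarrow> has_fragment_volume n P (w P)" and v: "v = sum w \<P>"
    using A unfolding has_volume_def by blast
  note frag = fragment_volume_surf[OF n w]
  show "A \<in> sets (surface_measure n)"
    unfolding \<P>(3) using \<P>(1) frag(1) by (intro sets.finite_Union) auto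
  show "v \<ge> 0"
    unfolding v using frag(3) by (rule sum_nonneg)
  have "emeasure (surface_measure n) (\<Union>P\<in>\<P>. P) = (\<Sum>P\<in>\<P>. emeasure (surface_measure n) P)"
    using \<P>(1,2) frag(1)
    by (intro sum_emeasure[symmetric]) (auto simp: disjoint_family_on_def disjoint_def)
  also have "\<dots> = (\<Sum>P\<in>\<P>. ennreal (w P))"
    using frag(2) by (intro sum.cong) auto
  also have "\<dots> = ennreal v"
    unfolding v using frag(3) by (intro sum_ennreal)
  finally show "emeasure (surface_measure n) A = ennreal v"
    by (simp add: \<P>(3))
qed

lemma unit_cube_0: "unit_cube 0 = {0}"
  by (auto simp: unit_cube_def Rn_0)

text \<open>
  In dimension \<open>0\<close> a fragment is empty or a single point, and the Gram determinant is that of the empty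
  matrix, namely \<open>1\<close>.
\<close>

lemma has_volume_0_eq_card:
  assumes "has_volume 0 A v"
  shows "finite A" "v = real (card A)"
proof -
  have frag: "finite P \<and> w = real (card P)" if P: "has_fragment_volume 0 P w" for P w
  proof -
    obtain N U V \<phi> B where par: "parameterization 0 N U V \<phi>" and BU: "B \<subseteq> U" and PB: "P = \<phi> ` B"
      and w: "w = set_lebesgue_integral (lebesgue_Rn 0) B (\<lambda>x. sqrt (Determinant.det (gram_matrix 0 \<phi> x)))"
      using P unfolding has_fragment_volume_def by (elim exE conjE) (rule that)
    have "B \<subseteq> {0}"
      using BU par openin_subset[of "top_of_set (Rn 0)" U] by (auto simp: parameterization_def Rn_0)
    then consider "B = {}" | "B = {0}" by blast
    then show ?thesis
    proof cases
      case 1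
      then show ?thesis by (simp add: PB w set_lebesgue_integral_def)
    next
      case 2
      have "emeasure (lebesgue_Rn 0) ({0} \<inter> Rn 0) = emeasure (leb 0) (unit_cube 0)"
        unfolding unit_cube_0 by (rule emeasure_lebesgue_Rn) simp
      then have "emeasure (lebesgue_Rn 0) {0} = 1"
        by (simp add: Rn_0)
      moreover have "{0} \<in> sets (lebesgue_Rn 0)"
        using borel_Int_Rn_in_lebesgue_Rn[of "{0}" 0] by (simp add: Rn_0)
      moreover have "Determinant.det (gram_matrix 0 \<phi> x) = 1" for x
        by (simp add: gram_matrix_def)
      ultimately show ?thesis
        by (simp add: PB w 2 set_lebesgue_integral_def measure_def)
    qed
  qed
  obtain \<P> w where \<P>: "finite \<P>" "disjoint \<P>" "A = \<Union>\<P>"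
    and w: "\<And>P. P \<in> \<P> \<Longrightarrow> has_fragment_volume 0 P (w P)" and v: "v = sum w \<P>"
    using assms unfolding has_volume_def by blast
  show "finite A"
    using \<P>(1,3) frag[OF w] by auto
  have "card A = sum card \<P>"
    unfolding \<P>(3) using \<P>(2) frag[OF w]
    by (intro card_Union_disjoint) (auto simp: disjoint_def pairwise_def disjnt_def)
  then show "v = real (card A)"
    unfolding v using frag[OF w] by simp
qed

lemma has_volume_null_higher:
  assumes "has_volume m A v" "m < n"
  shows "A \<in> null_sets (surface_measure n)"
proof (cases "m = 0")
  case True
  then show ?thesis
    using has_volume_0_eq_card(1) assms by (intro countable_null_surf countable_finite) auto
next
  case False
  then show ?thesis
    using has_volume_surf[of m A v] assms by (intro surf_finite_imp_null_higher[of m]) auto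
qed

lemma unit_cube_null_higher:
  assumes "m < n"
  shows "unit_cube m \<in> null_sets (surface_measure n)"
proof (cases "m = 0")
  case True
  then show ?thesis
    using assms by (intro countable_null_surf) (auto simp: unit_cube_0)
next
  case False
  then show ?thesis
    using assms emeasure_surf_unit_cube[of m]
    by (intro surf_finite_imp_null_higher[of m]) (auto intro: borel_in_surf)
qed

section \<open>Finite samples of a measure\<close>

text \<open>
  From each atom of the finite algebra generated by \<open>F\<close> take the integer part of \<open>T\<close> times its measure many
  points outside \<open>N\<close>. The atoms are indexed by the subsets of \<open>F\<close>, and each of them contributes an error of
  at most \<open>1\<close>.
\<close>

lemma finite_sample:
  fixes M :: "'a measure"
  assumes F: "finite F" "\<And>A. A \<in> F \<Longrightarrow> A \<in> sets M" "\<And>A. A \<in> F \<Longrightarrow> emeasure M A < \<infinity>"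
    and N: "N \<in> null_sets M" and fin_null: "\<And>S. finite S \<Longrightarrow> S \<in> null_sets M"
    and T: "T \<ge> 0"
  shows "\<exists>z. finite z \<and> z \<inter> N = {} \<and>
    (\<forall>A\<in>F. \<bar>real (card (z \<inter> A)) - T * measure M A\<bar> \<le> 2 ^ card F)"
proof -
  define atom where "atom S = \<Union>F - (\<Union>A\<in>F. if A \<in> S then \<Union>F - A else A) - N" for S
  have atom: "x \<in> atom S \<longleftrightarrow> x \<in> \<Union>F \<and> (\<forall>A\<in>F. x \<in> A \<longleftrightarrow> A \<in> S) \<and> x \<notin> N" for x S
    unfolding atom_def by (auto split: if_splits)
  have UF: "\<Union>F \<in> sets M"
    using F by (intro sets.finite_Union) auto
  have atM: "atom S \<in> sets M" for S
    unfolding atom_def using F UF N by (intro sets.Diff sets.finite_UN) auto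
  have disj: "atom S \<inter> atom S' = {}" if "S \<subseteq> F" "S' \<subseteq> F" "S \<noteq> S'" for S S'
    using that by (auto simp: atom)
  have "\<exists>w. finite w \<and> w \<subseteq> atom S \<and> card w = nat \<lfloor>T * measure M (atom S)\<rfloor>" for S
  proof (cases "finite (atom S)")
    case True
    then have "measure M (atom S) = 0"
      using fin_null[OF True] by (simp add: measure_eq_0_null_sets)
    then show ?thesis by (intro exI[of _ "{}"]) simp
  next
    case False
    then show ?thesis using infinite_arbitrarily_large by blast
  qed
  then obtain w where w: "\<And>S. finite (w S)" "\<And>S. w S \<subseteq> atom S"
    "\<And>S. card (w S) = nat \<lfloor>T * measure M (atom S)\<rfloor>"
    by metis
  define z where "z = (\<Union>S\<in>Pow F. w S)"
  have "finite z"
    unfolding z_def using F(1) w(1) by auto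
  moreover have wN: "x \<notin> N" if "x \<in> w S" for x S
    using subsetD[OF w(2) that] by (simp add: atom)
  then have "z \<inter> N = {}"
    by (auto simp: z_def)
  moreover have "\<bar>real (card (z \<inter> A)) - T * measure M A\<bar> \<le> 2 ^ card F" if A: "A \<in> F" for A
  proof -
    let ?I = "{S \<in> Pow F. A \<in> S}"
    have fI: "finite ?I" using F(1) by simp
    have "x \<in> A \<longleftrightarrow> A \<in> S" if "x \<in> w S" for x S
      using subsetD[OF w(2) that] A by (simp add: atom)
    then have "z \<inter> A = (\<Union>S\<in>?I. w S)"
      by (auto simp: z_def)
    moreover have "card (\<Union>S\<in>?I. w S) = (\<Sum>S\<in>?I. card (w S))"
    proof (rule card_UN_disjoint[OF fI])
      show "\<forall>S\<in>?I. \<forall>S'\<in>?I. S \<noteq> S' \<longrightarrow> w S \<inter> w S' = {}"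
      proof (intro ballI impI)
        fix S S' assume "S \<in> ?I" "S' \<in> ?I" "S \<noteq> S'"
        then show "w S \<inter> w S' = {}"
          using disj[of S S'] w(2)[of S] w(2)[of S'] by auto
      qed
    qed (use w(1) in auto)
    ultimately have card_z: "real (card (z \<inter> A)) = (\<Sum>S\<in>?I. real (nat \<lfloor>T * measure M (atom S)\<rfloor>))"
      using w(3) by simp
    have AN: "A - N = (\<Union>S\<in>?I. atom S)"
    proof
      show "A - N \<subseteq> (\<Union>S\<in>?I. atom S)"
      proof
        fix x assume x: "x \<in> A - N"
        then have "x \<in> atom {B \<in> F. x \<in> B}" using A by (auto simp: atom)
        then show "x \<in> (\<Union>S\<in>?I. atom S)" using x A by (intro UN_I[of "{B \<in> F. x \<in> B}"]) auto
      qed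
      show "(\<Union>S\<in>?I. atom S) \<subseteq> A - N" using A by (auto simp: atom)
    qed
    have "measure M A = measure M (A - N)"
      using measure_Diff_null_set[OF F(2)[OF A] N] by simp
    also have "\<dots> = (\<Sum>S\<in>?I. measure M (atom S))"
      unfolding AN
    proof (rule measure_finite_Union[OF fI])
      show "disjoint_family_on atom ?I"
        unfolding disjoint_family_on_def using disj by simp
      fix S assume "S \<in> ?I"
      then have "atom S \<subseteq> A" using A by (auto simp: atom)
      then have "emeasure M (atom S) \<le> emeasure M A"
        using F(2)[OF A] by (rule emeasure_mono)
      then show "emeasure M (atom S) \<noteq> \<infinity>"
        using F(3)[OF A] by auto
    qed (use atM in auto)
    finally have "\<bar>real (card (z \<inter> A)) - T * measure M A\<bar>
        = \<bar>\<Sum>S\<in>?I. real (nat \<lfloor>T * measure M (atom S)\<rfloor>) - T * measure M (atom S)\<bar>"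
      by (simp add: card_z sum_distrib_left sum_subtractf)
    also have "\<dots> \<le> (\<Sum>S\<in>?I. \<bar>real (nat \<lfloor>T * measure M (atom S)\<rfloor>) - T * measure M (atom S)\<bar>)"
      by (rule sum_abs)
    also have "\<dots> \<le> (\<Sum>S\<in>?I. 1)"
    proof (rule sum_mono)
      fix S
      have "0 \<le> T * measure M (atom S)" using T by simp
      then show "\<bar>real (nat \<lfloor>T * measure M (atom S)\<rfloor>) - T * measure M (atom S)\<bar> \<le> 1"
        by linarith
    qed
    also have "\<dots> \<le> real (card (Pow F))"
      using card_mono[of "Pow F" ?I] F(1) by auto
    also have "\<dots> = 2 ^ card F"
      using F(1) by (simp add: card_Pow)
    finally show ?thesis .
  qed
  ultimately show ?thesis by (intro exI[of _ z]) simp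
qed

text \<open>
  With \<open>T\<close> large, the bounded errors are small compared with the number of points in a set \<open>Q\<close> of
  measure \<open>1\<close>, which can also be made to exceed any given \<open>L\<close>.
\<close>

lemma finite_sample_ratio:
  fixes M :: "'a measure"
  assumes F: "finite F" "\<And>A. A \<in> F \<Longrightarrow> A \<in> sets M" "\<And>A. A \<in> F \<Longrightarrow> emeasure M A < \<infinity>"
    and N: "N \<in> null_sets M" and fin_null: "\<And>S. finite S \<Longrightarrow> S \<in> null_sets M"
    and Q: "Q \<in> F" "measure M Q = 1" and \<eta>: "\<eta> > 0"
  shows "\<exists>z. finite z \<and> z \<inter> N = {} \<and> L \<le> real (card (z \<inter> Q)) \<and> 0 < real (card (z \<inter> Q)) \<and>
    (\<forall>A\<in>F. \<bar>real (card (z \<inter> A)) - measure M A * real (card (z \<inter> Q))\<bar> \<le> \<eta> * real (card (z \<inter> Q)))"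
proof -
  define b :: real where "b = 2 ^ card F"
  define K where "K = b * (1 + (\<Sum>A\<in>F. measure M A))"
  have b: "b > 0" by (simp add: b_def)
  have K: "K \<ge> 0"
    unfolding K_def using b by (intro mult_nonneg_nonneg add_nonneg_nonneg sum_nonneg) auto
  define T where "T = b + \<bar>L\<bar> + K / \<eta> + 1"
  have T: "T \<ge> 0" unfolding T_def using b K \<eta> by auto
  obtain z where z: "finite z" "z \<inter> N = {}"
    "\<And>A. A \<in> F \<Longrightarrow> \<bar>real (card (z \<inter> A)) - T * measure M A\<bar> \<le> b"
    using finite_sample[OF F N fin_null T] unfolding b_def by blast
  define k where "k = real (card (z \<inter> Q))"
  have kT: "\<bar>k - T\<bar> \<le> b"
    using z(3)[OF Q(1)] Q(2) by (simp add: k_def)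
  then have k: "k \<ge> \<bar>L\<bar> + K / \<eta> + 1"
    by (simp add: T_def)
  have "K / \<eta> \<ge> 0" using K \<eta> by simp
  have k1: "L \<le> k" "0 < k" "K / \<eta> \<le> k"
    using k \<open>K / \<eta> \<ge> 0\<close> by linarith+
  have "\<bar>real (card (z \<inter> A)) - measure M A * k\<bar> \<le> \<eta> * k" if A: "A \<in> F" for A
  proof -
    have "\<bar>real (card (z \<inter> A)) - measure M A * k\<bar>
        \<le> \<bar>real (card (z \<inter> A)) - T * measure M A\<bar> + measure M A * \<bar>k - T\<bar>"
    proof -
      have "real (card (z \<inter> A)) - measure M A * k
          = (real (card (z \<inter> A)) - T * measure M A) - measure M A * (k - T)"
        by (simp add: algebra_simps)
      then show ?thesis
        by (metis abs_mult abs_of_nonneg abs_triangle_ineq4 measure_nonneg)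
    qed
    also have "\<dots> \<le> b + measure M A * b"
      using z(3)[OF A] kT by (intro add_mono mult_left_mono) auto
    also have "\<dots> \<le> K"
    proof -
      have "measure M A \<le> (\<Sum>A\<in>F. measure M A)"
        using F(1) A by (intro member_le_sum) auto
      then show ?thesis
        unfolding K_def using b by (simp add: algebra_simps)
    qed
    also have "\<dots> \<le> \<eta> * k"
      using k1(3) \<eta> by (simp add: field_simps)
    finally show ?thesis .
  qed
  then show ?thesis
    using z(1,2) k1 unfolding k_def by blast
qed

text \<open>
  Stage \<open>n\<close> samples \<open>\<sigma> n\<close>, avoids \<open>N n\<close>, and is chosen so large that everything accumulated before, starting
  with \<open>Y\<close>, is negligible. The number \<open>q n\<close> is the count of points in \<open>Q n\<close> at that stage.
\<close>

lemma tower_of_samples: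
  fixes \<sigma> :: "nat \<Rightarrow> 'a measure" and F :: "nat \<Rightarrow> 'a set set"
  assumes F: "\<And>n. n \<in> {1..M} \<Longrightarrow> finite (F n)"
      "\<And>n A. n \<in> {1..M} \<Longrightarrow> A \<in> F n \<Longrightarrow> A \<in> sets (\<sigma> n)"
      "\<And>n A. n \<in> {1..M} \<Longrightarrow> A \<in> F n \<Longrightarrow> emeasure (\<sigma> n) A < \<infinity>"
    and N: "\<And>n. n \<in> {1..M} \<Longrightarrow> N n \<in> null_sets (\<sigma> n)"
    and fin_null: "\<And>n S. n \<in> {1..M} \<Longrightarrow> finite S \<Longrightarrow> S \<in> null_sets (\<sigma> n)"
    and Q: "\<And>n. n \<in> {1..M} \<Longrightarrow> Q n \<in> F n" "\<And>n. n \<in> {1..M} \<Longrightarrow> measure (\<sigma> n) (Q n) = 1"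
    and FN: "\<And>n m A. n \<in> {1..M} \<Longrightarrow> m \<in> {1..M} \<Longrightarrow> n < m \<Longrightarrow> A \<in> F n \<Longrightarrow> A \<subseteq> N m"
    and \<eta>: "\<eta> > 0" and Y: "finite Y"
  obtains z q where "finite z" "Y \<subseteq> z" "\<And>n. n \<in> {1..M} \<Longrightarrow> q n > (0::real)"
    and "\<And>n A. n \<in> {1..M} \<Longrightarrow> A \<in> F n \<Longrightarrow> \<bar>real (card (z \<inter> A)) - measure (\<sigma> n) A * q n\<bar> \<le> \<eta> * q n"
    and "\<And>n A. Suc n \<in> {1..M} \<Longrightarrow> (\<And>m. m \<in> {1..M} \<Longrightarrow> n < m \<Longrightarrow> A \<subseteq> N m) \<Longrightarrow>
      real (card (z \<inter> A)) \<le> \<eta> * q (Suc n)"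
    and "\<And>A. (\<And>m. m \<in> {1..M} \<Longrightarrow> A \<subseteq> N m) \<Longrightarrow> z \<inter> A = Y \<inter> A"
proof -
  define P where "P n L z \<longleftrightarrow> finite z \<and> z \<inter> N n = {} \<and> L \<le> real (card (z \<inter> Q n)) \<and> 0 < real (card (z \<inter> Q n)) \<and>
    (\<forall>A\<in>F n. \<bar>real (card (z \<inter> A)) - measure (\<sigma> n) A * real (card (z \<inter> Q n))\<bar> \<le> \<eta> / 2 * real (card (z \<inter> Q n)))"
    for n L z
  have "\<exists>z. n \<in> {1..M} \<longrightarrow> P n L z" for n L
  proof (cases "n \<in> {1..M}")
    case True
    show ?thesis
      unfolding P_def
      using finite_sample_ratio[OF F(1)[OF True] F(2)[OF True] F(3)[OF True] N[OF True] fin_null[OF True]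
          Q(1)[OF True] Q(2)[OF True], of "\<eta> / 2" L] \<eta> by auto
  qed auto
  then obtain Z where Z: "\<And>n L. n \<in> {1..M} \<Longrightarrow> P n L (Z n L)"
    by metis
  \<comment> \<open>Half of the error is reserved for the points of the earlier stages.\<close>
  define tot where "tot = rec_nat Y (\<lambda>n t. t \<union> Z (Suc n) (2 * real (card t) / \<eta>))"
  define zs where "zs n = Z n (2 * real (card (tot (n - 1))) / \<eta>)" for n
  define q where "q n = real (card (zs n \<inter> Q n))" for n
  have tot: "tot 0 = Y" "tot (Suc n) = tot n \<union> zs (Suc n)" for n
    by (simp_all add: tot_def zs_def)
  have zs: "finite (zs n)" "zs n \<inter> N n = {}" "real (card (tot (n - 1))) \<le> \<eta> / 2 * q n" "0 < q n"
    "\<And>A. A \<in> F n \<Longrightarrow> \<bar>real (card (zs n \<inter> A)) - measure (\<sigma> n) A * q n\<bar> \<le> \<eta> / 2 * q n"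
    if "n \<in> {1..M}" for n
    using Z[OF that, of "2 * real (card (tot (n - 1))) / \<eta>"] \<eta>
    unfolding P_def zs_def[symmetric] q_def[symmetric] by (auto simp: field_simps)
  have fin: "n \<le> M \<Longrightarrow> finite (tot n)" for n
    by (induction n) (use Y zs(1) in \<open>auto simp: tot\<close>)
  have mono: "m \<le> n \<Longrightarrow> tot m \<subseteq> tot n" for m n
    by (rule lift_Suc_mono_le) (auto simp: tot)
  have cut: "tot M \<inter> A = tot n \<inter> A" if "n \<le> M" "\<And>m. m \<in> {1..M} \<Longrightarrow> n < m \<Longrightarrow> A \<subseteq> N m" for n A
  proof -
    have "k \<le> M \<Longrightarrow> n \<le> k \<Longrightarrow> tot k \<inter> A = tot n \<inter> A" for k
    proof (induction k)
      case (Suc k)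
      show ?case
      proof (cases "n = Suc k")
        case False
        then have "zs (Suc k) \<inter> A = {}"
          using zs(2)[of "Suc k"] that(2)[of "Suc k"] Suc.prems by fastforce
        moreover have "tot k \<inter> A = tot n \<inter> A"
          using Suc False by simp
        ultimately show ?thesis
          by (simp add: tot Int_Un_distrib2)
      qed simp
    qed simp
    from this[of M] show ?thesis using that(1) by blast
  qed
  show thesis
  proof (rule that[of "tot M" q])
    show "finite (tot M)" using fin by simp
    show "Y \<subseteq> tot M" using mono[of 0 M] tot(1) by simp
    show "q n > 0" if "n \<in> {1..M}" for n using zs(4)[OF that] .
    show "real (card (tot M \<inter> A)) \<le> \<eta> * q (Suc n)"
      if "Suc n \<in> {1..M}" "\<And>m. m \<in> {1..M} \<Longrightarrow> n < m \<Longrightarrow> A \<subseteq> N m" for n A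
    proof -
      have "card (tot M \<inter> A) \<le> card (tot n)"
        using that(1) by (subst cut[OF _ that(2)]) (auto intro!: card_mono fin)
      then have "real (card (tot M \<inter> A)) \<le> \<eta> / 2 * q (Suc n)"
        using zs(3)[OF that(1)] by simp
      then show ?thesis using \<eta> zs(4)[OF that(1)] by (smt (verit) field_sum_of_halves mult_pos_pos mult_right_mono)
    qed
    show "tot M \<inter> A = Y \<inter> A" if "\<And>m. m \<in> {1..M} \<Longrightarrow> A \<subseteq> N m" for A
      using cut[of 0 A] that tot(1) by simp
    show "\<bar>real (card (tot M \<inter> A)) - measure (\<sigma> n) A * q n\<bar> \<le> \<eta> * q n"
      if n: "n \<in> {1..M}" and A: "A \<in> F n" for n A
    proof -
      obtain k where k: "n = Suc k" using n by (cases n) auto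
      have eq: "tot M \<inter> A = (tot k \<inter> A) \<union> (zs n \<inter> A)"
        using cut[of n A] FN[OF n _ _ A] n by (auto simp: k tot)
      have fk: "finite (tot k)" using fin n k by simp
      have "card (tot M \<inter> A) \<le> card (tot k \<inter> A) + card (zs n \<inter> A)"
        unfolding eq by (rule card_Un_le)
      moreover have "card (tot k \<inter> A) \<le> card (tot k)"
        using fk by (intro card_mono) auto
      moreover have "card (zs n \<inter> A) \<le> card (tot M \<inter> A)"
        unfolding eq using fk zs(1)[OF n] by (intro card_mono) auto
      ultimately have "\<bar>real (card (tot M \<inter> A)) - real (card (zs n \<inter> A))\<bar> \<le> \<eta> / 2 * q n"
        using zs(3)[OF n] by (simp add: k)
      with zs(5)[OF n A] show ?thesis
        by linarith
    qed
  qed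
qed

section \<open>Finite sets meeting finitely many requirements\<close>

lemma emeasure_leb_translate_image:
  assumes x: "x \<in> Rn n" and A: "A \<in> sets borel"
  shows "emeasure (leb n) ((\<lambda>a. a + x) ` A) = emeasure (leb n) A"
proof -
  have "(\<lambda>a. a + x) ` A = (\<lambda>a. a + (- x)) -` A"
    by (auto simp: image_iff) (metis diff_add_cancel)
  then show ?thesis
    using emeasure_leb_translate[OF Rn_uminus[OF x] A] by simp
qed

lemma translate_image_borel:
  fixes A :: "fseq set"
  assumes "A \<in> sets borel"
  shows "(\<lambda>a. a + x) ` A \<in> sets borel"
proof -
  have "(\<lambda>a. a + x) ` A = (\<lambda>a. a + (- x)) -` A"
    by (auto simp: image_iff) (metis diff_add_cancel)
  then show ?thesis
    using measurable_sets[of "\<lambda>a. a + (- x)" borel borel A] assms by simp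
qed

text \<open>
  Above dimension \<open>N0\<close> no curved surfaces have to be sampled. The restriction to \<open>Rn n\<close> gives a
  middling set its Lebesgue measure, which is finite in high dimensions, while its Hausdorff measure in the
  whole sequence space may be infinite.
\<close>

definition stage_measure :: "nat \<Rightarrow> nat \<Rightarrow> fseq measure"
  where "stage_measure N0 n = (if n \<le> N0 then surface_measure n else density (surface_measure n) (indicator (Rn n)))"

lemma sets_stage_measure [simp]: "sets (stage_measure N0 n) = sets (surface_measure n)"
  by (simp add: stage_measure_def)

lemma emeasure_stage_measure_flat:
  assumes "N0 < n" "A \<in> sets borel"
  shows "emeasure (stage_measure N0 n) A = emeasure (leb n) A"
proof -
  have n: "n > 0" using assms(1) by simp
  have "emeasure (stage_measure N0 n) A = emeasure (surface_measure n) (Rn n \<inter> A)"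
    using assms(1) borel_in_surf[OF n Rn_borel] borel_in_surf[OF n assms(2)]
    by (simp add: stage_measure_def emeasure_restricted)
  then show ?thesis
    using emeasure_surf_Rn[OF n assms(2)] by (simp add: Int_commute)
qed

lemma null_sets_stage_measure:
  assumes "n > 0" "A \<in> null_sets (surface_measure n)"
  shows "A \<in> null_sets (stage_measure N0 n)"
proof (cases "n \<le> N0")
  case False
  have "Rn n \<inter> A \<in> null_sets (surface_measure n)"
    using assms borel_in_surf[OF assms(1) Rn_borel] by (intro null_set_Int1) auto
  then have "emeasure (stage_measure N0 n) A = 0"
    using False assms borel_in_surf[OF assms(1) Rn_borel]
    by (simp add: stage_measure_def emeasure_restricted null_setsD2 null_setsD1)
  then show ?thesis
    using assms(2) by (intro null_setsI) auto
qed (use assms in \<open>simp add: stage_measure_def\<close>)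

lemma emeasure_stage_measure_unit_cube:
  assumes "n > 0"
  shows "emeasure (stage_measure N0 n) (unit_cube n) = 1"
  using assms emeasure_surf_unit_cube[of n] emeasure_stage_measure_flat[of N0 n "unit_cube n"]
  by (cases "n \<le> N0") (auto simp: stage_measure_def)

abbreviation count_in :: "'a set \<Rightarrow> 'a set \<Rightarrow> real"
  where "count_in z A \<equiv> real (card (z \<inter> A))"

text \<open>
  The number \<open>K\<close> bounds all error terms, and also the dimensions of the unit cubes that are compared. Only
  consecutive cubes are compared, since the other comparisons follow.
\<close>

definition meets_requirements ::
    "fseq set \<Rightarrow> (nat \<times> fseq set \<times> real) set \<Rightarrow> fseq set set \<Rightarrow> (fseq set \<times> fseq) set \<Rightarrow> nat \<Rightarrow> fseq set \<Rightarrow> bool"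
  where "meets_requirements Y Fr Cs Ms K z \<longleftrightarrow> Y \<subseteq> z \<and>
    (\<forall>i<K. real K * count_in z (unit_cube i) < count_in z (unit_cube (Suc i))) \<and>
    (\<forall>(n, A, v)\<in>Fr. real K * \<bar>count_in z A - v * count_in z (unit_cube n)\<bar> < count_in z (unit_cube n)) \<and>
    (\<forall>C\<in>Cs. real K * count_in z C < count_in z (unit_cube 1)) \<and>
    (\<forall>(A, x)\<in>Ms. real K * \<bar>count_in z ((\<lambda>a. a + x) ` A) - count_in z A\<bar> < count_in z A)"

lemma middling_leb:
  assumes "A \<in> sets borel" "middling A"
  shows "\<forall>\<^sub>F n in sequentially. emeasure (leb n) A < \<infinity>" "\<exists>n>N. emeasure (leb n) A > 0"
proof -
  show "\<forall>\<^sub>F n in sequentially. emeasure (leb n) A < \<infinity>"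
    using assms by (simp add: middling_def emeasure_lebesgue_Rn)
  have "\<exists>\<^sub>F n in sequentially. emeasure (leb n) A > 0"
    using assms by (simp add: middling_def emeasure_lebesgue_Rn)
  then show "\<exists>n>N. emeasure (leb n) A > 0"
    unfolding frequently_sequentially by (meson Suc_le_eq)
qed

text \<open>
  Fragments and cubes are sampled in their own dimension. A middling set and its translate are sampled in
  the last dimension up to \<open>M\<close> in which they are not null. All of these sets, and the countable ones, are
  null in the later stages and are avoided there.
\<close>

lemma meets_requirements_exists:
  assumes Y: "finite Y" and Fr: "finite Fr" "\<And>n A v. (n, A, v) \<in> Fr \<Longrightarrow> has_volume n A v"
    and Cs: "finite Cs" "\<And>C. C \<in> Cs \<Longrightarrow> countable C"
    and Ms: "finite Ms" "\<And>A x. (A, x) \<in> Ms \<Longrightarrow> A \<in> sets borel \<and> middling A"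
  shows "\<exists>z. finite z \<and> meets_requirements Y Fr Cs Ms K z"
proof -
  have MsB: "fst p \<in> sets borel" "middling (fst p)" if "p \<in> Ms" for p
    using Ms(2)[of "fst p" "snd p"] that by auto
  have FrV: "has_volume (fst t) (fst (snd t)) (snd (snd t))" if "t \<in> Fr" for t
    using Fr(2) that by (cases t) auto
  define tr where "tr p = (\<lambda>a. a + snd p) ` fst p" for p :: "fseq set \<times> fseq"
  have tr_borel: "tr p \<in> sets borel" if "p \<in> Ms" for p
    unfolding tr_def by (rule translate_image_borel[OF MsB(1)[OF that]])

  \<comment> \<open>Above dimension \<open>N0\<close> only flat pieces have to be sampled.\<close>
  have "\<forall>\<^sub>F n in sequentially. \<forall>p\<in>Ms. snd p \<in> Rn n \<and> emeasure (leb n) (fst p) < \<infinity>"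
  proof (intro eventually_ball_finite Ms(1) ballI eventually_conj)
    fix p assume p: "p \<in> Ms"
    obtain k where "snd p \<in> Rn k" using ex_in_Rn by blast
    then show "\<forall>\<^sub>F n in sequentially. snd p \<in> Rn n"
      using Rn_mono unfolding eventually_sequentially by blast
    show "\<forall>\<^sub>F n in sequentially. emeasure (leb n) (fst p) < \<infinity>"
      using middling_leb(1) MsB[OF p] by blast
  qed
  moreover have "\<forall>\<^sub>F n in sequentially. \<forall>t\<in>Fr. fst t \<le> n"
    by (intro eventually_ball_finite Fr(1) ballI eventually_ge_at_top)
  ultimately have "\<forall>\<^sub>F n in sequentially. K \<le> n \<and> (\<forall>t\<in>Fr. fst t \<le> n) \<and>
      (\<forall>p\<in>Ms. snd p \<in> Rn n \<and> emeasure (leb n) (fst p) < \<infinity>)"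
    using eventually_ge_at_top[of K] by eventually_elim blast
  then obtain N0 where N0: "\<forall>n\<ge>N0. K \<le> n \<and> (\<forall>t\<in>Fr. fst t \<le> n) \<and>
      (\<forall>p\<in>Ms. snd p \<in> Rn n \<and> emeasure (leb n) (fst p) < \<infinity>)"
    unfolding eventually_sequentially ..
  have K: "K \<le> N0" and FrN: "\<And>t. t \<in> Fr \<Longrightarrow> fst t \<le> N0"
    using N0 by auto
  have MsN: "snd p \<in> Rn n" "emeasure (leb n) (fst p) < \<infinity>" if "p \<in> Ms" "N0 \<le> n" for p n
    using N0 that by auto

  have "\<forall>p\<in>Ms. \<exists>n>N0. emeasure (leb n) (fst p) > 0"
    using middling_leb(2) MsB by blast
  then obtain t where t: "\<forall>p\<in>Ms. t p > N0 \<and> emeasure (leb (t p)) (fst p) > 0"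
    by metis
  define M where "M = Max (insert (Suc N0) (t ` Ms))"
  have M: "Suc N0 \<le> M" "\<And>p. p \<in> Ms \<Longrightarrow> t p \<le> M"
    using Ms(1) by (auto simp: M_def)
  define pos where "pos p = {n. N0 < n \<and> n \<le> M \<and> emeasure (leb n) (fst p) > 0}" for p :: "fseq set \<times> fseq"
  define top where "top p = Max (pos p)" for p :: "fseq set \<times> fseq"
  have pos: "finite (pos p)" "p \<in> Ms \<Longrightarrow> pos p \<noteq> {}" for p
  proof -
    show "finite (pos p)" by (rule finite_subset[of _ "{..M}"]) (auto simp: pos_def)
    assume "p \<in> Ms"
    then have "t p \<in> pos p" using t M(2) by (auto simp: pos_def)
    then show "pos p \<noteq> {}" by blast
  qed
  have top: "N0 < top p" "top p \<le> M" "emeasure (leb (top p)) (fst p) > 0" if "p \<in> Ms" for p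
    using Max_in[OF pos(1) pos(2)[OF that]] unfolding top_def[symmetric] by (simp_all add: pos_def)
  have above_top: "emeasure (leb m) (fst p) = 0" if "p \<in> Ms" "top p < m" "m \<le> M" for p m
  proof (rule ccontr)
    assume "emeasure (leb m) (fst p) \<noteq> 0"
    then have "m \<in> pos p"
      using that top(1)[OF that(1)] by (auto simp: pos_def zero_less_iff_neq_zero)
    then show False
      using Max_ge[OF pos(1), of m p] that(2) by (simp add: top_def)
  qed

  let ?\<sigma> = "stage_measure N0"
  have flat: "emeasure (?\<sigma> n) (fst p) = emeasure (leb n) (fst p)"
    "emeasure (?\<sigma> n) (tr p) = emeasure (leb n) (fst p)" if "p \<in> Ms" "N0 < n" for p n
  proof -
    show "emeasure (?\<sigma> n) (fst p) = emeasure (leb n) (fst p)"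
      by (rule emeasure_stage_measure_flat[OF that(2) MsB(1)[OF that(1)]])
    have "emeasure (?\<sigma> n) (tr p) = emeasure (leb n) (tr p)"
      by (rule emeasure_stage_measure_flat[OF that(2) tr_borel[OF that(1)]])
    also have "\<dots> = emeasure (leb n) (fst p)"
      unfolding tr_def using that by (intro emeasure_leb_translate_image MsN MsB) auto
    finally show "emeasure (?\<sigma> n) (tr p) = emeasure (leb n) (fst p)" .
  qed

  \<comment> \<open>F n are the sets whose proportions stage n has to realize, B m the sets that stage m has to avoid.\<close>
  define F where "F n = insert (unit_cube n) ((\<lambda>t. fst (snd t)) ` {t \<in> Fr. fst t = n} \<union>
    fst ` {p \<in> Ms. top p = n} \<union> tr ` {p \<in> Ms. top p = n})" for n
  define B where "B m = unit_cube ` {..<m} \<union> (\<lambda>t. fst (snd t)) ` {t \<in> Fr. fst t < m} \<union> Cs \<union>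
    fst ` {p \<in> Ms. top p < m} \<union> tr ` {p \<in> Ms. top p < m}" for m
  \<comment> \<open>Stage 0 is exact: it contains the origin, which is the unit cube of dimension 0, and all points of the
    0-dimensional fragments.\<close>
  define Y' where "Y' = Y \<union> {0} \<union> (\<Union>t\<in>{t \<in> Fr. fst t = 0}. fst (snd t))"

  have vol: "fst (snd t) \<in> sets (?\<sigma> n)" "emeasure (?\<sigma> n) (fst (snd t)) = ennreal (snd (snd t))"
    "0 \<le> snd (snd t)" if "t \<in> Fr" "fst t = n" "n > 0" for t n
  proof -
    have "has_volume n (fst (snd t)) (snd (snd t))"
      using FrV[OF that(1)] that(2) by simp
    note v = has_volume_surf[OF that(3) this]
    show "fst (snd t) \<in> sets (?\<sigma> n)" "0 \<le> snd (snd t)" using v by simp_all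
    show "emeasure (?\<sigma> n) (fst (snd t)) = ennreal (snd (snd t))"
      using v(2) FrN[OF that(1)] that(2) by (simp add: stage_measure_def)
  qed
  have F_sets: "A \<in> sets (?\<sigma> n)" and F_fin: "emeasure (?\<sigma> n) A < \<infinity>" if n: "n \<in> {1..M}" and A: "A \<in> F n" for n A
  proof -
    have n0: "n > 0" using n by simp
    consider "A = unit_cube n" | t where "t \<in> Fr" "fst t = n" "A = fst (snd t)"
      | p where "p \<in> Ms" "top p = n" "A = fst p \<or> A = tr p"
      using A unfolding F_def by blast
    then have "A \<in> sets (?\<sigma> n) \<and> emeasure (?\<sigma> n) A < \<infinity>"
    proof cases
      case 1
      then show ?thesis
        using emeasure_stage_measure_unit_cube[OF n0, of N0] borel_in_surf[OF n0] by simp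
    next
      case 2
      then show ?thesis using vol[OF 2(1,2) n0] by simp
    next
      case 3
      have "N0 < n" using top(1)[OF 3(1)] 3(2) by simp
      then show ?thesis
        using 3 flat[OF 3(1)] MsN(2)[OF 3(1), of n] MsB(1)[OF 3(1)] tr_borel[OF 3(1)] borel_in_surf[OF n0]
        by auto
    qed
    then show "A \<in> sets (?\<sigma> n)" "emeasure (?\<sigma> n) A < \<infinity>" by auto
  qed
  have B_null: "E \<in> null_sets (?\<sigma> m)" if m: "m \<in> {1..M}" and E: "E \<in> B m" for E m
  proof -
    have m0: "m > 0" using m by simp
    consider k where "k < m" "E = unit_cube k" | t where "t \<in> Fr" "fst t < m" "E = fst (snd t)"
      | "E \<in> Cs" | p where "p \<in> Ms" "top p < m" "E = fst p \<or> E = tr p"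
      using E unfolding B_def by blast
    then show ?thesis
    proof cases
      case 1
      then show ?thesis using unit_cube_null_higher null_sets_stage_measure[OF m0] by blast
    next
      case 2
      then have "has_volume (fst t) E (snd (snd t))"
        using FrV[of t] by simp
      then show ?thesis
        using has_volume_null_higher 2(2) null_sets_stage_measure[OF m0] by blast
    next
      case 3
      then show ?thesis
        using countable_null_surf[OF m0 Cs(2)] null_sets_stage_measure[OF m0] by blast
    next
      case 4
      have "N0 < m" using top(1)[OF 4(1)] 4(2) by simp
      moreover have "emeasure (leb m) (fst p) = 0"
        using above_top[OF 4(1,2)] m by simp
      ultimately have "emeasure (?\<sigma> m) E = 0"
        using 4(3) flat[OF 4(1)] by auto
      then show ?thesis
        using 4(3) MsB(1)[OF 4(1)] tr_borel[OF 4(1)] borel_in_surf[OF m0] by (intro null_setsI) auto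
    qed
  qed
  have "finite (B m)" for m
    unfolding B_def using Fr(1) Cs(1) Ms(1) by auto
  then have UB_null: "\<Union>(B m) \<in> null_sets (?\<sigma> m)" if "m \<in> {1..M}" for m
    using null_sets_UN'[of "B m" "\<lambda>E. E" "?\<sigma> m"] B_null[OF that] countable_finite by auto
  have fin_null: "S \<in> null_sets (?\<sigma> n)" if "n \<in> {1..M}" "finite S" for n S
    using that by (intro null_sets_stage_measure countable_null_surf countable_finite) auto
  have F_le_B: "A \<subseteq> \<Union>(B m)" if "A \<in> F n" "n < m" for A n m
  proof -
    have "A \<in> B m"
      using that unfolding F_def B_def by blast
    then show ?thesis by blast
  qed
  have Y': "finite Y'"
  proof -
    have "finite (fst (snd t))" if "t \<in> Fr" "fst t = 0" for t
      using has_volume_0_eq_card(1) FrV[OF that(1)] that(2) by metis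
    then show ?thesis
      unfolding Y'_def using Y Fr(1) by auto
  qed

  define s where "s p = measure (leb (top p)) (fst p)" for p :: "fseq set \<times> fseq"
  have s: "s p > 0" if "p \<in> Ms" for p
    unfolding s_def measure_def using top(3)[OF that] MsN(2)[OF that, of "top p"] top(1)[OF that]
    by (simp add: enn2real_positive_iff)
  obtain \<eta> where \<eta>: "\<eta> > 0" "real K * \<eta> < 1 - \<eta>"
    "\<forall>t\<in>Fr. real K * (\<eta> * (1 + \<bar>snd (snd t)\<bar>)) < 1 - \<eta>"
    "\<forall>p\<in>Ms. real K * (2 * \<eta>) < s p - \<eta>"
  proof -
    have "\<forall>\<^sub>F \<eta> in at_right 0. real K * \<eta> < 1 - \<eta>"
    proof -
      have "((\<lambda>\<eta>. 1 - \<eta> - real K * \<eta>) \<longlongrightarrow> 1 - 0 - real K * 0) (at_right 0)"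
        by (intro tendsto_intros)
      from order_tendstoD(1)[OF this, of 0] show ?thesis
        by (simp add: algebra_simps)
    qed
    moreover have "\<forall>\<^sub>F \<eta> in at_right 0. \<forall>t\<in>Fr. real K * (\<eta> * (1 + \<bar>snd (snd t)\<bar>)) < 1 - \<eta>"
    proof (intro eventually_ball_finite Fr(1) ballI)
      fix t
      have "((\<lambda>\<eta>. 1 - \<eta> - real K * (\<eta> * (1 + \<bar>snd (snd t)\<bar>))) \<longlongrightarrow> 1 - 0 - real K * (0 * (1 + \<bar>snd (snd t)\<bar>))) (at_right 0)"
        by (intro tendsto_intros)
      from order_tendstoD(1)[OF this, of 0]
      show "\<forall>\<^sub>F \<eta> in at_right 0. real K * (\<eta> * (1 + \<bar>snd (snd t)\<bar>)) < 1 - \<eta>"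
        by (simp add: algebra_simps)
    qed
    moreover have "\<forall>\<^sub>F \<eta> in at_right 0. \<forall>p\<in>Ms. real K * (2 * \<eta>) < s p - \<eta>"
    proof (intro eventually_ball_finite Ms(1) ballI)
      fix p assume "p \<in> Ms"
      have "((\<lambda>\<eta>. s p - \<eta> - real K * (2 * \<eta>)) \<longlongrightarrow> s p - 0 - real K * (2 * 0)) (at_right 0)"
        by (intro tendsto_intros)
      from order_tendstoD(1)[OF this, of 0] show "\<forall>\<^sub>F \<eta> in at_right 0. real K * (2 * \<eta>) < s p - \<eta>"
        using s[OF \<open>p \<in> Ms\<close>] by (simp add: algebra_simps)
    qed
    moreover have "\<forall>\<^sub>F \<eta> in at_right (0::real). \<eta> > 0"
      by (rule eventually_at_right_less)
    ultimately have "\<forall>\<^sub>F \<eta> in at_right 0. \<eta> > 0 \<and> real K * \<eta> < 1 - \<eta> \<and>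
      (\<forall>t\<in>Fr. real K * (\<eta> * (1 + \<bar>snd (snd t)\<bar>)) < 1 - \<eta>) \<and> (\<forall>p\<in>Ms. real K * (2 * \<eta>) < s p - \<eta>)"
      by eventually_elim blast
    from eventually_happens'[OF _ this] show thesis
      using that by auto
  qed

  obtain z q where z: "finite z" "Y' \<subseteq> z" and q: "\<And>n. n \<in> {1..M} \<Longrightarrow> q n > (0::real)"
    and F_near: "\<And>n A. n \<in> {1..M} \<Longrightarrow> A \<in> F n \<Longrightarrow> \<bar>count_in z A - measure (?\<sigma> n) A * q n\<bar> \<le> \<eta> * q n"
    and low: "\<And>n A. Suc n \<in> {1..M} \<Longrightarrow> (\<And>m. m \<in> {1..M} \<Longrightarrow> n < m \<Longrightarrow> A \<subseteq> \<Union>(B m)) \<Longrightarrow>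
      count_in z A \<le> \<eta> * q (Suc n)"
    and base: "\<And>A. (\<And>m. m \<in> {1..M} \<Longrightarrow> A \<subseteq> \<Union>(B m)) \<Longrightarrow> z \<inter> A = Y' \<inter> A"
  proof (rule tower_of_samples[where M = M and F = F and \<sigma> = ?\<sigma> and N = "\<lambda>m. \<Union>(B m)" and Q = unit_cube and \<eta> = \<eta> and Y = Y'])
    show "finite (F n)" for n
      unfolding F_def using Fr(1) Ms(1) by auto
    show "measure (?\<sigma> n) (unit_cube n) = 1" if "n \<in> {1..M}" for n
      using emeasure_stage_measure_unit_cube[of n N0] that by (simp add: measure_def)
    show "unit_cube n \<in> F n" for n by (simp add: F_def)
  qed (use F_sets F_fin UB_null fin_null F_le_B \<eta>(1) Y' that in auto)

  have cube: "(1 - \<eta>) * q n \<le> count_in z (unit_cube n)" "\<bar>count_in z (unit_cube n) - q n\<bar> \<le> \<eta> * q n"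
    if n: "n \<in> {1..M}" for n
  proof -
    have "unit_cube n \<in> F n" by (simp add: F_def)
    moreover have "measure (?\<sigma> n) (unit_cube n) = 1"
      using emeasure_stage_measure_unit_cube[of n N0] n by (simp add: measure_def)
    ultimately show "\<bar>count_in z (unit_cube n) - q n\<bar> \<le> \<eta> * q n"
      using F_near[OF n, of "unit_cube n"] by simp
    then show "(1 - \<eta>) * q n \<le> count_in z (unit_cube n)"
      by (simp add: algebra_simps)
  qed
  have small: "real K * a < count_in z (unit_cube n)"
    if n: "n \<in> {1..M}" and a: "a \<le> b * q n" "real K * b < 1 - \<eta>" for a b n
  proof -
    have "real K * a \<le> real K * (b * q n)"
      using a(1) by (intro mult_left_mono) auto
    also have "\<dots> = (real K * b) * q n" by simp
    also have "\<dots> < (1 - \<eta>) * q n"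
      using a(2) q[OF n] by (rule mult_strict_right_mono)
    also have "\<dots> \<le> count_in z (unit_cube n)"
      by (rule cube(1)[OF n])
    finally show ?thesis .
  qed

  have "meets_requirements Y Fr Cs Ms K z"
    unfolding meets_requirements_def
  proof (intro conjI allI impI ballI)
    show "Y \<subseteq> z" using z(2) by (auto simp: Y'_def)
  next
    fix i assume i: "i < K"
    then have Si: "Suc i \<in> {1..M}" using K M(1) by auto
    have "count_in z (unit_cube i) \<le> \<eta> * q (Suc i)"
      by (rule low[OF Si]) (auto simp: B_def)
    then show "real K * count_in z (unit_cube i) < count_in z (unit_cube (Suc i))"
      using \<eta>(2) by (rule small[OF Si])
  next
    fix C assume C: "C \<in> Cs"
    have "count_in z C \<le> \<eta> * q (Suc 0)"
      by (rule low) (use C M(1) in \<open>auto simp: B_def\<close>)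
    then show "real K * count_in z C < count_in z (unit_cube 1)"
      using small[of "Suc 0" _ \<eta>] \<eta>(2) M(1) by simp
  next
    fix t assume t: "t \<in> Fr"
    define n A v where "n = fst t" "A = fst (snd t)" "v = snd (snd t)"
    note nAv = n_A_v_def
    have tA: "t = (n, A, v)" by (simp add: nAv)
    have "real K * \<bar>count_in z A - v * count_in z (unit_cube n)\<bar> < count_in z (unit_cube n)"
    proof (cases "n = 0")
      case True
      have "has_volume 0 A v" using Fr(2) t tA True by blast
      note fin = has_volume_0_eq_card[OF this]
      have sub: "unit_cube 0 \<union> A \<subseteq> Y'"
        using t True by (auto simp: Y'_def unit_cube_0 nAv)
      have "z \<inter> A = Y' \<inter> A"
        by (rule base) (use t True in \<open>auto simp: B_def nAv\<close>)
      then have "z \<inter> A = A" using sub by blast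
      moreover have "z \<inter> unit_cube 0 = Y' \<inter> unit_cube 0"
        by (rule base) (auto simp: B_def)
      then have "z \<inter> unit_cube 0 = {0}" using sub by (auto simp: unit_cube_0)
      ultimately show ?thesis
        using fin True by simp
    next
      case False
      have "n \<le> N0" using FrN[OF t] by (simp add: nAv)
      then have n: "n \<in> {1..M}" using M(1) False by auto
      have "A \<in> F n" using t by (auto simp: F_def nAv)
      moreover have "measure (?\<sigma> n) A = v"
        using vol[OF t, of n] False by (simp add: nAv measure_def)
      ultimately have "\<bar>count_in z A - v * q n\<bar> \<le> \<eta> * q n"
        using F_near[OF n] by metis
      moreover have "\<bar>v * q n - v * count_in z (unit_cube n)\<bar> \<le> \<bar>v\<bar> * (\<eta> * q n)"
        using cube(2)[OF n] by (simp add: abs_mult abs_minus_commute mult_left_mono flip: right_diff_distrib)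
      ultimately have "\<bar>count_in z A - v * count_in z (unit_cube n)\<bar> \<le> \<eta> * q n + \<bar>v\<bar> * (\<eta> * q n)"
        by linarith
      then have "\<bar>count_in z A - v * count_in z (unit_cube n)\<bar> \<le> (\<eta> * (1 + \<bar>v\<bar>)) * q n"
        by (simp add: algebra_simps)
      then show ?thesis
        using \<eta>(3) t by (intro small[OF n]) (auto simp: nAv)
    qed
    then show "case t of (n, A, v) \<Rightarrow> real K * \<bar>count_in z A - v * count_in z (unit_cube n)\<bar> < count_in z (unit_cube n)"
      by (simp add: tA)
  next
    fix p assume p: "p \<in> Ms"
    let ?n = "top p"
    have n: "?n \<in> {1..M}" using top[OF p] by auto
    have "measure (?\<sigma> ?n) (fst p) = s p" "measure (?\<sigma> ?n) (tr p) = s p"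
      using flat[OF p top(1)[OF p]] by (simp_all add: measure_def s_def)
    moreover have "fst p \<in> F ?n" "tr p \<in> F ?n"
      using p by (auto simp: F_def)
    ultimately have near: "\<bar>count_in z (fst p) - s p * q ?n\<bar> \<le> \<eta> * q ?n"
      "\<bar>count_in z (tr p) - s p * q ?n\<bar> \<le> \<eta> * q ?n"
      using F_near[OF n, of "fst p"] F_near[OF n, of "tr p"] by simp_all
    have "real K * \<bar>count_in z (tr p) - count_in z (fst p)\<bar> \<le> real K * (2 * \<eta> * q ?n)"
      using near by (intro mult_left_mono) linarith+
    also have "\<dots> = (real K * (2 * \<eta>)) * q ?n" by simp
    also have "\<dots> < (s p - \<eta>) * q ?n"
      using \<eta>(4) p q[OF n] by (intro mult_strict_right_mono) auto
    also have "\<dots> \<le> count_in z (fst p)"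
      using near(1) by (simp add: algebra_simps)
    finally show "case p of (A, x) \<Rightarrow> real K * \<bar>count_in z ((\<lambda>a. a + x) ` A) - count_in z A\<bar> < count_in z A"
      by (simp add: tr_def case_prod_unfold)
  qed
  then show ?thesis using z(1) by blast
qed

section \<open>The filter and its reduced power\<close>

text \<open>
  A tuple collects finitely many requirements of each kind, so the sets of solutions are directed downwards
  and the filter they generate is proper because each of them is nonempty.
\<close>

type_synonym requirements =
  "fseq set \<times> (nat \<times> fseq set \<times> real) set \<times> fseq set set \<times> (fseq set \<times> fseq) set \<times> nat"

definition admissible :: "requirements set"
  where "admissible = {(Y, Fr, Cs, Ms, K). finite Y \<and> finite Fr \<and> (\<forall>(n, A, v)\<in>Fr. has_volume n A v) \<and>
    finite Cs \<and> (\<forall>C\<in>Cs. countable C) \<and> finite Ms \<and> (\<forall>(A, x)\<in>Ms. A \<in> sets borel \<and> middling A)}"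

definition satisfying :: "requirements \<Rightarrow> fseq fset set"
  where "satisfying = (\<lambda>(Y, Fr, Cs, Ms, K). {z. meets_requirements Y Fr Cs Ms K (fset z)})"

definition requirement_filter :: "fseq fset filter"
  where "requirement_filter = (INF p\<in>admissible. principal (satisfying p))"

lemma satisfying_nonempty: "p \<in> admissible \<Longrightarrow> satisfying p \<noteq> {}"
proof -
  assume p: "p \<in> admissible"
  obtain Y Fr Cs Ms K where p_eq: "p = (Y, Fr, Cs, Ms, K)" by (cases p) auto
  have "\<exists>z. finite z \<and> meets_requirements Y Fr Cs Ms K z"
    using p unfolding p_eq admissible_def by (intro meets_requirements_exists) auto
  then obtain z where "finite z" "meets_requirements Y Fr Cs Ms K z" by blast
  then have "Abs_fset z \<in> satisfying p"
    by (simp add: p_eq satisfying_def Abs_fset_inverse)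
  then show ?thesis by blast
qed

lemma meets_requirements_mono:
  assumes "meets_requirements Y Fr Cs Ms K z"
    and "Y' \<subseteq> Y" "Fr' \<subseteq> Fr" "Cs' \<subseteq> Cs" "Ms' \<subseteq> Ms" "K' \<le> K"
  shows "meets_requirements Y' Fr' Cs' Ms' K' z"
proof -
  have m: "Y \<subseteq> z" "\<forall>i<K. real K * count_in z (unit_cube i) < count_in z (unit_cube (Suc i))"
    "\<forall>(n, A, v)\<in>Fr. real K * \<bar>count_in z A - v * count_in z (unit_cube n)\<bar> < count_in z (unit_cube n)"
    "\<forall>C\<in>Cs. real K * count_in z C < count_in z (unit_cube 1)"
    "\<forall>(A, x)\<in>Ms. real K * \<bar>count_in z ((\<lambda>a. a + x) ` A) - count_in z A\<bar> < count_in z A"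
    using assms(1) unfolding meets_requirements_def by - (elim conjE, assumption)+
  have le: "real K' * t < u" if "t \<ge> 0" "real K * t < u" for t u
    using mult_right_mono[of "real K'" "real K" t] assms(6) that by simp
  show ?thesis
    unfolding meets_requirements_def
  proof (intro conjI allI impI ballI)
    show "Y' \<subseteq> z"
      using m(1) assms(2) by (rule subset_trans[rotated])
    show "real K' * count_in z (unit_cube i) < count_in z (unit_cube (Suc i))" if "i < K'" for i
      using m(2) assms(6) that by (intro le) simp_all
    show "real K' * count_in z C < count_in z (unit_cube 1)" if "C \<in> Cs'" for C
      using bspec[OF m(4) subsetD[OF assms(4) that]] by (intro le) simp_all
    show "case t of (n, A, v) \<Rightarrow> real K' * \<bar>count_in z A - v * count_in z (unit_cube n)\<bar> < count_in z (unit_cube n)"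
      if "t \<in> Fr'" for t
      using bspec[OF m(3) subsetD[OF assms(3) that]] by (auto simp: case_prod_unfold intro!: le)
    show "case p of (A, x) \<Rightarrow> real K' * \<bar>count_in z ((\<lambda>a. a + x) ` A) - count_in z A\<bar> < count_in z A"
      if "p \<in> Ms'" for p
      using bspec[OF m(5) subsetD[OF assms(5) that]] by (auto simp: case_prod_unfold intro!: le)
  qed
qed

lemma requirement_filter_nontrivial: "requirement_filter \<noteq> bot"
proof -
  have directed: "\<exists>r\<in>admissible. principal (satisfying r) \<le> inf (principal (satisfying p)) (principal (satisfying p'))"
    if p: "p \<in> admissible" "p' \<in> admissible" for p p'
  proof -
    obtain Y Fr Cs Ms K where p_eq: "p = (Y, Fr, Cs, Ms, K)" by (cases p) auto
    obtain Y' Fr' Cs' Ms' K' where p'_eq: "p' = (Y', Fr', Cs', Ms', K')" by (cases p') auto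
    let ?r = "(Y \<union> Y', Fr \<union> Fr', Cs \<union> Cs', Ms \<union> Ms', max K K')"
    have "?r \<in> admissible"
      using p by (auto simp: admissible_def p_eq p'_eq)
    moreover have "satisfying ?r \<subseteq> satisfying p \<inter> satisfying p'"
      by (auto simp: satisfying_def p_eq p'_eq elim!: meets_requirements_mono)
    ultimately show ?thesis
      by (intro bexI[of _ ?r]) auto
  qed
  have ne: "admissible \<noteq> {}"
  proof -
    have "({}, {}, {}, {}, 0) \<in> admissible" by (simp add: admissible_def)
    then show ?thesis by blast
  qed
  have "\<not> eventually (\<lambda>_. False) requirement_filter"
    unfolding requirement_filter_def
    by (subst eventually_INF_base[OF ne directed])
      (use satisfying_nonempty in \<open>auto simp: eventually_principal\<close>)
  then show ?thesis
    by (simp add: trivial_limit_def)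
qed

lemma eventually_requirement:
  assumes "(Y, Fr, Cs, Ms, K) \<in> admissible"
  shows "\<forall>\<^sub>F z in requirement_filter. meets_requirements Y Fr Cs Ms K (fset z)"
  unfolding requirement_filter_def
  by (rule eventually_INF1[OF assms]) (simp add: eventually_principal satisfying_def)

lemma eventually_mem: "\<forall>\<^sub>F z in requirement_filter. x |\<in>| z"
proof -
  have "({x}, {}, {}, {}, 0) \<in> admissible" by (simp add: admissible_def)
  from eventually_requirement[OF this] show ?thesis
    by eventually_elim (simp add: meets_requirements_def)
qed

lemma eventually_unit_cube_Suc:
  "\<forall>\<^sub>F z in requirement_filter. real K * count_in (fset z) (unit_cube i) < count_in (fset z) (unit_cube (Suc i))"
proof -
  have "({}, {}, {}, {}, max K (Suc i)) \<in> admissible" by (simp add: admissible_def)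
  from eventually_requirement[OF this] show ?thesis
  proof eventually_elim
    case (elim z)
    then have "meets_requirements {} {} {} {} (max K (Suc i)) (fset z)" .
    then have "real (max K (Suc i)) * count_in (fset z) (unit_cube i) < count_in (fset z) (unit_cube (Suc i))"
      unfolding meets_requirements_def by (meson less_Suc_eq less_max_iff_disj)
    moreover have "real K * count_in (fset z) (unit_cube i) \<le> real (max K (Suc i)) * count_in (fset z) (unit_cube i)"
      by (intro mult_right_mono) auto
    ultimately show ?case by linarith
  qed
qed

lemma eventually_unit_cube_less:
  assumes "i < j"
  shows "\<forall>\<^sub>F z in requirement_filter. real K * count_in (fset z) (unit_cube i) < count_in (fset z) (unit_cube j)"
  using assms
proof (induction j)
  case (Suc j)
  show ?case
  proof (cases "i = j")
    case True
    then show ?thesis using eventually_unit_cube_Suc by simp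
  next
    case False
    then have "i < j" using Suc.prems by simp
    then have IH: "\<forall>\<^sub>F z in requirement_filter. real K * count_in (fset z) (unit_cube i) < count_in (fset z) (unit_cube j)"
      by (rule Suc.IH)
    show ?thesis
      using IH eventually_unit_cube_Suc[of 1 j] by eventually_elim simp
  qed
qed simp

lemma eventually_volume:
  assumes "has_volume n A v"
  shows "\<forall>\<^sub>F z in requirement_filter.
    real K * \<bar>count_in (fset z) A - v * count_in (fset z) (unit_cube n)\<bar> < count_in (fset z) (unit_cube n)"
proof -
  have "({}, {(n, A, v)}, {}, {}, K) \<in> admissible"
    using assms by (simp add: admissible_def)
  from eventually_requirement[OF this] show ?thesis
    by eventually_elim (simp add: meets_requirements_def)
qed

lemma eventually_countable:
  assumes "countable C"
  shows "\<forall>\<^sub>F z in requirement_filter. real K * count_in (fset z) C < count_in (fset z) (unit_cube 1)"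
proof -
  have "({}, {}, {C}, {}, K) \<in> admissible"
    using assms by (simp add: admissible_def)
  from eventually_requirement[OF this] show ?thesis
    by eventually_elim (simp add: meets_requirements_def)
qed

lemma eventually_middling:
  assumes "A \<in> sets borel" "middling A"
  shows "\<forall>\<^sub>F z in requirement_filter.
    real K * \<bar>count_in (fset z) ((\<lambda>a. a + x) ` A) - count_in (fset z) A\<bar> < count_in (fset z) A"
proof -
  have "({}, {}, {}, {(A, x)}, K) \<in> admissible"
    using assms by (simp add: admissible_def)
  from eventually_requirement[OF this] show ?thesis
    by eventually_elim (simp add: meets_requirements_def)
qed

lemma pow_measure_eq: "pow_measure F A = pow_class F (\<lambda>z. count_in (fset z) A / real (fcard z))"
proof -
  have "(\<Sum>x\<in>fset z. indicator A x) = count_in (fset z) A" for z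
    by (simp add: sum.If_cases indicator_def Int_def)
  then show ?thesis
    by (simp add: pow_measure_def pow_integral_def)
qed

text \<open>
  Integer multiples are bounded in absolute value by natural multiples of \<open>\<bar>g z\<bar>\<close>; \<open>K = 0\<close> yields that \<open>h\<close> is
  positive.
\<close>

lemma much_less_pow_classI:
  assumes "\<And>K::nat. \<forall>\<^sub>F z in F. real K * \<bar>g z\<bar> < h z"
  shows "much_less F (pow_class F g) (pow_class F h)"
proof -
  have pos: "\<forall>\<^sub>F z in F. 0 < h z"
    using assms[of 0] by simp
  have "(\<forall>\<^sub>F z in F. - h z < of_int n * g z) \<and> (\<forall>\<^sub>F z in F. of_int n * g z < h z)" for n :: int
  proof -
    have "\<bar>of_int n * g z\<bar> = real (nat \<bar>n\<bar>) * \<bar>g z\<bar>" for z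
      by (simp add: abs_mult)
    then have "\<forall>\<^sub>F z in F. \<bar>of_int n * g z\<bar> < h z"
      using assms[of "nat \<bar>n\<bar>"] by simp
    then show ?thesis
      by (auto elim!: eventually_mono simp: abs_less_iff)
  qed
  then show ?thesis
    using pos
    by (simp add: much_less_def PowR_zero pow_const_def pow_class_mult pow_class_uminus pow_less_class_iff)
qed

lemma fcard_pos: "x |\<in>| z \<Longrightarrow> 0 < real (fcard z)"
  by (auto simp: fcard.rep_eq card_gt_0_iff)

lemma count_in_le_fcard: "count_in (fset z) A \<le> real (fcard z)"
  by (simp add: fcard.rep_eq card_mono)

lemma much_less_pow_measureI:
  assumes "\<And>K::nat. \<forall>\<^sub>F z in requirement_filter. real K * \<bar>g z\<bar> < h z"
  shows "much_less requirement_filter (pow_class requirement_filter (\<lambda>z. g z / real (fcard z)))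
    (pow_class requirement_filter (\<lambda>z. h z / real (fcard z)))"
proof (rule much_less_pow_classI)
  fix K :: nat
  show "\<forall>\<^sub>F z in requirement_filter. real K * \<bar>g z / real (fcard z)\<bar> < h z / real (fcard z)"
    using assms[of K] eventually_mem[of 0]
  proof eventually_elim
    case (elim z)
    then show ?case
      using fcard_pos[of 0 z] by (simp add: abs_divide divide_strict_right_mono)
  qed
qed

lemma infinitesimal_unit_cube:
  "infinitesimal requirement_filter (pow_measure requirement_filter (unit_cube i))"
  unfolding infinitesimal_def pow_measure_eq PowR_one
proof (rule much_less_pow_classI)
  fix K :: nat
  show "\<forall>\<^sub>F z in requirement_filter. real K * \<bar>count_in (fset z) (unit_cube i) / real (fcard z)\<bar> < 1"
    using eventually_unit_cube_Suc[of K i] eventually_mem[of 0]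
  proof eventually_elim
    case (elim z)
    then have "real K * count_in (fset z) (unit_cube i) < real (fcard z)"
      using count_in_le_fcard[of z "unit_cube (Suc i)"] by linarith
    then show ?case
      using fcard_pos[OF elim(2)] by (simp add: field_simps)
  qed
qed

lemma ratio_close_pow_classI:
  assumes "\<And>K::nat. \<forall>\<^sub>F z in F. real K * \<bar>g z - h z\<bar> < h z"
  shows "ratio_close F (pow_class F g) (pow_class F h)"
proof -
  interpret cring "PowR F" by (rule cring_PowR)
  have pos: "\<forall>\<^sub>F z in F. 0 < h z"
    using assms[of 0] by simp
  have inverse: "pow_class F h \<otimes>\<^bsub>PowR F\<^esub> pow_class F (\<lambda>z. 1 / h z) = \<one>\<^bsub>PowR F\<^esub>"
    unfolding pow_class_mult PowR_one pow_class_eq_iff using pos by eventually_elim simp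
  have unit: "pow_class F h \<in> Units (PowR F)"
    using inverse m_comm[of "pow_class F h" "pow_class F (\<lambda>z. 1 / h z)"]
    unfolding Units_def by (intro CollectI conjI bexI[of _ "pow_class F (\<lambda>z. 1 / h z)"]) auto
  have inv: "inv\<^bsub>PowR F\<^esub> (pow_class F h) = pow_class F (\<lambda>z. 1 / h z)"
    using inverse by (intro comm_inv_char) auto
  have "much_less F (pow_class F (\<lambda>z. g z * (1 / h z) + - 1)) (pow_class F (\<lambda>_. 1))"
  proof (rule much_less_pow_classI)
    fix K :: nat
    show "\<forall>\<^sub>F z in F. real K * \<bar>g z * (1 / h z) + - 1\<bar> < 1"
      using assms[of K] pos
    proof eventually_elim
      case (elim z)
      have "\<bar>g z * (1 / h z) + - 1\<bar> = \<bar>g z - h z\<bar> / h z"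
        using elim(2) by (simp add: field_simps flip: abs_divide) (simp add: abs_divide)
      then show ?case
        using elim by (simp add: field_simps)
    qed
  qed
  then show ?thesis
    using unit
    by (simp add: ratio_close_def inf_close_def infinitesimal_def inv a_minus_def PowR_one
        pow_class_mult pow_class_uminus pow_class_add)
qed

theorem theorem15:
  shows "\<exists>(\<Gamma> :: fseq fset filter) (\<epsilon> :: nat \<Rightarrow> (fseq fset \<Rightarrow> real) set).
    \<Gamma> \<noteq> bot \<and> fine_filter \<Gamma> \<and>
    (\<forall>i. \<epsilon> i \<in> carrier (PowR \<Gamma>) \<and> pow_less \<Gamma> \<zero>\<^bsub>PowR \<Gamma>\<^esub> (\<epsilon> i) \<and> infinitesimal \<Gamma> (\<epsilon> i)) \<and>
    (\<forall>i j. i < j \<longrightarrow> much_less \<Gamma> (\<epsilon> i) (\<epsilon> j)) \<and>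
    (\<forall>n. \<epsilon> n = pow_measure \<Gamma> (unit_cube n)) \<and>
    (\<forall>n S A v. piecewise_smooth_surface n S \<and> measurable_fragment n S A \<and> has_volume n A v \<longrightarrow>
      (\<exists>\<delta>\<in>carrier (PowR \<Gamma>).
        pow_measure \<Gamma> A = pow_const \<Gamma> v \<otimes>\<^bsub>PowR \<Gamma>\<^esub> \<epsilon> n \<oplus>\<^bsub>PowR \<Gamma>\<^esub> \<delta> \<and> much_less \<Gamma> \<delta> (\<epsilon> n))) \<and>
    (\<forall>C. countable C \<longrightarrow> much_less \<Gamma> (pow_measure \<Gamma> C) (\<epsilon> 1)) \<and>
    (\<forall>A x. A \<in> sets borel \<and> middling A \<longrightarrow>
      ratio_close \<Gamma> (pow_measure \<Gamma> ((\<lambda>a. a + x) ` A)) (pow_measure \<Gamma> A))"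
proof -
  let ?\<Gamma> = requirement_filter
  let ?\<epsilon> = "\<lambda>n. pow_measure ?\<Gamma> (unit_cube n)"
  have carrier: "?\<epsilon> i \<in> carrier (PowR ?\<Gamma>)" for i
    by (simp add: pow_measure_eq)
  have increasing: "much_less ?\<Gamma> (?\<epsilon> i) (?\<epsilon> j)" if "i < j" for i j
    unfolding pow_measure_eq using eventually_unit_cube_less[OF that]
    by (intro much_less_pow_measureI) simp
  have positive: "pow_less ?\<Gamma> \<zero>\<^bsub>PowR ?\<Gamma>\<^esub> (?\<epsilon> i)" for i
  proof -
    have "\<forall>\<^sub>F z in ?\<Gamma>. 0 < count_in (fset z) (unit_cube i) / real (fcard z)"
      using eventually_mem[of 0]
    proof eventually_elim
      case (elim z)
      then have "0 \<in> fset z \<inter> unit_cube i"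
        by (simp add: unit_cube_def Rn_zero)
      then have "0 < card (fset z \<inter> unit_cube i)"
        by (metis card_gt_0_iff empty_iff finite_Int finite_fset)
      then show ?case
        using fcard_pos[OF elim] by simp
    qed
    then show ?thesis
      by (simp add: pow_measure_eq PowR_zero pow_less_class_iff)
  qed
  have volume: "\<exists>\<delta>\<in>carrier (PowR ?\<Gamma>).
      pow_measure ?\<Gamma> A = pow_const ?\<Gamma> v \<otimes>\<^bsub>PowR ?\<Gamma>\<^esub> ?\<epsilon> n \<oplus>\<^bsub>PowR ?\<Gamma>\<^esub> \<delta> \<and> much_less ?\<Gamma> \<delta> (?\<epsilon> n)"
    if "has_volume n A v" for n A v
  proof (intro bexI conjI)
    let ?\<delta> = "pow_class ?\<Gamma> (\<lambda>z. (count_in (fset z) A - v * count_in (fset z) (unit_cube n)) / real (fcard z))"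
    show "pow_measure ?\<Gamma> A = pow_const ?\<Gamma> v \<otimes>\<^bsub>PowR ?\<Gamma>\<^esub> ?\<epsilon> n \<oplus>\<^bsub>PowR ?\<Gamma>\<^esub> ?\<delta>"
      by (simp add: pow_measure_eq pow_const_def pow_class_mult pow_class_add diff_divide_distrib)
    show "much_less ?\<Gamma> ?\<delta> (?\<epsilon> n)"
      unfolding pow_measure_eq using eventually_volume[OF that] by (rule much_less_pow_measureI)
  qed simp
  have countable: "much_less ?\<Gamma> (pow_measure ?\<Gamma> C) (?\<epsilon> 1)" if "countable C" for C
    unfolding pow_measure_eq using eventually_countable[OF that]
    by (intro much_less_pow_measureI) simp
  have middling: "ratio_close ?\<Gamma> (pow_measure ?\<Gamma> ((\<lambda>a. a + x) ` A)) (pow_measure ?\<Gamma> A)"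
    if "A \<in> sets borel" "middling A" for A x
    unfolding pow_measure_eq
  proof (rule ratio_close_pow_classI)
    fix K :: nat
    show "\<forall>\<^sub>F z in ?\<Gamma>. real K * \<bar>count_in (fset z) ((\<lambda>a. a + x) ` A) / real (fcard z) - count_in (fset z) A / real (fcard z)\<bar>
        < count_in (fset z) A / real (fcard z)"
      using eventually_middling[OF that, of K x] eventually_mem[of 0]
    proof eventually_elim
      case (elim z)
      then show ?case
        using fcard_pos[OF elim(2)]
        by (simp add: divide_strict_right_mono flip: diff_divide_distrib)
    qed
  qed
  have fine: "fine_filter ?\<Gamma>"
    by (simp add: fine_filter_def eventually_mem)
  show ?thesis
    by (intro exI[of _ ?\<Gamma>] exI[of _ ?\<epsilon>] conjI allI impI requirement_filter_nontrivial fine carrier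
        positive infinitesimal_unit_cube increasing refl) (use volume countable middling in auto)
qed

end
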